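(* Let $d \geq 2$ and let $E, F \subset \mathbb{R}^d$ have Hausdorff dimensions $s_E$ and $s_F$, respectively. Suppose that there exist Frostman measures $\mu_E$ and $\mu_F$, supported on $E$ and $F$ respectively, and non-negative numbers $\gamma_F$ and $l_F$, such that, for $\delta>0$ sufficiently small and $|\xi|$ sufficiently large: (i) $|\widehat{\mu}_F(\xi)| \lessapprox |\xi|^{-\gamma_F}$; and (ii) $\mu_F(T_\delta) \lessapprox \delta^{s_F - l_F}$ for every tube $T_\delta$ of length $\approx 1$ and radius $\approx \delta$ emanating from the origin. For each $y \in F$ define the projection set $\pi_y(E) = \{x \cdot y : x \in E\} \subset \mathbb{R}$. (a) If for some $0 < \alpha \leq 1$ $$\max\left\{ \frac{\min\{\gamma_F, s_E\}}{\alpha},\ \frac{s_E + s_F - l_F + 1 - \alpha}{d} \right\} > 1,$$ then $\dim_{\mathcal H}(\pi_y(E)) \geq \alpha$ for $\mu_F$-almost every $y \in F$. (b) If the displayed inequality holds with $\alpha = 1$, i.e. $\max\left\{ \min\{\gamma_F, s_E\},\ \frac{s_E+s_F-l_F}{d}\right\} > 1$, then $\mathcal{L}^1(\pi_y(E)) > 0$ for $\mu_F$-almost every $y \in F$.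
   Context: $\dim_{\mathcal H}$ is Hausdorff dimension, $\mathcal{L}^1$ is one-dimensional Lebesgue (outer) measure, and $x\cdot y$ is the Euclidean inner product. A Frostman measure on a set $E$ of Hausdorff dimension $s_E$ is a compactly supported Borel probability measure $\mu_E$ supported on $E$ such that $\mu_E(B(x,r)) \lessapprox r^{s_E}$ for all $x$ and all small $r>0$, that is, for every $\epsilon>0$ there is $C_\epsilon$ with $\mu_E(B(x,r)) \le C_\epsilon r^{s_E-\epsilon}$. Notation: $X \lesssim Y$ means $X \le CY$ for some constant $C>0$; $X \approx Y$ means $X \lesssim Y$ and $Y \lesssim X$. $X \lessapprox Y$ with controlling parameter $N$ means that for every $\epsilon>0$ there is $C_\epsilon>0$ with $X \le C_\epsilon N^\epsilon Y$; the controlling parameter is $|\xi|$ in (i), $\delta^{-1}$ in (ii), and $r^{-1}$ in the Frostman condition. Constants are uniform over all $\xi$, respectively over all tubes. A tube of length $\approx 1$ and radius $\approx\delta$ emanating from the origin is a neighborhood of radius $\approx \delta$ of a line segment of length $\approx 1$ having the origin as an endpoint. $\widehat{\mu}$ denotes the Fourier transform of the measure $\mu$.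
   Formalization: Part (a) additionally assumes that s_F > 0 or μ_F({0}) = 0; without this it fails, e.g. for F = {0}, μ_F the point mass at 0, s_F = γ_F = l_F = 0, E the closed unit ball, α = 1/2, where π_0(E) = {0} has dimension 0. *)

theory Defs
  imports "HOL-Probability.Probability"
begin

section \<open>Hausdorff measure and dimension\<close>

text \<open>
  The cases on the empty set and on \<open>s = 0\<close> make \<open>s = 0\<close> give counting measure
  (note \<open>0 powr 0 = 0\<close> in HOL).
\<close>

definition hausdorff_weight :: "real \<Rightarrow> 'a::metric_space set \<Rightarrow> ennreal" where
  "hausdorff_weight s U =
     (if U = {} then 0 else if s = 0 then 1 else ennreal (diameter U powr s))"

text \<open>
  Covering sets are required to be bounded because \<^const>\<open>diameter\<close> is meaningful only for those.
\<close>

definition hausdorff_premeasure :: "real \<Rightarrow> real \<Rightarrow> 'a::metric_space set \<Rightarrow> ennreal" where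
  "hausdorff_premeasure s \<delta> A =
     (INF U \<in> {U :: nat \<Rightarrow> 'a set.
         A \<subseteq> (\<Union>i. U i) \<and> (\<forall>i. bounded (U i) \<and> diameter (U i) \<le> \<delta>)}.
       \<Sum>i. hausdorff_weight s (U i))"

definition hausdorff_measure :: "real \<Rightarrow> 'a::metric_space set \<Rightarrow> ennreal" where
  "hausdorff_measure s A = (SUP \<delta> \<in> {0<..}. hausdorff_premeasure s \<delta> A)"

definition hausdorff_dim :: "'a::metric_space set \<Rightarrow> ereal" where
  "hausdorff_dim A = (INF s \<in> {s. 0 \<le> s \<and> hausdorff_measure s A = 0}. ereal s)"

section \<open>Borel measures on Euclidean space\<close>

definition measure_support :: "'a::topological_space measure \<Rightarrow> 'a set" where
  "measure_support M = {x. \<forall>U. open U \<and> x \<in> U \<longrightarrow> 0 < emeasure M U}"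

text \<open>
  A probability measure is supported on \<open>E\<close> if the complement of \<open>E\<close> is a null set, i.e. is
  contained in a Borel set of measure 0; \<open>E\<close> itself need not be Borel.
\<close>

definition frostman_measure :: "'a::euclidean_space set \<Rightarrow> real \<Rightarrow> 'a measure \<Rightarrow> bool" where
  "frostman_measure E s M \<longleftrightarrow>
     sets M = sets borel \<and> prob_space M \<and>
     compact (measure_support M) \<and> (AE x in M. x \<in> E) \<and>
     (\<forall>\<epsilon>>0. \<exists>C>0. \<forall>\<^sub>F r in at_right 0. \<forall>x.
        measure M (ball x r) \<le> C * (1 / r) powr \<epsilon> * r powr s)"

definition fourier_measure :: "'a::euclidean_space measure \<Rightarrow> 'a \<Rightarrow> complex" where
  "fourier_measure M \<xi> = (\<integral>x. cis (- 2 * pi * (x \<bullet> \<xi>)) \<partial>M)"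

text \<open>
  The tube of radius \<open>\<rho>\<close> and length \<open>norm v\<close> emanating from the origin in direction \<open>v\<close>.
\<close>

definition tube :: "'a::euclidean_space \<Rightarrow> real \<Rightarrow> 'a set" where
  "tube v \<rho> = (\<Union>p \<in> closed_segment 0 v. ball p \<rho>)"

definition projection_set :: "'a::euclidean_space \<Rightarrow> 'a set \<Rightarrow> real set" where
  "projection_set y E = (\<lambda>x. x \<bullet> y) ` E"

end

theory Submission
  imports Defs "HOL-Real_Asymp.Real_Asymp"
begin

text \<open>
  Let \<open>J \<delta>\<close> be the \<open>\<mu>\<^sub>F\<close>-average over \<open>y\<close> of the \<open>\<mu>\<^sub>E \<times> \<mu>\<^sub>E\<close>-mass of the pairs with
  \<open>\<bar>(x - x') \<bullet> y\<bar> \<le> \<delta>\<close>. A bound \<open>J \<delta> \<lesssim> \<delta> powr \<alpha>\<close> suffices: summing over dyadic \<open>\<delta>\<close> gives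
  the mass distribution principle on almost every projection, and for \<open>\<alpha> = 1\<close> Fatou's lemma and an
  \<open>L\<^sup>2\<close> argument show that a null set carries no mass of the projected measure.

  Under Fourier decay, \<open>\<mu>\<^sub>F\<close> gives the plate \<open>\<bar>z \<bullet> y\<bar> \<le> \<delta>\<close> mass \<open>\<lesssim> (\<delta> / \<bar>z\<bar>) powr \<alpha>\<close>, so
  \<open>J \<delta>\<close> is bounded by the Riesz \<open>\<alpha>\<close>-energy of \<open>\<mu>\<^sub>E\<close>. Under the tube condition, \<open>J \<delta>\<close> is
  dominated by a positive definite Gaussian in \<open>x - x'\<close>, whose Fourier transform is \<open>\<delta>\<close> times the
  \<open>\<mu>\<^sub>F\<close>-average of unit neighbourhoods of the lines \<open>\<real> y\<close> up to height \<open>1 / \<delta>\<close>. The tube condition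
  bounds it by \<open>\<delta> powr \<alpha> * \<bar>\<xi>\<bar> powr (- \<tau>)\<close> with \<open>\<tau> < s\<^sub>F - l\<^sub>F + 1 - \<alpha>\<close>, and
  \<open>\<integral> \<bar>\<xi>\<bar> powr (- \<tau>) * \<bar>fourier_measure \<mu>\<^sub>E \<xi>\<bar>\<^sup>2\<close> is finite as soon as \<open>\<tau> > d - s\<^sub>E\<close>.
\<close>

section \<open>Gaussian Fourier transforms\<close>

text \<open>The kernels must dominate the slab indicator and have a non-negative Fourier transform,
  so that upper bounds can be inserted under the frequency integral; Gaussians do both. A slab is
  unbounded, and its transform lives on the null set \<real> \<open>y\<close>. As \<open>muE\<close>
  has compact support, a second, unit-scale Gaussian in \<open>x - x'\<close> costs only a constant,
  and it thickens the line to its unit neighbourhood. The term 1 - \<alpha> in \<tau> is paid for by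
  the prefactor \<delta>: where \<delta> times the norm of \<xi> is at most 1, \<delta> is at most
  \<open>\<delta> powr \<alpha> * norm \<xi> powr (- (1 - \<alpha>))\<close>. All hypotheses carry
  \<epsilon>-losses and all inequalities between exponents are strict, so the proofs move to
  intermediate exponents, often midpoints, where clean power bounds hold. The constants of the tube
  argument blow up as \<open>y\<close> tends to 0, so it is run on
  \<open>{y. a \<le> norm y}\<close> for each \<open>a > 0\<close>, and the origin has to be a null
  set. For Lebesgue measure this comes for free: a Frostman exponent is at most the dimension, so
  the tube inequality at \<alpha> = 1 forces \<open>0 < sF\<close>.\<close>

lemma borel_measurable_cis [measurable (raw)]:
  "f \<in> borel_measurable M \<Longrightarrow> (\<lambda>x. cis (f x)) \<in> borel_measurable M"
  unfolding cis_conv_exp by measurable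

text \<open>The characteristic function of the standard normal distribution, written as a Lebesgue
  integral over its density and rescaled by \<open>x = s * t\<close>. The factor
  \<open>1 / s\<close> is the Jacobian and \<open>sqrt (2 * pi)\<close> removes the normalisation of
  the density.\<close>

lemma gaussian_fourier_real:
  fixes s u :: real
  assumes "s > 0"
  shows "has_bochner_integral lborel (\<lambda>t. complex_of_real (exp (- (s * t)\<^sup>2 / 2)) * cis (t * u))
           (complex_of_real (sqrt (2 * pi) / s * exp (- (u / s)\<^sup>2 / 2)))"
proof -
  have int: "integrable lborel (\<lambda>x. complex_of_real (std_normal_density x) * iexp (u / s * x))"
  proof (rule Bochner_Integration.integrable_bound)
    show "integrable lborel std_normal_density"
      by simp
  qed (auto simp: norm_mult)
  have "char std_normal_distribution (u / s)
      = (\<integral>x. complex_of_real (std_normal_density x) * iexp (u / s * x) \<partial>lborel)"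
    unfolding char_def by (subst integral_density) (auto simp: scaleR_conv_of_real normal_density_nonneg)
  then have "has_bochner_integral lborel (\<lambda>x. complex_of_real (std_normal_density x) * iexp (u / s * x))
      (complex_of_real (exp (- ((u / s)\<^sup>2) / 2)))"
    using int by (simp add: has_bochner_integral_iff char_std_normal_distribution)
  from lborel_has_bochner_integral_real_affine_iff[THEN iffD1, OF _ this, of s 0] assms
  have "has_bochner_integral lborel
      (\<lambda>x. complex_of_real (std_normal_density (s * x)) * iexp (u / s * (s * x)))
      (complex_of_real (exp (- ((u / s)\<^sup>2) / 2)) /\<^sub>R s)"
    by simp
  from has_bochner_integral_mult_right[OF this, of "complex_of_real (sqrt (2 * pi))"] assms
  show ?thesis
    by (simp add: std_normal_density_def cis_conv_exp scaleR_conv_of_real field_simps power_mult_distrib)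
qed

text \<open>Lebesgue measure is the image of the product measure over \<open>Basis\<close> under the
  coordinate map, so Fubini for finite products applies.\<close>

lemma has_bochner_integral_lborel_prod:
  fixes f :: "'a::euclidean_space \<Rightarrow> real \<Rightarrow> complex"
  assumes "\<And>b. b \<in> Basis \<Longrightarrow> has_bochner_integral lborel (f b) (I b)"
  shows "has_bochner_integral lborel (\<lambda>x. \<Prod>b\<in>Basis. f b (x \<bullet> b)) (\<Prod>b\<in>Basis. I b)"
proof -
  interpret product_sigma_finite "\<lambda>_::'a. lborel :: real measure"
    by standard
  have int: "\<And>b. b \<in> Basis \<Longrightarrow> integrable lborel (f b)"
    and I: "\<And>b. b \<in> Basis \<Longrightarrow> integral\<^sup>L lborel (f b) = I b"
    using assms by (auto simp: has_bochner_integral_iff)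
  have [measurable]: "b \<in> Basis \<Longrightarrow> f b \<in> borel_measurable borel" for b
    using int[of b] by auto
  have eq: "(\<Prod>b\<in>Basis. f b ((\<Sum>b\<in>Basis. p b *\<^sub>R b) \<bullet> b)) = (\<Prod>b\<in>Basis. f b (p b))" for p
    by (intro prod.cong) (auto simp: inner_sum_left_Basis)
  have lb: "lborel = distr (\<Pi>\<^sub>M b\<in>Basis. lborel) borel (\<lambda>f. \<Sum>b\<in>Basis. f b *\<^sub>R (b::'a))"
    by (subst lborel_def) (simp add: lborel_eq_real)
  have 1: "integrable (\<Pi>\<^sub>M b\<in>Basis. lborel) (\<lambda>p. \<Prod>b\<in>Basis. f b (p b))"
    by (rule product_integrable_prod) (auto intro: int)
  have 2: "(\<integral>p. (\<Prod>b\<in>Basis. f b (p b)) \<partial>(\<Pi>\<^sub>M b\<in>Basis. lborel)) = (\<Prod>b\<in>Basis. I b)"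
    by (subst product_integral_prod) (auto intro: int simp: I)
  have "has_bochner_integral (\<Pi>\<^sub>M b\<in>Basis. lborel)
      (\<lambda>p. \<Prod>b\<in>Basis. f b ((\<Sum>b\<in>Basis. p b *\<^sub>R b) \<bullet> b)) (\<Prod>b\<in>Basis. I b)"
    unfolding eq using 1 2 by (simp add: has_bochner_integral_iff)
  then show ?thesis
    by (subst lb, intro has_bochner_integral_distr) auto
qed

lemma norm_power2_eq_sum_Basis: "(norm x)\<^sup>2 = (\<Sum>b\<in>Basis. (x \<bullet> b)\<^sup>2)"
  unfolding power2_norm_eq_inner by (subst euclidean_inner) (simp add: power2_eq_square)

lemma cis_sum: "finite A \<Longrightarrow> cis (sum f A) = (\<Prod>a\<in>A. cis (f a))"
  by (induction A rule: finite_induct) (auto simp: cis_mult[symmetric])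

lemma gaussian_fourier:
  fixes z :: "'a::euclidean_space"
  assumes "s > 0"
  shows "has_bochner_integral lborel (\<lambda>\<xi>::'a. complex_of_real (exp (- (s * norm \<xi>)\<^sup>2 / 2)) * cis (\<xi> \<bullet> z))
           (complex_of_real ((sqrt (2 * pi) / s) ^ DIM('a) * exp (- (norm z / s)\<^sup>2 / 2)))"
proof -
  have "has_bochner_integral lborel
      (\<lambda>\<xi>::'a. \<Prod>b\<in>Basis. complex_of_real (exp (- (s * (\<xi> \<bullet> b))\<^sup>2 / 2)) * cis ((\<xi> \<bullet> b) * (z \<bullet> b)))
      (\<Prod>b\<in>Basis. complex_of_real (sqrt (2 * pi) / s * exp (- ((z \<bullet> b) / s)\<^sup>2 / 2)))"
    by (rule has_bochner_integral_lborel_prod) (rule gaussian_fourier_real[OF assms])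
  moreover have "(\<Prod>b\<in>Basis. complex_of_real (exp (- (s * (\<xi> \<bullet> b))\<^sup>2 / 2)) * cis ((\<xi> \<bullet> b) * (z \<bullet> b)))
      = complex_of_real (exp (- (s * norm \<xi>)\<^sup>2 / 2)) * cis (\<xi> \<bullet> z)" for \<xi> :: 'a
  proof -
    have "- (s * norm \<xi>)\<^sup>2 / 2 = (\<Sum>b\<in>Basis. - (s * (\<xi> \<bullet> b))\<^sup>2 / 2)"
      by (simp add: power_mult_distrib norm_power2_eq_sum_Basis sum_distrib_left sum_negf sum_divide_distrib)
    moreover have "\<xi> \<bullet> z = (\<Sum>b\<in>Basis. (\<xi> \<bullet> b) * (z \<bullet> b))"
      by (rule euclidean_inner)
    ultimately show ?thesis
      by (simp add: prod.distrib exp_sum cis_sum del: of_real_exp)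
  qed
  moreover have "(\<Prod>b\<in>Basis. complex_of_real (sqrt (2 * pi) / s * exp (- ((z \<bullet> b) / s)\<^sup>2 / 2)))
      = complex_of_real ((sqrt (2 * pi) / s) ^ DIM('a) * exp (- (norm z / s)\<^sup>2 / 2))"
  proof -
    have "- (norm z / s)\<^sup>2 / 2 = (\<Sum>b\<in>Basis. - ((z \<bullet> b) / s)\<^sup>2 / 2)"
      by (simp add: power_divide norm_power2_eq_sum_Basis sum_negf sum_divide_distrib)
    then have e: "exp (- (norm z / s)\<^sup>2 / 2) = (\<Prod>b\<in>Basis. exp (- ((z \<bullet> b) / s)\<^sup>2 / 2))"
      by (simp only: exp_sum[OF finite_Basis])
    show ?thesis
      unfolding e of_real_prod[symmetric] by (simp only: prod.distrib prod_constant)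
  qed
  ultimately show ?thesis
    by simp
qed

text \<open>Moving the centre to \<open>w\<close> produces the phase
  \<open>cis (w \<bullet> z)\<close>. Later \<open>w\<close> runs through the points
  \<open>t *\<^sub>R y\<close> of a line.\<close>

lemma gaussian_fourier_shift:
  fixes z w :: "'a::euclidean_space"
  assumes "s > 0"
  shows "has_bochner_integral lborel
           (\<lambda>\<xi>::'a. complex_of_real (exp (- (s * norm (\<xi> - w))\<^sup>2 / 2)) * cis (\<xi> \<bullet> z))
           (complex_of_real ((sqrt (2 * pi) / s) ^ DIM('a) * exp (- (norm z / s)\<^sup>2 / 2)) * cis (w \<bullet> z))"
proof -
  have "has_bochner_integral lborel
      (\<lambda>\<xi>::'a. complex_of_real (exp (- (s * norm \<xi>)\<^sup>2 / 2)) * cis (\<xi> \<bullet> z) * cis (w \<bullet> z))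
      (complex_of_real ((sqrt (2 * pi) / s) ^ DIM('a) * exp (- (norm z / s)\<^sup>2 / 2)) * cis (w \<bullet> z))"
    by (intro has_bochner_integral_mult_left gaussian_fourier assms)
  then have "has_bochner_integral lborel
      (\<lambda>\<xi>::'a. complex_of_real (exp (- (s * norm ((w + \<xi>) - w))\<^sup>2 / 2)) * cis ((w + \<xi>) \<bullet> z))
      (complex_of_real ((sqrt (2 * pi) / s) ^ DIM('a) * exp (- (norm z / s)\<^sup>2 / 2)) * cis (w \<bullet> z))"
    by (simp add: inner_add_left cis_mult[symmetric] ac_simps)
  then show ?thesis
    by (subst lborel_distr_plus[of w, symmetric], intro has_bochner_integral_distr) auto
qed

section \<open>Projections from small-scale mass\<close>

text \<open>The mass that the image of \<open>M\<close> under projection to \<open>y\<close> gives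
  to the closed interval of radius \<open>r\<close> about \<open>x \<bullet> y\<close>. As an
  integral of an indicator it is jointly measurable in \<open>x\<close> and \<open>y\<close> by the
  rules for parametrised integrals.\<close>

definition slab :: "'a::euclidean_space measure \<Rightarrow> 'a \<Rightarrow> real \<Rightarrow> 'a \<Rightarrow> ennreal" where
  "slab M y r x = (\<integral>\<^sup>+x'. indicator {..r} \<bar>(x - x') \<bullet> y\<bar> \<partial>M)"

lemma slab_eq_emeasure:
  assumes [measurable_cong]: "sets M = sets borel"
  shows "slab M y r x = emeasure M {x'. \<bar>(x - x') \<bullet> y\<bar> \<le> r}"
proof -
  have "slab M y r x = (\<integral>\<^sup>+x'. indicator {x'. \<bar>(x - x') \<bullet> y\<bar> \<le> r} x' \<partial>M)"
    unfolding slab_def by (intro nn_integral_cong) (auto split: split_indicator)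
  also have "\<dots> = emeasure M {x'. \<bar>(x - x') \<bullet> y\<bar> \<le> r}"
    by (subst nn_integral_indicator) (auto simp: assms)
  finally show ?thesis .
qed

lemma borel_measurable_slab:
  fixes f g :: "'b \<Rightarrow> 'a::euclidean_space"
  assumes "finite_measure M" and [measurable_cong]: "sets M = sets borel"
    and [measurable]: "f \<in> borel_measurable L" "g \<in> borel_measurable L"
  shows "(\<lambda>w. slab M (f w) r (g w)) \<in> borel_measurable L"
proof -
  interpret finite_measure M by fact
  show ?thesis
    unfolding slab_def by measurable
qed

lemma slab_mono: "r \<le> r' \<Longrightarrow> slab M y r x \<le> slab M y r' x"
  unfolding slab_def by (intro nn_integral_mono) (auto split: split_indicator)

lemma ex_dyadic_scale:
  fixes r :: real
  assumes "0 < r" "r \<le> 1"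
  obtains k :: nat where "(1/2) ^ Suc k < r" "r \<le> (1/2) ^ k"
proof -
  have ex: "\<exists>k. (1/2::real) ^ Suc k < r"
  proof -
    obtain n where "(1/2::real) ^ n < r"
      using real_arch_pow_inv[OF \<open>0 < r\<close>, of "1/2"] by auto
    moreover have "(1/2::real) ^ Suc n \<le> (1/2) ^ n" by simp
    ultimately show ?thesis using order_le_less_trans by blast
  qed
  define k where "k = (LEAST k. (1/2::real) ^ Suc k < r)"
  have "(1/2) ^ Suc k < r"
    unfolding k_def by (rule LeastI_ex[OF ex])
  moreover have "r \<le> (1/2) ^ k"
  proof (cases k)
    case (Suc m)
    then have "\<not> (1/2::real) ^ Suc m < r"
      unfolding k_def by (intro not_less_Least) auto
    then show ?thesis by (simp add: Suc)
  qed (use assms in auto)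
  ultimately show ?thesis by (rule that)
qed

text \<open>Monotonicity in \<open>r\<close> interpolates between dyadic scales; rounding
  \<open>r\<close> up to the next power of 1/2 at most doubles it, hence the factor
  \<open>2 powr \<beta>\<close>.\<close>

lemma slab_le_powr:
  assumes "0 < \<beta>" and bd: "\<And>k. ennreal ((2 powr \<beta>) ^ k) * slab M y ((1/2) ^ k) x \<le> ennreal c"
    and "0 \<le> c" "0 \<le> r" "r \<le> 1"
  shows "slab M y r x \<le> ennreal (c * 2 powr \<beta> * r powr \<beta>)"
proof -
  have *: "slab M y ((1/2) ^ k) x \<le> ennreal (c * (1 / 2 powr \<beta>) ^ k)" for k
  proof -
    have "slab M y ((1/2) ^ k) x
        = ennreal ((1 / 2 powr \<beta>) ^ k) * (ennreal ((2 powr \<beta>) ^ k) * slab M y ((1/2) ^ k) x)"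
      by (simp add: mult.assoc[symmetric] ennreal_mult[symmetric] power_mult_distrib[symmetric]
          del: power_mult_distrib)
    also have "\<dots> \<le> ennreal ((1 / 2 powr \<beta>) ^ k) * ennreal c"
      by (intro mult_left_mono bd) auto
    finally show ?thesis
      using \<open>0 \<le> c\<close> by (simp add: ennreal_mult[symmetric] mult.commute)
  qed
  show ?thesis
  proof (cases "r = 0")
    case False
    then obtain k where k: "(1/2) ^ Suc k < r" "r \<le> (1/2) ^ k"
      using ex_dyadic_scale[of r] \<open>0 \<le> r\<close> \<open>r \<le> 1\<close> by auto
    have "slab M y r x \<le> ennreal (c * (1 / 2 powr \<beta>) ^ k)"
      using slab_mono[OF k(2)] * order_trans by blast
    also have "\<dots> \<le> ennreal (c * (2 powr \<beta> * r powr \<beta>))"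
    proof (intro ennreal_leI mult_left_mono \<open>0 \<le> c\<close>)
      have "(1 / 2 powr \<beta>) ^ k = ((1/2::real) ^ k) powr \<beta>"
        by (simp add: powr_divide powr_powr powr_realpow[symmetric] powr_power mult.commute)
      also have "\<dots> \<le> (2 * r) powr \<beta>"
        using k(1) \<open>0 < \<beta>\<close> by (intro powr_mono2) auto
      finally show "(1 / 2 powr \<beta>) ^ k \<le> 2 powr \<beta> * r powr \<beta>"
        using \<open>0 \<le> r\<close> by (simp add: powr_mult)
    qed
    finally show ?thesis by (simp add: mult.assoc)
  next
    case True
    \<comment> \<open>Radius 0 matters because covers may contain sets of diameter 0; since
      \<open>0 powr \<beta> = 0\<close> the claim is that such a slab is null, which follows by
      letting the dyadic scale tend to 0.\<close>
    have "(\<lambda>k. ennreal (c * (1 / 2 powr \<beta>) ^ k)) \<longlonglongrightarrow> ennreal (c * 0)"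
      using \<open>0 < \<beta>\<close>
      by (intro tendsto_ennrealI tendsto_intros LIMSEQ_power_zero) (auto simp: field_simps)
    then have "slab M y 0 x \<le> ennreal (c * 0)"
      by (rule LIMSEQ_le_const) (auto intro!: exI[of _ 0] order_trans[OF slab_mono *])
    then show ?thesis using True by simp
  qed
qed

text \<open>Mass distribution principle for the projected measure, localised to the set
  \<open>A\<close> of good centres. A covering set that meets the projection of \<open>A\<close>
  lies in an interval about such a centre with radius its own diameter, so its mass is at most
  \<open>c\<close> times its weight; covers of arbitrarily small total weight exist.\<close>

lemma null_set_if_slab_le_powr:
  fixes E :: "'a::euclidean_space set"
  assumes "prob_space M" and setsM [measurable_cong]: "sets M = sets borel"
    and E: "AE x in M. x \<in> E"
    and A: "A \<in> sets M" and "0 \<le> c" and "0 \<le> s" "s < \<beta>"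
    and bd: "\<And>x r. x \<in> A \<Longrightarrow> 0 \<le> r \<Longrightarrow> r \<le> 1 \<Longrightarrow> slab M y r x \<le> ennreal (c * r powr \<beta>)"
    and H: "hausdorff_measure s (projection_set y E) = 0"
  shows "emeasure M A = 0"
proof -
  interpret prob_space M by fact
  let ?P = "projection_set y E"
  have "hausdorff_premeasure s 1 ?P \<le> hausdorff_measure s ?P"
    unfolding hausdorff_measure_def by (rule SUP_upper) auto
  then have pre: "hausdorff_premeasure s 1 ?P = 0"
    using H by simp
  have le: "emeasure M A \<le> ennreal c * ennreal e" if "e > 0" for e
  proof -
    have "hausdorff_premeasure s 1 ?P < ennreal e"
      using that pre by simp
    then obtain U :: "nat \<Rightarrow> real set" where cov: "?P \<subseteq> (\<Union>i. U i)"
      and U: "\<And>i. bounded (U i)" "\<And>i. diameter (U i) \<le> 1"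
      and e: "(\<Sum>i. hausdorff_weight s (U i)) < ennreal e"
      unfolding hausdorff_premeasure_def INF_less_iff by auto
    \<comment> \<open>The centre is chosen in \<open>A\<close>, since the slab bound is available
      only there.\<close>
    define p where "p i = (SOME x. x \<in> A \<and> x \<bullet> y \<in> U i)" for i
    define B where "B i = (if \<exists>x. x \<in> A \<and> x \<bullet> y \<in> U i
        then {x'. \<bar>(p i - x') \<bullet> y\<bar> \<le> diameter (U i)} else {})" for i
    have p: "p i \<in> A \<and> p i \<bullet> y \<in> U i" if "\<exists>x. x \<in> A \<and> x \<bullet> y \<in> U i" for i
      unfolding p_def using that by (rule someI_ex)
    have B [measurable]: "B i \<in> sets M" for i
      unfolding setsM B_def by auto
    have cover: "x \<in> (\<Union>i. B i)" if "x \<in> A" "x \<in> E" for x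
    proof -
      have "x \<bullet> y \<in> ?P"
        using that by (auto simp: projection_set_def)
      then obtain i where i: "x \<bullet> y \<in> U i"
        using cov by auto
      then have ex: "\<exists>x. x \<in> A \<and> x \<bullet> y \<in> U i"
        using that by auto
      have "dist (p i \<bullet> y) (x \<bullet> y) \<le> diameter (U i)"
        using i p[OF ex] U(1) by (intro diameter_bounded_bound) auto
      then have "x \<in> B i"
        using ex by (auto simp: B_def dist_real_def inner_diff_left)
      then show ?thesis by auto
    qed
    have wt: "emeasure M (B i) \<le> ennreal c * hausdorff_weight s (U i)" for i
    proof (cases "\<exists>x. x \<in> A \<and> x \<bullet> y \<in> U i")
      case True
      have d: "0 \<le> diameter (U i)" using U(1) by (rule diameter_ge_0)
      have "emeasure M (B i) = slab M y (diameter (U i)) (p i)"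
        using True by (simp add: B_def slab_eq_emeasure setsM)
      also have "\<dots> \<le> ennreal (c * diameter (U i) powr \<beta>)"
        using bd p[OF True] U(2)[of i] d by auto
      also have "\<dots> = ennreal c * ennreal (diameter (U i) powr \<beta>)"
        using \<open>0 \<le> c\<close> by (simp add: ennreal_mult)
      also have "\<dots> \<le> ennreal c * hausdorff_weight s (U i)"
      proof (rule mult_left_mono)
        have "diameter (U i) powr \<beta> \<le> diameter (U i) powr s"
          using d U(2)[of i] \<open>s < \<beta>\<close> by (intro powr_mono') auto
        \<comment> \<open>Needed for \<open>s = 0\<close>, where a non-empty set has weight 1 even
          if its diameter is 0.\<close>
        moreover have "diameter (U i) powr \<beta> \<le> 1"
          using d U(2)[of i] \<open>s < \<beta>\<close> \<open>0 \<le> s\<close> by (intro powr_le1) auto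
        ultimately show "ennreal (diameter (U i) powr \<beta>) \<le> hausdorff_weight s (U i)"
          using p[OF True] by (auto simp: hausdorff_weight_def intro: ennreal_leI)
      qed simp
      finally show ?thesis .
    qed (auto simp: B_def)
    have "AE x in M. x \<in> A \<longrightarrow> x \<in> (\<Union>i. B i)"
      using E by eventually_elim (use cover in blast)
    then have "emeasure M A \<le> emeasure M (\<Union>i. B i)"
      by (rule emeasure_mono_AE) auto
    also have "\<dots> \<le> (\<Sum>i. emeasure M (B i))"
      by (rule emeasure_subadditive_countably) auto
    also have "\<dots> \<le> (\<Sum>i. ennreal c * hausdorff_weight s (U i))"
      by (intro suminf_le wt) auto
    also have "\<dots> = ennreal c * (\<Sum>i. hausdorff_weight s (U i))"
      by simp
    also have "\<dots> \<le> ennreal c * ennreal e"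
      using e by (intro mult_left_mono) auto
    finally show ?thesis .
  qed
  have "measure M A \<le> 0"
  proof (rule field_le_epsilon)
    fix e :: real assume "e > 0"
    \<comment> \<open>Dividing by \<open>c + 1\<close> instead of \<open>c\<close> keeps the
      quotient meaningful for \<open>c = 0\<close>.\<close>
    have "emeasure M A \<le> ennreal c * ennreal (e / (c + 1))"
      using \<open>e > 0\<close> \<open>0 \<le> c\<close> by (intro le) auto
    also have "\<dots> = ennreal (c * (e / (c + 1)))"
      using \<open>0 \<le> c\<close> \<open>e > 0\<close> by (subst ennreal_mult) auto
    finally have "measure M A \<le> c * (e / (c + 1))"
      using \<open>0 \<le> c\<close> \<open>e > 0\<close> by (simp add: emeasure_eq_measure)
    also have "\<dots> \<le> e"
      using \<open>0 \<le> c\<close> \<open>e > 0\<close> by (simp add: field_simps)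
    finally show "measure M A \<le> 0 + e" by simp
  qed
  then show ?thesis
    by (simp add: emeasure_eq_measure measure_le_0_iff)
qed

text \<open>Each sublevel set of the dyadic sum bounds every single term, so it satisfies the power
  bound and is null if the projection has measure 0 in some dimension \<open>s < \<beta>\<close>.
  These countably many sets carry all the mass, a contradiction.\<close>

lemma hausdorff_dim_projection_ge:
  fixes E :: "'a::euclidean_space set"
  assumes "prob_space M" and setsM [measurable_cong]: "sets M = sets borel"
    and E: "AE x in M. x \<in> E" and "0 < \<beta>"
    and fin: "AE x in M. (\<Sum>k. ennreal ((2 powr \<beta>) ^ k) * slab M y ((1/2) ^ k) x) \<noteq> \<infinity>"
  shows "ereal \<beta> \<le> hausdorff_dim (projection_set y E)"
  unfolding hausdorff_dim_def
proof (rule INF_greatest)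
  fix s assume s: "s \<in> {s. 0 \<le> s \<and> hausdorff_measure s (projection_set y E) = 0}"
  interpret prob_space M by fact
  note [measurable (raw)] = borel_measurable_slab[OF finite_measure_axioms setsM]
  let ?S = "\<lambda>x. \<Sum>k. ennreal ((2 powr \<beta>) ^ k) * slab M y ((1/2) ^ k) x"
  have [measurable]: "?S \<in> borel_measurable M"
    by measurable
  define A where "A n = {x \<in> space M. ?S x \<le> of_nat n}" for n :: nat
  have A [measurable]: "A n \<in> sets M" for n
    unfolding A_def by measurable
  show "ereal \<beta> \<le> ereal s"
  proof (rule ccontr)
    assume "\<not> ereal \<beta> \<le> ereal s"
    then have "s < \<beta>" by simp
    have "emeasure M (A n) = 0" for n
    proof (rule null_set_if_slab_le_powr[where c = "real n * 2 powr \<beta>" and s = s and \<beta> = \<beta> and E = E])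
      fix x r assume x: "x \<in> A n" and r: "0 \<le> r" "r \<le> (1::real)"
      show "slab M y r x \<le> ennreal (real n * 2 powr \<beta> * r powr \<beta>)"
      proof (rule slab_le_powr[OF \<open>0 < \<beta>\<close> _ _ r])
        fix k
        have "ennreal ((2 powr \<beta>) ^ k) * slab M y ((1/2) ^ k) x \<le> ?S x"
          using sum_le_suminf[of "\<lambda>k. ennreal ((2 powr \<beta>) ^ k) * slab M y ((1/2) ^ k) x" "{k}"]
          by simp
        also have "\<dots> \<le> ennreal (real n)"
          using x by (simp add: A_def ennreal_of_nat_eq_real_of_nat)
        finally show "ennreal ((2 powr \<beta>) ^ k) * slab M y ((1/2) ^ k) x \<le> ennreal (real n)" .
      qed simp
    qed (use s \<open>s < \<beta>\<close> E setsM \<open>prob_space M\<close> A in auto)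
    then have "AE x in M. \<forall>n. x \<notin> A n"
      by (auto simp: AE_all_countable intro!: AE_not_in null_setsI)
    then have "AE x in M. False"
      using fin
    proof eventually_elim
      case (elim x)
      then obtain n where "?S x \<le> of_nat n"
        by (metis ennreal_Ex_less_of_nat infinity_ennreal_def less_imp_le top.not_eq_extremum)
      moreover have "x \<in> space M" using setsM sets_eq_imp_space_eq[OF setsM] by simp
      ultimately show False using elim by (auto simp: A_def)
    qed
    then show False by simp
  qed
qed

text \<open>For \<beta> < \<alpha> the integrated dyadic terms are dominated by a geometric series
  of ratio \<open>2 powr (\<beta> - \<alpha>)\<close>, so the sum is finite almost
  everywhere.\<close>

lemma AE_hausdorff_dim_projection_ge:
  fixes E :: "'a::euclidean_space set"
  assumes M: "prob_space M" and setsM [measurable_cong]: "sets M = sets borel"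
    and N: "finite_measure N" and setsN [measurable_cong]: "sets N = sets borel"
    and E: "AE x in M. x \<in> E" and "0 < \<alpha>"
    and bd: "\<And>\<delta>. 0 < \<delta> \<Longrightarrow> \<delta> \<le> 1 \<Longrightarrow> (\<integral>\<^sup>+y. \<integral>\<^sup>+x. slab M y \<delta> x \<partial>M \<partial>N) \<le> ennreal (C * \<delta> powr \<alpha>)"
  shows "AE y in N. ereal \<alpha> \<le> hausdorff_dim (projection_set y E)"
proof -
  interpret M: prob_space M by fact
  interpret N: finite_measure N by fact
  note [measurable (raw)] = borel_measurable_slab[OF M.finite_measure_axioms setsM]
  have *: "AE y in N. ereal \<beta> \<le> hausdorff_dim (projection_set y E)" if \<beta>: "0 < \<beta>" "\<beta> < \<alpha>" for \<beta>
  proof -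
    let ?S = "\<lambda>y x. \<Sum>k. ennreal ((2 powr \<beta>) ^ k) * slab M y ((1/2) ^ k) x"
    have [measurable]: "(\<lambda>(y, x). ?S y x) \<in> borel_measurable (N \<Otimes>\<^sub>M M)"
      by measurable
    have "(\<integral>\<^sup>+y. \<integral>\<^sup>+x. ?S y x \<partial>M \<partial>N)
        = (\<Sum>k. ennreal ((2 powr \<beta>) ^ k) * (\<integral>\<^sup>+y. \<integral>\<^sup>+x. slab M y ((1/2) ^ k) x \<partial>M \<partial>N))"
      by (simp add: nn_integral_suminf nn_integral_cmult)
    also have "\<dots> \<le> (\<Sum>k. ennreal (\<bar>C\<bar> * (2 powr (\<beta> - \<alpha>)) ^ k))"
    proof (intro suminf_le)
      fix k :: nat
      have "(\<integral>\<^sup>+y. \<integral>\<^sup>+x. slab M y ((1/2) ^ k) x \<partial>M \<partial>N) \<le> ennreal (C * ((1/2) ^ k) powr \<alpha>)"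
        by (rule bd) (auto simp: power_le_one)
      also have "\<dots> \<le> ennreal (\<bar>C\<bar> * ((1/2) ^ k) powr \<alpha>)"
        by (intro ennreal_leI mult_right_mono) auto
      finally have "ennreal ((2 powr \<beta>) ^ k) * (\<integral>\<^sup>+y. \<integral>\<^sup>+x. slab M y ((1/2) ^ k) x \<partial>M \<partial>N)
          \<le> ennreal ((2 powr \<beta>) ^ k) * ennreal (\<bar>C\<bar> * ((1/2) ^ k) powr \<alpha>)"
        by (rule mult_left_mono) simp
      also have "\<dots> = ennreal (\<bar>C\<bar> * ((2 powr \<beta>) ^ k * ((1/2) ^ k) powr \<alpha>))"
        by (simp add: ennreal_mult[symmetric] mult_ac)
      also have "(2 powr \<beta>) ^ k * ((1/2) ^ k) powr \<alpha> = (2 powr (\<beta> - \<alpha>)) ^ k"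
        by (simp add: powr_divide powr_power powr_diff powr_powr powr_realpow[symmetric] field_simps)
      finally show "ennreal ((2 powr \<beta>) ^ k) * (\<integral>\<^sup>+y. \<integral>\<^sup>+x. slab M y ((1/2) ^ k) x \<partial>M \<partial>N)
          \<le> ennreal (\<bar>C\<bar> * (2 powr (\<beta> - \<alpha>)) ^ k)" .
    qed auto
    also have "\<dots> < \<infinity>"
    proof -
      have "summable (\<lambda>k. \<bar>C\<bar> * (2 powr (\<beta> - \<alpha>)) ^ k)"
        using \<beta> by (intro summable_mult summable_geometric) (auto simp: powr_less_one)
      then show ?thesis
        by (simp add: suminf_ennreal2 less_top)
    qed
    finally have "AE y in N. (\<integral>\<^sup>+x. ?S y x \<partial>M) \<noteq> \<infinity>"
      by (intro nn_integral_PInf_AE) auto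
    then show ?thesis
    proof eventually_elim
      case (elim y)
      have "(\<lambda>x. ?S y x) \<in> borel_measurable M"
        by measurable
      from nn_integral_PInf_AE[OF this elim] show ?case
        by (intro hausdorff_dim_projection_ge[OF M setsM E \<beta>(1)])
    qed
  qed
  \<comment> \<open>Almost-everywhere statements combine only countably often, so \<beta> increases
    to \<alpha> along a sequence. The shift \<open>n + 2\<close> keeps every member strictly between
    0 and \<alpha>.\<close>
  have "AE y in N. \<forall>n. ereal (\<alpha> * (1 - 1 / real (n + 2))) \<le> hausdorff_dim (projection_set y E)"
    unfolding AE_all_countable using \<open>0 < \<alpha>\<close>
    by (intro allI *) (auto simp: field_simps intro!: add_pos_nonneg)
  then show ?thesis
  proof eventually_elim
    case (elim y)
    have "(\<lambda>n. ereal (\<alpha> * (1 - 1 / real (n + 2)))) \<longlonglongrightarrow> ereal (\<alpha> * (1 - 0))"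
      by (intro tendsto_ereal tendsto_intros)
         (use LIMSEQ_ignore_initial_segment[OF lim_1_over_n, of 2] in simp)
    from LIMSEQ_le_const2[OF this] show ?case
      using elim by auto
  qed
qed

text \<open>
  With \<open>h v\<close> the mass of the pushforward of \<open>M\<close> in the interval of length \<open>r\<close> about \<open>v\<close>, Fubini
  gives \<open>\<integral> h\<^sup>2 \<le> r \<integral> slab\<close> and \<open>r M {x. x \<bullet> y \<in> O\<^sub>r} \<le> \<integral> h\<close> over \<open>O\<close>, where \<open>O\<^sub>r\<close> is the \<open>r\<close>-interior of
  \<open>O\<close>; AM-GM combines the two.
\<close>

lemma emeasure_inner_part_le:
  fixes y :: "'a::euclidean_space"
  assumes M: "prob_space M" and setsM [measurable_cong]: "sets M = sets borel"
    and "open S" and S: "emeasure lborel S \<le> ennreal (t\<^sup>2)" and "0 < t" "0 < r" "0 \<le> K"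
    and K: "(\<integral>\<^sup>+x. slab M y r x \<partial>M) \<le> ennreal (K * r)"
  shows "emeasure M {x. r \<le> infdist (x \<bullet> y) (- S)} \<le> ennreal (t * (1 + K))"
proof -
  interpret prob_space M by fact
  have [measurable]: "S \<in> sets borel" using \<open>open S\<close> by simp
  note [measurable (raw)] = borel_measurable_slab[OF finite_measure_axioms setsM]
  \<comment> \<open>The radius is \<open>r / 2\<close>, so that two points over the same interval
    have projections at distance at most \<open>r\<close>, which is the slab condition.\<close>
  define bal :: "'a \<Rightarrow> real \<Rightarrow> ennreal" where "bal x v = indicator {x'. \<bar>x' \<bullet> y - v\<bar> \<le> r / 2} x" for x v
  have [measurable (raw)]: "(\<lambda>w. bal (f w) (g w)) \<in> borel_measurable L"
    if [measurable]: "f \<in> borel_measurable L" "g \<in> borel_measurable L"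
    for f g and L :: "'c measure"
    unfolding bal_def indicator_def by measurable
  have interval: "\<bar>u - v\<bar> \<le> r / 2 \<longleftrightarrow> v \<in> {u - r / 2 .. u + r / 2}" for u v
    unfolding atLeastAtMost_iff abs_le_iff by linarith
  have near: "\<bar>a - b\<bar> \<le> r" if "\<bar>a - v\<bar> \<le> r / 2" "\<bar>b - v\<bar> \<le> r / 2" for a b v :: real
    using that by linarith
  have length: "(\<integral>\<^sup>+v. bal x v \<partial>lborel) = ennreal r" for x
  proof -
    have "(\<integral>\<^sup>+v. bal x v \<partial>lborel) = (\<integral>\<^sup>+v. indicator {x \<bullet> y - r / 2 .. x \<bullet> y + r / 2} v \<partial>lborel)"
      by (intro nn_integral_cong) (simp only: bal_def indicator_def mem_Collect_eq interval)
    then show ?thesis using \<open>0 < r\<close> by simp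
  qed
  define h where "h v = (\<integral>\<^sup>+x. bal x v \<partial>M)" for v
  have [measurable]: "h \<in> borel_measurable borel"
    unfolding h_def by measurable
  have h_le: "h v \<le> 1" for v
  proof -
    have "h v \<le> (\<integral>\<^sup>+x. 1 \<partial>M)"
      unfolding h_def bal_def by (intro nn_integral_mono) (auto split: split_indicator)
    then show ?thesis by (simp add: emeasure_space_1)
  qed
  have sq: "(\<integral>\<^sup>+v. h v * h v \<partial>lborel) \<le> ennreal r * (\<integral>\<^sup>+x. slab M y r x \<partial>M)"
  proof -
    have "h v * h v = (\<integral>\<^sup>+x. \<integral>\<^sup>+x'. bal x v * bal x' v \<partial>M \<partial>M)" for v
      unfolding h_def by (subst nn_integral_cmult) (auto simp: nn_integral_multc)
    then have "(\<integral>\<^sup>+v. h v * h v \<partial>lborel)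
        = (\<integral>\<^sup>+v. \<integral>\<^sup>+x. \<integral>\<^sup>+x'. bal x v * bal x' v \<partial>M \<partial>M \<partial>lborel)"
      by simp
    also have "\<dots> \<le> (\<integral>\<^sup>+v. \<integral>\<^sup>+x. \<integral>\<^sup>+x'. bal x v * indicator {..r} \<bar>(x - x') \<bullet> y\<bar> \<partial>M \<partial>M \<partial>lborel)"
    proof (intro nn_integral_mono)
      fix v x x'
      show "bal x v * bal x' v \<le> bal x v * indicator {..r} \<bar>(x - x') \<bullet> y\<bar>"
        using near[of "x \<bullet> y" v "x' \<bullet> y"] by (simp add: bal_def indicator_def inner_diff_left)
    qed
    also have "\<dots> = (\<integral>\<^sup>+v. \<integral>\<^sup>+x. bal x v * slab M y r x \<partial>M \<partial>lborel)"
      unfolding slab_def by (simp add: nn_integral_cmult)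
    also have "\<dots> = (\<integral>\<^sup>+x. \<integral>\<^sup>+v. bal x v * slab M y r x \<partial>lborel \<partial>M)"
    proof -
      interpret pair_sigma_finite M lborel ..
      show ?thesis
        by (intro Fubini') measurable
    qed
    also have "\<dots> = (\<integral>\<^sup>+x. ennreal r * slab M y r x \<partial>M)"
      by (simp add: nn_integral_multc length)
    also have "\<dots> = ennreal r * (\<integral>\<^sup>+x. slab M y r x \<partial>M)"
      by (simp add: nn_integral_cmult)
    finally show ?thesis .
  qed
  let ?A = "{x. r \<le> infdist (x \<bullet> y) (- S)}"
  have [measurable]: "?A \<in> sets borel"
    by (intro borel_closed closed_Collect_le continuous_intros)
  have "ennreal r * emeasure M ?A = (\<integral>\<^sup>+x. indicator ?A x * (\<integral>\<^sup>+v. bal x v \<partial>lborel) \<partial>M)"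
    unfolding length by (subst nn_integral_multc) (simp_all add: mult.commute setsM)
  also have "\<dots> = (\<integral>\<^sup>+x. \<integral>\<^sup>+v. indicator ?A x * bal x v \<partial>lborel \<partial>M)"
    by (simp add: nn_integral_cmult)
  \<comment> \<open>A point whose projection has distance at least \<open>r\<close> from the
    complement of \<open>S\<close> keeps its whole interval of radius \<open>r / 2\<close> inside
    \<open>S\<close>.\<close>
  also have "\<dots> \<le> (\<integral>\<^sup>+x. \<integral>\<^sup>+v. indicator S v * bal x v \<partial>lborel \<partial>M)"
  proof (intro nn_integral_mono)
    fix x v
    show "indicator ?A x * bal x v \<le> indicator S v * bal x v"
    proof (cases "v \<in> S \<or> x \<notin> ?A")
      case False
      then have "r \<le> dist (x \<bullet> y) v"
        using infdist_le[of v "- S" "x \<bullet> y"] by auto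
      then have "\<not> \<bar>x \<bullet> y - v\<bar> \<le> r / 2"
        using \<open>0 < r\<close> unfolding dist_real_def by linarith
      then show ?thesis
        by (simp add: bal_def indicator_def)
    qed (auto simp: indicator_def)
  qed
  also have "\<dots> = (\<integral>\<^sup>+v. \<integral>\<^sup>+x. indicator S v * bal x v \<partial>M \<partial>lborel)"
  proof -
    interpret pair_sigma_finite M lborel ..
    show ?thesis
      by (intro Fubini'[symmetric]) measurable
  qed
  also have "\<dots> = (\<integral>\<^sup>+v. indicator S v * h v \<partial>lborel)"
    unfolding h_def by (simp add: nn_integral_cmult)
  also have "\<dots> \<le> (\<integral>\<^sup>+v. ennreal (r / t) * indicator S v + ennreal (t / r) * (h v * h v) \<partial>lborel)"
  proof (intro nn_integral_mono)
    fix v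
    obtain a where a: "h v = ennreal a" "0 \<le> a"
      using h_le[of v] by (metis ennreal_cases ennreal_one_neq_top top.extremum_unique)
    \<comment> \<open>The weights are balanced for the two known bounds: \<open>S\<close> has
      measure at most \<open>t\<^sup>2\<close> and the integral of \<open>h * h\<close> is at most
      \<open>K * r\<^sup>2\<close>, so the two terms become \<open>r * t\<close> and
      \<open>K * r * t\<close>.\<close>
    have "a \<le> r / t + t / r * (a * a)"
    proof -
      have "0 \<le> (t / r) * (a - r / (2 * t))\<^sup>2"
        using \<open>0 < t\<close> \<open>0 < r\<close> by simp
      also have "\<dots> = t / r * (a * a) - a + r / (4 * t)"
        using \<open>0 < t\<close> \<open>0 < r\<close> by (simp add: field_simps power2_eq_square)
      finally have "a \<le> r / (4 * t) + t / r * (a * a)" by linarith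
      moreover have "r / (4 * t) \<le> r / t"
        using \<open>0 < t\<close> \<open>0 < r\<close> by (simp add: field_simps)
      ultimately show ?thesis by linarith
    qed
    then have "ennreal a \<le> ennreal (r / t) + ennreal (t / r) * (ennreal a * ennreal a)"
      using \<open>0 < t\<close> \<open>0 < r\<close> a by (simp add: ennreal_mult[symmetric] ennreal_plus[symmetric] ennreal_leI del: ennreal_plus)
    then show "indicator S v * h v \<le> ennreal (r / t) * indicator S v + ennreal (t / r) * (h v * h v)"
      using a by (cases "v \<in> S") simp_all
  qed
  also have "\<dots> = ennreal (r / t) * emeasure lborel S + ennreal (t / r) * (\<integral>\<^sup>+v. h v * h v \<partial>lborel)"
    by (simp add: nn_integral_add nn_integral_cmult)
  also have "\<dots> \<le> ennreal (r / t) * ennreal (t\<^sup>2) + ennreal (t / r) * (ennreal r * ennreal (K * r))"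
    by (intro add_mono mult_left_mono S order_trans[OF sq] K) auto
  also have "\<dots> = ennreal (r * (t * (1 + K)))"
    using \<open>0 < t\<close> \<open>0 < r\<close> \<open>0 \<le> K\<close>
    by (simp add: ennreal_mult[symmetric] ennreal_plus[symmetric] power2_eq_square field_simps del: ennreal_plus)
  also have "\<dots> = ennreal r * ennreal (t * (1 + K))"
    using \<open>0 < t\<close> \<open>0 < r\<close> \<open>0 \<le> K\<close> by (simp add: ennreal_mult)
  finally show ?thesis
    using \<open>0 < r\<close> by (subst (asm) ennreal_mult_le_mult_iff) auto
qed

text \<open>If the projection were null, an open set of measure below \<open>t\<^sup>2\<close> would
  contain it, and the inner parts of that set would exhaust the mass of \<open>M\<close>. Each inner
  part has mass at most \<open>t * (1 + K)\<close>, which is impossible for small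
  \<open>t\<close>.\<close>

lemma outer_measure_projection_pos:
  fixes E :: "'a::euclidean_space set"
  assumes M: "prob_space M" and setsM [measurable_cong]: "sets M = sets borel"
    and E: "AE x in M. x \<in> E"
    and fin: "liminf (\<lambda>k. ennreal (2 ^ k) * (\<integral>\<^sup>+x. slab M y ((1/2) ^ k) x \<partial>M)) \<noteq> \<infinity>"
  shows "0 < outer_measure_of lborel (projection_set y E)"
proof (rule ccontr)
  interpret prob_space M by fact
  let ?P = "projection_set y E"
  assume "\<not> ?thesis"
  then have zero: "outer_measure_of lborel ?P = 0" by simp
  define L where "L = liminf (\<lambda>k. ennreal (2 ^ k) * (\<integral>\<^sup>+x. slab M y ((1/2) ^ k) x \<partial>M))"
  have "L < top"
    using fin by (simp add: L_def top.not_eq_extremum)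
  then obtain n where "L < of_nat n"
    using ennreal_Ex_less_of_nat[of L] by blast
  then obtain K where K: "0 \<le> K" "liminf (\<lambda>k. ennreal (2 ^ k) * (\<integral>\<^sup>+x. slab M y ((1/2) ^ k) x \<partial>M)) < ennreal K"
    by (intro that[of "real n"]) (simp_all add: L_def ennreal_of_nat_eq_real_of_nat)
  \<comment> \<open>A finite liminf controls only infinitely many scales. That suffices, because the
    sets \<open>A j\<close> below increase with \<open>j\<close>.\<close>
  have freq: "\<exists>k\<ge>j. (\<integral>\<^sup>+x. slab M y ((1/2) ^ k) x \<partial>M) \<le> ennreal (K * (1/2) ^ k)" for j
  proof (rule ccontr)
    assume "\<not> ?thesis"
    then have gt: "ennreal (K * (1/2) ^ k) < (\<integral>\<^sup>+x. slab M y ((1/2) ^ k) x \<partial>M)" if "k \<ge> j" for k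
      using that by (meson not_le)
    have "ennreal K \<le> ennreal (2 ^ k) * (\<integral>\<^sup>+x. slab M y ((1/2) ^ k) x \<partial>M)" if "k \<ge> j" for k
    proof -
      have "ennreal K = ennreal (2 ^ k) * ennreal (K * (1/2) ^ k)"
        using K(1) by (simp add: ennreal_mult[symmetric] power_one_over field_simps)
      also have "\<dots> \<le> ennreal (2 ^ k) * (\<integral>\<^sup>+x. slab M y ((1/2) ^ k) x \<partial>M)"
        using gt[OF that] by (intro mult_left_mono) auto
      finally show ?thesis .
    qed
    then have "ennreal K \<le> liminf (\<lambda>k. ennreal (2 ^ k) * (\<integral>\<^sup>+x. slab M y ((1/2) ^ k) x \<partial>M))"
      by (intro Liminf_bounded eventually_sequentiallyI[of j]) auto
    then show False using K(2) by simp
  qed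
  have bound: "1 \<le> t * (1 + K)" if "t > 0" for t
  proof -
    obtain B where B: "B \<in> sets lborel" "?P \<subseteq> B" "emeasure lborel B = 0"
      using outer_measure_of_attain[of ?P lborel] zero by auto
    obtain S where S: "open S" "B \<subseteq> S" "emeasure lborel (S - B) < ennreal (t\<^sup>2)"
      using outer_regular_lborel[of B "t\<^sup>2"] B(1) \<open>t > 0\<close> by auto
    have "emeasure lborel S \<le> emeasure lborel B + emeasure lborel (S - B)"
      using S B by (metis Diff_partition emeasure_subadditive borel_open sets.Diff sets_lborel)
    then have Sm: "emeasure lborel S \<le> ennreal (t\<^sup>2)"
      using S(3) B(3) by auto
    \<comment> \<open>\<open>infdist\<close> to the empty set is 0 by convention, which would make
      the inner parts of \<open>UNIV\<close> empty.\<close>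
    have "S \<noteq> UNIV"
      using Sm by (auto simp: emeasure_lborel_UNIV top_unique)
    then have nonempty: "- S \<noteq> {}" by blast
    define A where "A j = {x. (1/2) ^ j \<le> infdist (x \<bullet> y) (- S)}" for j :: nat
    have Ac [measurable]: "A j \<in> sets M" for j
      unfolding A_def setsM by (intro borel_closed closed_Collect_le continuous_intros)
    have incseq: "incseq A"
      unfolding A_def incseq_def
      by (auto intro: order_trans[OF power_decreasing])
    have Aj: "emeasure M (A j) \<le> ennreal (t * (1 + K))" for j
    proof -
      obtain k where "k \<ge> j" and k: "(\<integral>\<^sup>+x. slab M y ((1/2) ^ k) x \<partial>M) \<le> ennreal (K * (1/2) ^ k)"
        using freq by blast
      have "emeasure M (A j) \<le> emeasure M (A k)"
        using incseq \<open>k \<ge> j\<close> by (intro emeasure_mono) (auto simp: incseq_def)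
      also have "\<dots> \<le> ennreal (t * (1 + K))"
        unfolding A_def
        by (rule emeasure_inner_part_le[OF M setsM S(1) Sm \<open>t > 0\<close> _ K(1) k]) auto
      finally show ?thesis .
    qed
    have "1 = emeasure M (space M)" by (simp add: emeasure_space_1)
    also have "\<dots> \<le> emeasure M (\<Union>j. A j)"
    proof (rule emeasure_mono_AE)
      show "AE x in M. x \<in> space M \<longrightarrow> x \<in> (\<Union>j. A j)"
        using E
      proof eventually_elim
        case (elim x)
        then have "x \<bullet> y \<in> S"
          using B(2) S(2) by (auto simp: projection_set_def)
        then have "infdist (x \<bullet> y) (- S) > 0"
          using in_closed_iff_infdist_zero[of "- S" "x \<bullet> y"] nonempty S(1) infdist_nonneg[of "x \<bullet> y" "- S"]
          by (auto simp: less_le)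
        then obtain j where "(1/2) ^ j < infdist (x \<bullet> y) (- S)"
          using real_arch_pow_inv[of "infdist (x \<bullet> y) (- S)" "1/2"] by auto
        then show ?case by (auto simp: A_def intro!: exI[of _ j])
      qed
    qed auto
    also have "\<dots> = (SUP j. emeasure M (A j))"
      using incseq by (intro SUP_emeasure_incseq[symmetric]) auto
    also have "\<dots> \<le> ennreal (t * (1 + K))"
      by (intro SUP_least Aj)
    finally show ?thesis by simp
  qed
  from bound[of "1 / (2 * (1 + K))"] K(1) show False
    by (simp add: field_simps)
qed

text \<open>At exponent 1 the normalised dyadic terms are bounded in mean but need not be summable,
  so Fatou's lemma takes the place of the geometric series.\<close>

lemma AE_outer_measure_projection_pos:
  fixes E :: "'a::euclidean_space set"
  assumes M: "prob_space M" and setsM [measurable_cong]: "sets M = sets borel"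
    and N: "finite_measure N" and setsN [measurable_cong]: "sets N = sets borel"
    and E: "AE x in M. x \<in> E"
    and bd: "\<And>\<delta>. 0 < \<delta> \<Longrightarrow> \<delta> \<le> 1 \<Longrightarrow> (\<integral>\<^sup>+y. \<integral>\<^sup>+x. slab M y \<delta> x \<partial>M \<partial>N) \<le> ennreal (C * \<delta>)"
  shows "AE y in N. 0 < outer_measure_of lborel (projection_set y E)"
proof -
  interpret M: prob_space M by fact
  interpret N: finite_measure N by fact
  note [measurable (raw)] = borel_measurable_slab[OF M.finite_measure_axioms setsM]
  let ?L = "\<lambda>k y. ennreal (2 ^ k) * (\<integral>\<^sup>+x. slab M y ((1/2) ^ k) x \<partial>M)"
  have "(\<integral>\<^sup>+y. liminf (\<lambda>k. ?L k y) \<partial>N) \<le> liminf (\<lambda>k. \<integral>\<^sup>+y. ?L k y \<partial>N)"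
    by (rule nn_integral_liminf) auto
  also have "\<dots> \<le> ennreal C"
  proof (rule Liminf_le)
    have "(\<integral>\<^sup>+y. ?L k y \<partial>N) \<le> ennreal C" for k
    proof -
      have "(\<integral>\<^sup>+y. ?L k y \<partial>N) = ennreal (2 ^ k) * (\<integral>\<^sup>+y. \<integral>\<^sup>+x. slab M y ((1/2) ^ k) x \<partial>M \<partial>N)"
        by (rule nn_integral_cmult) measurable
      also have "\<dots> \<le> ennreal (2 ^ k) * ennreal (C * (1/2) ^ k)"
        by (intro mult_left_mono bd) (auto simp: power_le_one)
      also have "\<dots> = ennreal C"
        by (simp add: ennreal_mult'[symmetric] power_one_over field_simps)
      finally show ?thesis .
    qed
    then show "\<forall>\<^sub>F k in sequentially. (\<integral>\<^sup>+y. ?L k y \<partial>N) \<le> ennreal C"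
      by simp
  qed simp
  also have "\<dots> < \<infinity>" by simp
  finally have "AE y in N. liminf (\<lambda>k. ?L k y) \<noteq> \<infinity>"
    by (intro nn_integral_PInf_AE) auto
  then show ?thesis
    by eventually_elim (rule outer_measure_projection_pos[OF M setsM E])
qed

section \<open>Frostman measures and Riesz energy\<close>

text \<open>Taking \<epsilon> = \<open>s - t\<close> turns the lossy bound into a clean power for
  small radii. Radii above the threshold \<open>R\<close> are covered by total mass 1, at the price
  of the constant \<open>(1 / R) powr t\<close>.\<close>

lemma frostman_ball_le:
  assumes "frostman_measure E s M" "0 \<le> t" "t < s"
  obtains C where "0 < C" "\<And>x r. 0 < r \<Longrightarrow> measure M (ball x r) \<le> C * r powr t"
proof -
  interpret prob_space M
    using assms(1) unfolding frostman_measure_def by blast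
  have "\<forall>\<epsilon>>0. \<exists>C>0. \<forall>\<^sub>F r in at_right 0. \<forall>x. measure M (ball x r) \<le> C * (1 / r) powr \<epsilon> * r powr s"
    using assms(1) unfolding frostman_measure_def by blast
  then obtain C where "C > 0" and
    "\<forall>\<^sub>F r in at_right 0. \<forall>x. measure M (ball x r) \<le> C * (1 / r) powr (s - t) * r powr s"
    using assms(3) by (meson diff_gt_0_iff_gt)
  then obtain R where "R > 0" and
    R: "\<And>r x. 0 < r \<Longrightarrow> r < R \<Longrightarrow> measure M (ball x r) \<le> C * (1 / r) powr (s - t) * r powr s"
    unfolding eventually_at_right_field by auto
  show ?thesis
  proof
    show "0 < C + (1 / R) powr t"
      using \<open>C > 0\<close> by (simp add: add_pos_nonneg)
    fix x and r :: real assume "0 < r"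
    show "measure M (ball x r) \<le> (C + (1 / R) powr t) * r powr t"
    proof (cases "r < R")
      case True
      have "measure M (ball x r) \<le> C * (1 / r) powr (s - t) * r powr s"
        using R \<open>0 < r\<close> True by blast
      also have "\<dots> = C * r powr t"
        using \<open>0 < r\<close> by (simp add: powr_divide powr_diff)
      finally show ?thesis
        by (simp add: distrib_right add_increasing2)
    next
      case False
      have "1 \<le> (r / R) powr t"
        using False \<open>R > 0\<close> \<open>0 \<le> t\<close> by (intro ge_one_powr_ge_zero) auto
      also have "\<dots> = (1 / R) powr t * r powr t"
        using \<open>R > 0\<close> \<open>0 < r\<close> by (simp add: powr_divide)
      finally have "1 \<le> (1 / R) powr t * r powr t" .
      then show ?thesis
        using prob_le_1[of "ball x r"] \<open>C > 0\<close> unfolding distrib_right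
        by (intro add_increasing order_trans[OF prob_le_1]) auto
    qed
  qed
qed

lemma frostman_singleton_null:
  assumes F: "frostman_measure E s M" and "0 < s"
  shows "measure M {x} = 0"
proof -
  interpret prob_space M
    using F unfolding frostman_measure_def by blast
  have setsM: "sets M = sets borel"
    using F unfolding frostman_measure_def by blast
  obtain C where C: "\<And>x r. 0 < r \<Longrightarrow> measure M (ball x r) \<le> C * r powr (s / 2)"
    by (rule frostman_ball_le[OF F, of "s / 2"]) (use \<open>0 < s\<close> in auto)
  have "measure M {x} \<le> C * 0"
  proof (rule tendsto_lowerbound)
    have "\<forall>\<^sub>F r in at_right 0. 0 \<le> (r::real)"
      unfolding eventually_at_right_field by (intro exI[of _ 1]) auto
    then show "((\<lambda>r. C * r powr (s / 2)) \<longlongrightarrow> C * 0) (at_right 0)"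
      using \<open>0 < s\<close> by (auto intro!: tendsto_eq_intros)
    show "\<forall>\<^sub>F r in at_right 0. measure M {x} \<le> C * r powr (s / 2)"
      unfolding eventually_at_right_field
    proof (intro exI[of _ 1] conjI allI impI)
      fix r :: real assume "0 < r"
      then have "measure M {x} \<le> measure M (ball x r)"
        by (intro finite_measure_mono) (auto simp: setsM)
      then show "measure M {x} \<le> C * r powr (s / 2)"
        using C[OF \<open>0 < r\<close>, of x] by linarith
    qed simp
  qed simp
  then show ?thesis
    by (simp add: measure_le_0_iff)
qed

text \<open>The kernel is infinite at \<open>z = 0\<close>, so no point mass has finite energy.\<close>

definition riesz :: "real \<Rightarrow> 'a::euclidean_space \<Rightarrow> ennreal" where
  "riesz s z = inverse (ennreal (norm z powr s))"

lemma borel_measurable_riesz [measurable]: "riesz s \<in> borel_measurable borel"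
  unfolding riesz_def by measurable

text \<open>The term at the dyadic scale of \<open>norm z\<close> alone suffices, and 1 covers
  \<open>norm z > 1\<close>. The balls are open, so their radius is doubled to contain the closed
  shell. At \<open>z = 0\<close> all terms are at least 1 and the sum is infinite, as the kernel
  is.\<close>

lemma riesz_le_dyadic_sum:
  fixes z :: "'a::euclidean_space"
  assumes "0 < s"
  shows "riesz s z \<le> 1 + (\<Sum>k. ennreal ((2 powr s) ^ Suc k) * indicator (ball 0 (2 * (1/2) ^ k)) z)"
proof -
  let ?t = "\<lambda>k. ennreal ((2 powr s) ^ Suc k) * indicator (ball 0 (2 * (1/2) ^ k)) z"
  consider "z = 0" | "0 < norm z" "norm z \<le> 1" | "1 < norm z"
    by force
  then show ?thesis
  proof cases
    case 1
    have "(\<Sum>k::nat. 1::ennreal) \<le> (\<Sum>k. ?t k)"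
    proof (intro suminf_le)
      fix k
      have "1 \<le> (2 powr s) ^ Suc k"
        using \<open>0 < s\<close> by (intro one_le_power ge_one_powr_ge_zero) auto
      then show "1 \<le> ?t k"
        using 1 by (simp del: power_Suc)
    qed auto
    moreover have "(\<Sum>k::nat. 1::ennreal) = top"
      using nn_integral_count_space_nat[of "\<lambda>_. 1"] by simp
    ultimately show ?thesis
      by (simp add: top_unique)
  next
    case 2
    obtain k where k: "(1/2) ^ Suc k < norm z" "norm z \<le> (1/2) ^ k"
      using ex_dyadic_scale[OF 2] .
    have "riesz s z = ennreal (norm z powr (- s))"
      using 2 by (simp add: riesz_def inverse_ennreal powr_minus)
    also have "\<dots> \<le> ennreal ((2 powr s) ^ Suc k)"
    proof (rule ennreal_leI)
      have "norm z powr (- s) \<le> ((1/2) ^ Suc k) powr (- s)"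
        using k(1) \<open>0 < s\<close> by (intro powr_mono2') auto
      also have "\<dots> = (2 powr s) ^ Suc k"
        by (simp add: powr_realpow[symmetric] powr_powr powr_divide powr_minus powr_power field_simps del: power_Suc)
      finally show "norm z powr (- s) \<le> (2 powr s) ^ Suc k" .
    qed
    also have "\<dots> = ?t k"
      using k(2) 2 by (simp add: indicator_def order_le_less_trans[OF k(2)])
    also have "\<dots> \<le> (\<Sum>k. ?t k)"
    proof -
      have "(\<Sum>k\<in>{k}. ?t k) \<le> (\<Sum>k. ?t k)"
        by (rule sum_le_suminf) auto
      then show ?thesis by (simp only: sum.insert sum.empty finite.intros empty_iff not_False_eq_True add_0_right)
    qed
    finally show ?thesis
      by (simp add: add_increasing)
  next
    case 3
    have "0 < norm z powr s"
      using 3 by (intro powr_gt_zero[THEN iffD2]) auto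
    then have "riesz s z = ennreal (norm z powr (- s))"
      by (simp add: riesz_def inverse_ennreal powr_minus)
    also have "\<dots> \<le> ennreal 1"
      using 3 \<open>0 < s\<close> powr_mono[of "- s" 0 "norm z"] by (intro ennreal_leI) (auto split: if_splits)
    finally show ?thesis
      by (simp add: add_increasing2)
  qed
qed

text \<open>With the ball bound at an exponent \<open>t\<close> strictly between \<open>s\<close>
  and \<open>s'\<close>, the dyadic sum is geometric of ratio \<open>2 powr (s - t)\<close>,
  uniformly in the centre.\<close>

lemma riesz_potential_bounded:
  fixes M :: "'a::euclidean_space measure"
  assumes F: "frostman_measure E s' M" and "0 < s" "s < s'"
  obtains K where "0 \<le> K" "\<And>x. (\<integral>\<^sup>+x'. riesz s (x - x') \<partial>M) \<le> ennreal K"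
proof -
  interpret prob_space M
    using F unfolding frostman_measure_def by blast
  have setsM [measurable_cong]: "sets M = sets borel"
    using F unfolding frostman_measure_def by blast
  define t where "t = (s + s') / 2"
  have t: "0 \<le> t" "s < t" "t < s'"
    using assms by (auto simp: t_def)
  obtain C where C: "0 < C" "\<And>x r. 0 < r \<Longrightarrow> measure M (ball x r) \<le> C * r powr t"
    by (rule frostman_ball_le[OF F t(1) t(3)]) blast
  let ?a = "\<lambda>k. 2 powr s * C * 2 powr t * (2 powr (s - t)) ^ k"
  have summ: "summable ?a"
    using t by (intro summable_mult summable_geometric) (auto simp: powr_less_one)
  show ?thesis
  proof
    show "0 \<le> 1 + (\<Sum>k. ?a k)"
      using C(1) by (intro add_nonneg_nonneg suminf_nonneg summ) auto
    fix x
    have meas: "(\<lambda>x'. ennreal ((2 powr s) ^ Suc k) * indicator (ball x (2 * (1/2) ^ k)) x') \<in> borel_measurable M" for k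
      by (intro borel_measurable_times_ennreal borel_measurable_const borel_measurable_indicator) (simp add: setsM)
    have "(\<integral>\<^sup>+x'. riesz s (x - x') \<partial>M)
        \<le> (\<integral>\<^sup>+x'. 1 + (\<Sum>k. ennreal ((2 powr s) ^ Suc k) * indicator (ball x (2 * (1/2) ^ k)) x') \<partial>M)"
    proof (rule nn_integral_mono)
      fix x'
      show "riesz s (x - x') \<le> 1 + (\<Sum>k. ennreal ((2 powr s) ^ Suc k) * indicator (ball x (2 * (1/2) ^ k)) x')"
        using riesz_le_dyadic_sum[OF \<open>0 < s\<close>, of "x - x'"]
        by (simp add: indicator_def dist_norm norm_minus_commute del: power_Suc)
    qed
    also have "\<dots> = 1 + (\<integral>\<^sup>+x'. (\<Sum>k. ennreal ((2 powr s) ^ Suc k) * indicator (ball x (2 * (1/2) ^ k)) x') \<partial>M)"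
      by (subst nn_integral_add) (simp_all only: meas borel_measurable_suminf_order borel_measurable_const nn_integral_const emeasure_space_1 mult_1)
    also have "\<dots> = 1 + (\<Sum>k. ennreal ((2 powr s) ^ Suc k) * emeasure M (ball x (2 * (1/2) ^ k)))"
      by (subst nn_integral_suminf[OF meas])
         (simp only: nn_integral_cmult_indicator setsM borel_open[OF open_ball])
    also have "\<dots> \<le> 1 + (\<Sum>k. ennreal (?a k))"
    proof (intro add_left_mono suminf_le)
      fix k :: nat
      have "emeasure M (ball x (2 * (1/2) ^ k)) = ennreal (measure M (ball x (2 * (1/2) ^ k)))"
        by (simp add: emeasure_eq_measure)
      also have "\<dots> \<le> ennreal (C * (2 * (1/2) ^ k) powr t)"
        by (intro ennreal_leI C(2)) auto
      finally have "ennreal ((2 powr s) ^ Suc k) * emeasure M (ball x (2 * (1/2) ^ k))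
          \<le> ennreal ((2 powr s) ^ Suc k) * ennreal (C * (2 * (1/2) ^ k) powr t)"
        by (rule mult_left_mono) simp
      also have "\<dots> = ennreal ((2 powr s) ^ Suc k * (C * (2 * (1/2) ^ k) powr t))"
        using C(1) by (intro ennreal_mult[symmetric] mult_nonneg_nonneg zero_le_power powr_ge_zero less_imp_le)
      also have "(2 powr s) ^ Suc k * (C * (2 * (1/2) ^ k) powr t) = ?a k"
        by (simp add: powr_mult powr_divide powr_power powr_diff powr_powr powr_realpow[symmetric] field_simps)
      finally show "ennreal ((2 powr s) ^ Suc k) * emeasure M (ball x (2 * (1/2) ^ k))
          \<le> ennreal (?a k)" .
    qed auto
    also have "\<dots> = ennreal (1 + (\<Sum>k. ?a k))"
      using C(1) summ by (simp add: suminf_ennreal2 ennreal_plus suminf_nonneg)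
    finally show "(\<integral>\<^sup>+x'. riesz s (x - x') \<partial>M) \<le> ennreal (1 + (\<Sum>k. ?a k))" .
  qed
qed

section \<open>Gaussian bounds by powers, and Fubini for oscillating integrands\<close>

lemma powr_mult_gaussian_le:
  fixes q c u :: real
  assumes "0 < c" "0 \<le> q" "0 \<le> u"
  shows "(1 + u) powr q * exp (- (c * u\<^sup>2)) \<le> exp (q\<^sup>2 / (4 * c))"
proof -
  have "(1 + u) powr q = exp (q * ln (1 + u))"
    using assms by (simp add: powr_def)
  also have "\<dots> \<le> exp (q * u)"
    using assms ln_add_one_self_le_self[of u] by (simp add: mult_left_mono)
  also have "\<dots> \<le> exp (c * u\<^sup>2 + q\<^sup>2 / (4 * c))"
  proof -
    have "0 \<le> c * (u - q / (2 * c))\<^sup>2"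
      using assms by simp
    also have "\<dots> = c * u\<^sup>2 + q\<^sup>2 / (4 * c) - q * u"
      using assms by (simp add: field_simps power2_eq_square)
    finally show ?thesis by simp
  qed
  finally show ?thesis
    by (simp add: exp_add exp_minus field_simps)
qed

text \<open>Trades a Gaussian cutoff at height \<open>1 / r\<close> for a negative power of
  \<open>r * (1 + x)\<close>; since \<open>r \<le> 1\<close> this product is at most
  \<open>1 + r * x\<close>.\<close>

lemma gaussian_le_scaled_powr:
  fixes q c r x :: real
  assumes "0 < c" "0 \<le> q" "0 < r" "r \<le> 1" "0 \<le> x"
  shows "exp (- (c * (r * x)\<^sup>2)) \<le> exp (q\<^sup>2 / (4 * c)) * r powr (- q) * (1 + x) powr (- q)"
proof -
  have "(r * (1 + x)) powr q * exp (- (c * (r * x)\<^sup>2)) \<le> (1 + r * x) powr q * exp (- (c * (r * x)\<^sup>2))"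
    using assms by (intro mult_right_mono powr_mono2) (auto simp: algebra_simps)
  also have "\<dots> \<le> exp (q\<^sup>2 / (4 * c))"
    using assms by (intro powr_mult_gaussian_le) auto
  finally have "r powr q * (1 + x) powr q * exp (- (c * (r * x)\<^sup>2)) \<le> exp (q\<^sup>2 / (4 * c))"
    using assms by (simp add: powr_mult)
  moreover have "0 < r powr q" "0 < (1 + x) powr q"
    using assms by auto
  ultimately show ?thesis
    unfolding powr_minus by (simp add: field_simps)
qed

text \<open>The integrand has modulus \<open>\<bar>w t\<bar>\<close> and \<open>Q\<close> is finite,
  so it is absolutely integrable. The Parseval-type identities below are instances.\<close>

lemma fubini_phase:
  fixes w :: "'b \<Rightarrow> real" and \<phi> :: "'b \<Rightarrow> 'c \<Rightarrow> real"
  assumes "sigma_finite_measure L" "finite_measure Q" and w: "integrable L w"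
    and [measurable]: "(\<lambda>(t, q). \<phi> t q) \<in> borel_measurable (L \<Otimes>\<^sub>M Q)"
  shows "integrable L (\<lambda>t. complex_of_real (w t) * (\<integral>q. cis (\<phi> t q) \<partial>Q))"
    and "integrable Q (\<lambda>q. \<integral>t. complex_of_real (w t) * cis (\<phi> t q) \<partial>L)"
    and "(\<integral>t. complex_of_real (w t) * (\<integral>q. cis (\<phi> t q) \<partial>Q) \<partial>L)
      = (\<integral>q. \<integral>t. complex_of_real (w t) * cis (\<phi> t q) \<partial>L \<partial>Q)"
proof -
  interpret L: sigma_finite_measure L by fact
  interpret Q: finite_measure Q by fact
  interpret pair_sigma_finite L Q ..
  have [measurable]: "w \<in> borel_measurable L" using w by auto
  have int: "integrable (L \<Otimes>\<^sub>M Q) (\<lambda>(t, q). complex_of_real (w t) * cis (\<phi> t q))"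
  proof (rule Fubini_integrable)
    show "integrable L (\<lambda>t. \<integral>q. norm (case (t, q) of (t, q) \<Rightarrow> complex_of_real (w t) * cis (\<phi> t q)) \<partial>Q)"
      using w by (simp add: norm_mult)
    show "AE t in L. integrable Q (\<lambda>q. case (t, q) of (t, q) \<Rightarrow> complex_of_real (w t) * cis (\<phi> t q))"
      by (intro AE_I2) (auto intro!: Q.integrable_const_bound[where B = "\<bar>w t\<bar>" for t] simp: norm_mult)
  qed measurable
  show "integrable L (\<lambda>t. complex_of_real (w t) * (\<integral>q. cis (\<phi> t q) \<partial>Q))"
    using integrable_fst'[OF int] by simp
  show "integrable Q (\<lambda>q. \<integral>t. complex_of_real (w t) * cis (\<phi> t q) \<partial>L)"
    using integrable_snd[OF int] by simp
  show "(\<integral>t. complex_of_real (w t) * (\<integral>q. cis (\<phi> t q) \<partial>Q) \<partial>L)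
      = (\<integral>q. \<integral>t. complex_of_real (w t) * cis (\<phi> t q) \<partial>L \<partial>Q)"
    using Fubini_integral[OF int] by simp
qed

lemma integrable_powr_tail:
  fixes p :: real
  assumes "1 < p"
  shows "integrable lborel (\<lambda>t. (1 + \<bar>t\<bar>) powr (- p))"
proof (rule integrableI_nonneg)
  let ?f = "\<lambda>t::real. ennreal ((1 + \<bar>t\<bar>) powr (- p))"
  have half: "(\<integral>\<^sup>+t. ?f t * indicator {0..} t \<partial>lborel) = ennreal (1 / (p - 1))"
  proof -
    have "(\<integral>\<^sup>+t. ennreal ((1 + t) powr (- p)) * indicator {0..} t \<partial>lborel)
        = ennreal (0 - (- ((1 + 0) powr (1 - p) / (p - 1))))"
    proof (rule nn_integral_FTC_atLeast)
      show "((\<lambda>t. - ((1 + t) powr (1 - p) / (p - 1))) \<longlongrightarrow> 0) at_top"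
        using \<open>1 < p\<close> by real_asymp
      show "DERIV (\<lambda>t. - ((1 + t) powr (1 - p) / (p - 1))) x :> (1 + x) powr (- p)" if "0 \<le> x" for x :: real
      proof -
        have "((\<lambda>t. (1 + t) powr (1 - p)) has_real_derivative (1 - p) * (1 + x) powr (- p)) (at x)"
          using DERIV_fun_powr[of "\<lambda>t. 1 + t" 1 x "1 - p"] that by (auto intro!: derivative_eq_intros)
        moreover have "- ((1 - p) * (1 + x) powr (- p) / (p - 1)) = (1 + x) powr (- p)"
          using \<open>1 < p\<close> by (simp add: field_simps)
        ultimately show ?thesis
          using DERIV_minus[OF DERIV_cdivide[of "\<lambda>t. (1 + t) powr (1 - p)" "(1 - p) * (1 + x) powr (- p)" x UNIV "p - 1"]] by simp
      qed
    qed auto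
    moreover have "(\<integral>\<^sup>+t. ?f t * indicator {0..} t \<partial>lborel)
        = (\<integral>\<^sup>+t. ennreal ((1 + t) powr (- p)) * indicator {0..} t \<partial>lborel)"
      by (intro nn_integral_cong) (auto simp: indicator_def)
    ultimately show ?thesis by simp
  qed
  have "(\<integral>\<^sup>+t. ?f t \<partial>lborel) \<le> (\<integral>\<^sup>+t. ?f t * indicator {0..} t + ?f (- t) * indicator {0..} (- t) \<partial>lborel)"
    by (intro nn_integral_mono) (auto simp: indicator_def)
  also have "\<dots> = (\<integral>\<^sup>+t. ?f t * indicator {0..} t \<partial>lborel) + (\<integral>\<^sup>+t. ?f (- t) * indicator {0..} (- t) \<partial>lborel)"
    by (rule nn_integral_add) auto
  also have "(\<integral>\<^sup>+t. ?f (- t) * indicator {0..} (- t) \<partial>lborel) = (\<integral>\<^sup>+t. ?f t * indicator {0..} t \<partial>lborel)"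
    using nn_integral_real_affine[of "\<lambda>t. ?f t * indicator {0..} t" "-1" 0] by simp
  finally show "(\<integral>\<^sup>+t. ?f t \<partial>lborel) < \<infinity>"
    unfolding half by (rule le_less_trans) auto
qed auto

section \<open>Fourier decay\<close>

lemma integrable_gaussian:
  fixes w :: "'a::euclidean_space"
  assumes "s > 0"
  shows "integrable lborel (\<lambda>\<xi>::'a. exp (- (s * norm (\<xi> - w))\<^sup>2 / 2))"
proof -
  have "integrable lborel (\<lambda>\<xi>::'a. norm (complex_of_real (exp (- (s * norm (\<xi> - w))\<^sup>2 / 2)) * cis (\<xi> \<bullet> 0)))"
    using gaussian_fourier_shift[OF assms, of w 0] by (intro integrable_norm) (simp add: has_bochner_integral_iff)
  then show ?thesis by (simp add: norm_mult del: of_real_exp)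
qed

lemma norm_fourier_measure_le_1:
  assumes "prob_space M"
  shows "norm (fourier_measure M \<xi>) \<le> 1"
proof -
  interpret prob_space M by fact
  have "norm (fourier_measure M \<xi>) \<le> (\<integral>x. norm (cis (- 2 * pi * (x \<bullet> \<xi>))) \<partial>M)"
    unfolding fourier_measure_def by (rule integral_norm_bound)
  then show ?thesis by (simp add: prob_space)
qed

text \<open>High frequencies use the hypothesis with \<epsilon> = \<gamma> - \<open>b\<close>; the
  remaining bounded range uses that a probability measure has transform at most 1.\<close>

lemma fourier_decay_global:
  fixes M :: "'a::euclidean_space measure"
  assumes M: "prob_space M"
    and decay: "\<forall>\<epsilon>>0. \<exists>C>0. \<forall>\<^sub>F \<xi> in at_infinity.
           norm (fourier_measure M \<xi>) \<le> C * norm \<xi> powr \<epsilon> * norm \<xi> powr (- \<gamma>)"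
    and b: "0 \<le> b" "b < \<gamma>"
  obtains C where "0 \<le> C" "\<And>\<xi>. norm (fourier_measure M \<xi>) \<le> C * (1 + norm \<xi>) powr (- b)"
proof -
  obtain C where "C > 0" and "\<forall>\<^sub>F \<xi> in at_infinity.
      norm (fourier_measure M \<xi>) \<le> C * norm \<xi> powr (\<gamma> - b) * norm \<xi> powr (- \<gamma>)"
    using decay b by (meson diff_gt_0_iff_gt)
  then obtain R where R: "\<And>\<xi>. R \<le> norm \<xi> \<Longrightarrow>
      norm (fourier_measure M \<xi>) \<le> C * norm \<xi> powr (\<gamma> - b) * norm \<xi> powr (- \<gamma>)"
    unfolding eventually_at_infinity by blast
  define R' where "R' = max R 1"
  show ?thesis
  proof
    show "0 \<le> C * 2 powr b + (1 + R') powr b"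
      using \<open>C > 0\<close> by simp
    fix \<xi> :: 'a
    show "norm (fourier_measure M \<xi>) \<le> (C * 2 powr b + (1 + R') powr b) * (1 + norm \<xi>) powr (- b)"
    proof (cases "R' \<le> norm \<xi>")
      case True
      then have "1 \<le> norm \<xi>" "R \<le> norm \<xi>" by (auto simp: R'_def)
      have "norm (fourier_measure M \<xi>) \<le> C * (norm \<xi> powr (\<gamma> - b) * norm \<xi> powr (- \<gamma>))"
        using R[OF \<open>R \<le> norm \<xi>\<close>] by (simp add: mult.assoc)
      also have "norm \<xi> powr (\<gamma> - b) * norm \<xi> powr (- \<gamma>) = norm \<xi> powr (- b)"
        by (simp add: powr_add[symmetric])
      also have "norm \<xi> powr (- b) \<le> ((1 + norm \<xi>) / 2) powr (- b)"
        using \<open>1 \<le> norm \<xi>\<close> b by (intro powr_mono2') auto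
      also have "\<dots> = 2 powr b * (1 + norm \<xi>) powr (- b)"
        by (simp add: powr_divide powr_minus field_simps)
      finally have "norm (fourier_measure M \<xi>) \<le> C * (2 powr b * (1 + norm \<xi>) powr (- b))"
        using \<open>C > 0\<close> by simp
      then show ?thesis
        by (simp add: distrib_right add_increasing2 mult.assoc)
    next
      case False
      have "(1 + R') powr (- b) \<le> (1 + norm \<xi>) powr (- b)"
        using False b by (intro powr_mono2') (auto simp: add_pos_nonneg)
      then have "(1 + R') powr b * (1 + R') powr (- b) \<le> (1 + R') powr b * (1 + norm \<xi>) powr (- b)"
        by (intro mult_left_mono) auto
      moreover have "(1 + R') powr b * (1 + R') powr (- b) = 1"
        by (simp add: powr_add[symmetric] R'_def max_def)
      moreover have "0 \<le> C * 2 powr b * (1 + norm \<xi>) powr (- b)"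
        using \<open>C > 0\<close> by simp
      ultimately show ?thesis
        using norm_fourier_measure_le_1[OF M, of \<xi>] unfolding distrib_right by linarith
    qed
  qed
qed

text \<open>A Gaussian in \<open>(e \<bullet> y) / r\<close> dominates the plate. By Parseval its
  mean is of order \<open>r\<close> times the integral of the transform of \<open>N\<close> along
  the line spanned by \<open>e\<close>, cut off at height \<open>1 / r\<close>. Replacing the cutoff
  by a power of exponent 1 - \<beta> makes the integral converge, as 1 - \<beta> + \<open>b\<close>
  > 1, and leaves \<open>r * r powr (- (1 - \<beta>))\<close>.\<close>

lemma plate_measure_le_unit:
  fixes N :: "'a::euclidean_space measure"
  assumes N: "prob_space N" and setsN [measurable_cong]: "sets N = sets borel"
    and dec: "\<And>\<xi>. norm (fourier_measure N \<xi>) \<le> C * (1 + norm \<xi>) powr (- b)"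
    and "0 \<le> C" "0 < \<beta>" "\<beta> \<le> 1" "\<beta> < b"
  obtains C' where "0 \<le> C'"
    "\<And>e r. norm e = 1 \<Longrightarrow> 0 < r \<Longrightarrow> r \<le> 1 \<Longrightarrow> measure N {y. \<bar>e \<bullet> y\<bar> \<le> r} \<le> C' * r powr \<beta>"
proof -
  interpret prob_space N by fact
  define I where "I = (\<integral>t. (1 + \<bar>t\<bar>) powr (- (1 - \<beta> + b)) \<partial>lborel)"
  have intI: "integrable lborel (\<lambda>t::real. (1 + \<bar>t\<bar>) powr (- (1 - \<beta> + b)))"
    using assms by (intro integrable_powr_tail) auto
  have "0 \<le> I" unfolding I_def by (intro Bochner_Integration.integral_nonneg) auto
  define K where "K = exp ((1 - \<beta>)\<^sup>2 / (4 * (1/2))) * (C * (2 * pi) powr b)"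
  have "0 \<le> K" using \<open>0 \<le> C\<close> by (simp add: K_def)
  show ?thesis
  proof
    show "0 \<le> exp (1/2) * (K * I)" using \<open>0 \<le> K\<close> \<open>0 \<le> I\<close> by simp
    fix e :: 'a and r :: real assume e: "norm e = 1" and r: "0 < r" "r \<le> 1"
    define G where "G y = exp (- ((e \<bullet> y) / r)\<^sup>2 / 2)" for y
    have [measurable]: "G \<in> borel_measurable N" unfolding G_def by measurable
    have intG: "integrable N G"
      by (rule integrable_const_bound[where B = 1]) (auto simp: G_def)
    have w: "integrable lborel (\<lambda>t::real. exp (- (r * t)\<^sup>2 / 2))"
      using integrable_gaussian[OF r(1), of "0::real"] by (simp add: power_mult_distrib)
    have [measurable]: "(\<lambda>(t, y). t * (e \<bullet> y)) \<in> borel_measurable (lborel \<Otimes>\<^sub>M N)"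
      by measurable
    note fub = fubini_phase[OF lborel.sigma_finite_measure_axioms finite_measure_axioms w this]
    \<comment> \<open>\<open>fourier_measure\<close> has \<open>2 * pi\<close> in its phase and the
      Gaussian formula does not, so the frequency is rescaled.\<close>
    have F: "(\<integral>y. cis (t * (e \<bullet> y)) \<partial>N) = fourier_measure N ((- t / (2 * pi)) *\<^sub>R e)" for t
      unfolding fourier_measure_def by (intro Bochner_Integration.integral_cong refl) (simp add: inner_commute)
    have "complex_of_real (sqrt (2 * pi) / r * (\<integral>y. G y \<partial>N))
        = (\<integral>y. \<integral>t. complex_of_real (exp (- (r * t)\<^sup>2 / 2)) * cis (t * (e \<bullet> y)) \<partial>lborel \<partial>N)"
      using gaussian_fourier_real[OF r(1)]
      by (simp add: has_bochner_integral_iff G_def flip: integral_complex_of_real)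
    also have "\<dots> = (\<integral>t. complex_of_real (exp (- (r * t)\<^sup>2 / 2)) * fourier_measure N ((- t / (2 * pi)) *\<^sub>R e) \<partial>lborel)"
      using fub(3) by (simp add: F)
    finally have eq: "complex_of_real (sqrt (2 * pi) / r * (\<integral>y. G y \<partial>N)) = \<dots>" .
    have "sqrt (2 * pi) / r * (\<integral>y. G y \<partial>N) \<le> norm (complex_of_real (sqrt (2 * pi) / r * (\<integral>y. G y \<partial>N)))"
      unfolding norm_of_real by (rule abs_ge_self)
    also have "\<dots> \<le> (\<integral>t. norm (complex_of_real (exp (- (r * t)\<^sup>2 / 2)) * fourier_measure N ((- t / (2 * pi)) *\<^sub>R e)) \<partial>lborel)"
      unfolding eq by (rule integral_norm_bound)
    also have "\<dots> \<le> (\<integral>t. K * r powr (- (1 - \<beta>)) * (1 + \<bar>t\<bar>) powr (- (1 - \<beta> + b)) \<partial>lborel)"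
    proof (rule integral_mono)
      show "integrable lborel (\<lambda>t. norm (complex_of_real (exp (- (r * t)\<^sup>2 / 2)) * fourier_measure N ((- t / (2 * pi)) *\<^sub>R e)))"
        using fub(1) by (intro integrable_norm) (simp add: F)
      show "integrable lborel (\<lambda>t. K * r powr (- (1 - \<beta>)) * (1 + \<bar>t\<bar>) powr (- (1 - \<beta> + b)))"
        by (intro integrable_mult_right intI)
      fix t :: real
      have "norm (fourier_measure N ((- t / (2 * pi)) *\<^sub>R e)) \<le> C * (1 + \<bar>t\<bar> / (2 * pi)) powr (- b)"
        using dec[of "(- t / (2 * pi)) *\<^sub>R e"] e by simp
      also have "\<dots> \<le> C * ((1 + \<bar>t\<bar>) / (2 * pi)) powr (- b)"
      proof (intro mult_left_mono powr_mono2' \<open>0 \<le> C\<close>)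
        show "(1 + \<bar>t\<bar>) / (2 * pi) \<le> 1 + \<bar>t\<bar> / (2 * pi)"
          using pi_gt3 by (simp add: field_simps)
      qed (use assms in auto)
      also have "\<dots> = C * (2 * pi) powr b * (1 + \<bar>t\<bar>) powr (- b)"
        by (simp add: powr_divide powr_minus field_simps)
      finally have 1: "norm (fourier_measure N ((- t / (2 * pi)) *\<^sub>R e)) \<le> C * (2 * pi) powr b * (1 + \<bar>t\<bar>) powr (- b)" .
      have 2: "exp (- (r * t)\<^sup>2 / 2) \<le> exp ((1 - \<beta>)\<^sup>2 / (4 * (1/2))) * r powr (- (1 - \<beta>)) * (1 + \<bar>t\<bar>) powr (- (1 - \<beta>))"
        using gaussian_le_scaled_powr[of "1/2" "1 - \<beta>" r "\<bar>t\<bar>"] assms r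
        by (simp add: power_mult_distrib)
      have "exp (- (r * t)\<^sup>2 / 2) * norm (fourier_measure N ((- t / (2 * pi)) *\<^sub>R e))
          \<le> (exp ((1 - \<beta>)\<^sup>2 / (4 * (1/2))) * r powr (- (1 - \<beta>)) * (1 + \<bar>t\<bar>) powr (- (1 - \<beta>)))
            * (C * (2 * pi) powr b * (1 + \<bar>t\<bar>) powr (- b))"
        by (intro mult_mono 1 2) auto
      also have "\<dots> = K * r powr (- (1 - \<beta>)) * ((1 + \<bar>t\<bar>) powr (- (1 - \<beta>)) * (1 + \<bar>t\<bar>) powr (- b))"
        unfolding K_def by (simp only: mult_ac)
      also have "(1 + \<bar>t\<bar>) powr (- (1 - \<beta>)) * (1 + \<bar>t\<bar>) powr (- b) = (1 + \<bar>t\<bar>) powr (- (1 - \<beta> + b))"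
        by (simp add: powr_add[symmetric])
      finally show "norm (complex_of_real (exp (- (r * t)\<^sup>2 / 2)) * fourier_measure N ((- t / (2 * pi)) *\<^sub>R e))
          \<le> K * r powr (- (1 - \<beta>)) * (1 + \<bar>t\<bar>) powr (- (1 - \<beta> + b))"
        unfolding norm_mult norm_of_real by simp
    qed
    also have "\<dots> = K * r powr (- (1 - \<beta>)) * I"
      unfolding I_def by simp
    finally have "sqrt (2 * pi) * (\<integral>y. G y \<partial>N) \<le> r * (K * r powr (- (1 - \<beta>)) * I)"
      using r by (simp add: field_simps)
    also have "\<dots> = K * I * r powr \<beta>"
      using r powr_add[of r 1 "- (1 - \<beta>)"] by simp
    finally have "sqrt (2 * pi) * (\<integral>y. G y \<partial>N) \<le> K * I * r powr \<beta>" .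
    moreover have "1 * (\<integral>y. G y \<partial>N) \<le> sqrt (2 * pi) * (\<integral>y. G y \<partial>N)"
      using pi_gt3 by (intro mult_right_mono Bochner_Integration.integral_nonneg) (auto simp: G_def)
    ultimately have G: "(\<integral>y. G y \<partial>N) \<le> K * I * r powr \<beta>"
      by linarith
    define P where "P = {y. \<bar>e \<bullet> y\<bar> \<le> r}"
    have P: "P \<in> sets N"
      by (simp add: setsN P_def)
    have "measure N P = (\<integral>y. indicator P y \<partial>N)"
      using sets.sets_into_space[OF P] by (simp add: Int_absorb2)
    also have "\<dots> \<le> (\<integral>y. exp (1/2) * G y \<partial>N)"
    proof (rule integral_mono)
      show "integrable N (indicator P :: 'a \<Rightarrow> real)"
        using P by (intro integrable_real_indicator) (auto simp: less_top[symmetric])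
      show "integrable N (\<lambda>y. exp (1/2) * G y)"
        by (intro integrable_mult_right intG)
      fix y
      show "indicator P y \<le> exp (1/2) * G y"
      proof (cases "\<bar>e \<bullet> y\<bar> \<le> r")
        case True
        then have "\<bar>(e \<bullet> y) / r\<bar> \<le> 1" using r(1) by simp
        then have "((e \<bullet> y) / r)\<^sup>2 \<le> 1" by (simp add: abs_square_le_1)
        then have "1 \<le> exp (1/2 + - ((e \<bullet> y) / r)\<^sup>2 / 2)"
          by simp
        then show ?thesis using True by (simp only: G_def P_def exp_add) simp
      qed (simp add: G_def P_def)
    qed
    also have "\<dots> = exp (1/2) * (\<integral>y. G y \<partial>N)"
      by simp
    also have "\<dots> \<le> exp (1/2) * (K * I * r powr \<beta>)"
      by (intro mult_left_mono G) auto
    finally show "measure N {y. \<bar>e \<bullet> y\<bar> \<le> r} \<le> exp (1/2) * (K * I) * r powr \<beta>"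
      by (simp add: P_def mult.assoc)
  qed
qed

text \<open>Normalising the normal vector divides the width by \<open>norm z\<close>. Widths above 1
  are handled by total mass 1.\<close>

lemma plate_measure_le:
  fixes N :: "'a::euclidean_space measure"
  assumes N: "prob_space N" and setsN: "sets N = sets borel"
    and decay: "\<forall>\<epsilon>>0. \<exists>C>0. \<forall>\<^sub>F \<xi> in at_infinity.
           norm (fourier_measure N \<xi>) \<le> C * norm \<xi> powr \<epsilon> * norm \<xi> powr (- \<gamma>)"
    and \<beta>: "0 < \<beta>" "\<beta> \<le> 1" "\<beta> < \<gamma>"
  obtains C where "0 \<le> C"
    "\<And>z \<delta>. z \<noteq> 0 \<Longrightarrow> 0 < \<delta> \<Longrightarrow> measure N {y. \<bar>z \<bullet> y\<bar> \<le> \<delta>} \<le> C * (\<delta> / norm z) powr \<beta>"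
proof -
  interpret prob_space N by fact
  obtain C1 where C1: "0 \<le> C1" "\<And>\<xi>. norm (fourier_measure N \<xi>) \<le> C1 * (1 + norm \<xi>) powr (- ((\<beta> + \<gamma>) / 2))"
    by (rule fourier_decay_global[OF N decay, of "(\<beta> + \<gamma>) / 2"]) (use \<beta> in auto)
  obtain C where C: "0 \<le> C"
    "\<And>e r. norm e = 1 \<Longrightarrow> 0 < r \<Longrightarrow> r \<le> 1 \<Longrightarrow> measure N {y. \<bar>e \<bullet> y\<bar> \<le> r} \<le> C * r powr \<beta>"
    by (rule plate_measure_le_unit[OF N setsN C1(2,1), of \<beta>]) (use \<beta> in auto)
  show ?thesis
  proof
    show "0 \<le> C + 1" using C(1) by simp
    fix z :: 'a and \<delta> :: real assume "z \<noteq> 0" "0 < \<delta>"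
    then have pos: "0 < \<delta> / norm z" by simp
    have "{y. \<bar>z \<bullet> y\<bar> \<le> \<delta>} = {y. \<bar>(z /\<^sub>R norm z) \<bullet> y\<bar> \<le> \<delta> / norm z}"
      using \<open>z \<noteq> 0\<close> by (auto simp: abs_mult field_simps)
    moreover have "measure N {y. \<bar>(z /\<^sub>R norm z) \<bullet> y\<bar> \<le> \<delta> / norm z} \<le> (C + 1) * (\<delta> / norm z) powr \<beta>"
    proof (cases "\<delta> / norm z \<le> 1")
      case True
      have "measure N {y. \<bar>(z /\<^sub>R norm z) \<bullet> y\<bar> \<le> \<delta> / norm z} \<le> C * (\<delta> / norm z) powr \<beta>"
        using True pos \<open>z \<noteq> 0\<close> by (intro C(2)) auto
      then show ?thesis by (simp add: distrib_right add_increasing2)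
    next
      case False
      then have "1 \<le> (\<delta> / norm z) powr \<beta>"
        using \<beta> by (intro ge_one_powr_ge_zero) auto
      moreover have "0 \<le> C * (\<delta> / norm z) powr \<beta>" using C(1) by simp
      ultimately show ?thesis
        using prob_le_1[of "{y. \<bar>(z /\<^sub>R norm z) \<bullet> y\<bar> \<le> \<delta> / norm z}"] unfolding distrib_right by linarith
    qed
    ultimately show "measure N {y. \<bar>z \<bullet> y\<bar> \<le> \<delta>} \<le> (C + 1) * (\<delta> / norm z) powr \<beta>"
      by simp
  qed
qed

text \<open>With \<open>y\<close> integrated first, the inner integral is the mass of a plate with
  normal \<open>x - x'\<close>, and what remains is a Riesz energy of order \<beta>.\<close>

lemma slab_integral_le_of_fourier_decay:
  fixes M N :: "'a::euclidean_space measure"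
  assumes F: "frostman_measure E s M"
    and N: "prob_space N" and setsN [measurable_cong]: "sets N = sets borel"
    and decay: "\<forall>\<epsilon>>0. \<exists>C>0. \<forall>\<^sub>F \<xi> in at_infinity.
           norm (fourier_measure N \<xi>) \<le> C * norm \<xi> powr \<epsilon> * norm \<xi> powr (- \<gamma>)"
    and \<beta>: "0 < \<beta>" "\<beta> \<le> 1" "\<beta> < \<gamma>" "\<beta> < s"
  obtains C where "\<And>\<delta>. 0 < \<delta> \<Longrightarrow> (\<integral>\<^sup>+y. \<integral>\<^sup>+x. slab M y \<delta> x \<partial>M \<partial>N) \<le> ennreal (C * \<delta> powr \<beta>)"
proof -
  interpret N: prob_space N by fact
  interpret M: prob_space M
    using F unfolding frostman_measure_def by blast
  have setsM [measurable_cong]: "sets M = sets borel"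
    using F unfolding frostman_measure_def by blast
  interpret NM: pair_sigma_finite M N ..
  obtain C where C: "0 \<le> C"
    "\<And>z \<delta>. z \<noteq> 0 \<Longrightarrow> 0 < \<delta> \<Longrightarrow> measure N {y. \<bar>z \<bullet> y\<bar> \<le> \<delta>} \<le> C * (\<delta> / norm z) powr \<beta>"
    using plate_measure_le[OF N setsN decay \<beta>(1-3)] by blast
  obtain K where K: "0 \<le> K" "\<And>x. (\<integral>\<^sup>+x'. riesz \<beta> (x - x') \<partial>M) \<le> ennreal K"
    using riesz_potential_bounded[OF F \<beta>(1,4)] by blast
  show ?thesis
  proof
    fix \<delta> :: real assume "0 < \<delta>"
    let ?i = "\<lambda>y x x'. indicator {..\<delta>} \<bar>(x - x') \<bullet> y\<bar> :: ennreal"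
    have "(\<integral>\<^sup>+y. \<integral>\<^sup>+x. slab M y \<delta> x \<partial>M \<partial>N) = (\<integral>\<^sup>+x. \<integral>\<^sup>+y. \<integral>\<^sup>+x'. ?i y x x' \<partial>M \<partial>N \<partial>M)"
      unfolding slab_def by (rule NM.Fubini') measurable
    also have "\<dots> = (\<integral>\<^sup>+x. \<integral>\<^sup>+x'. \<integral>\<^sup>+y. ?i y x x' \<partial>N \<partial>M \<partial>M)"
      by (intro nn_integral_cong NM.Fubini') measurable
    also have "\<dots> \<le> (\<integral>\<^sup>+x. \<integral>\<^sup>+x'. ennreal ((C + 1) * \<delta> powr \<beta>) * riesz \<beta> (x - x') \<partial>M \<partial>M)"
    proof (intro nn_integral_mono)
      fix x x'
      have "(\<integral>\<^sup>+y. ?i y x x' \<partial>N) = (\<integral>\<^sup>+y. indicator {y. \<bar>(x - x') \<bullet> y\<bar> \<le> \<delta>} y \<partial>N)"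
        by (intro nn_integral_cong) (simp add: indicator_def)
      also have "\<dots> = ennreal (measure N {y. \<bar>(x - x') \<bullet> y\<bar> \<le> \<delta>})"
        by (simp add: N.emeasure_eq_measure setsN)
      finally have eq: "(\<integral>\<^sup>+y. ?i y x x' \<partial>N) = ennreal (measure N {y. \<bar>(x - x') \<bullet> y\<bar> \<le> \<delta>})" .
      show "(\<integral>\<^sup>+y. ?i y x x' \<partial>N) \<le> ennreal ((C + 1) * \<delta> powr \<beta>) * riesz \<beta> (x - x')"
      proof (cases "x - x' = 0")
        case True
        \<comment> \<open>On the diagonal the kernel is infinite. The constant is
          \<open>C + 1\<close> because \<open>0 * top = 0\<close> would spoil the bound if
          \<open>C = 0\<close>.\<close>
        have "0 < (C + 1) * \<delta> powr \<beta>" using C(1) \<open>0 < \<delta>\<close> by (intro mult_pos_pos) auto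
        then have "ennreal ((C + 1) * \<delta> powr \<beta>) * riesz \<beta> (x - x') = top"
          using True C(1) \<open>0 < \<delta>\<close> unfolding riesz_def by (subst ennreal_mult_eq_top_iff) auto
        then show ?thesis by (simp only: top_greatest)
      next
        case False
        then have pos: "0 < norm (x - x') powr \<beta>"
          by (intro powr_gt_zero[THEN iffD2]) auto
        have "measure N {y. \<bar>(x - x') \<bullet> y\<bar> \<le> \<delta>} \<le> C * (\<delta> / norm (x - x')) powr \<beta>"
          by (rule C(2)[OF False \<open>0 < \<delta>\<close>])
        also have "\<dots> = (C * \<delta> powr \<beta>) * inverse (norm (x - x') powr \<beta>)"
          using \<open>0 < \<delta>\<close> by (simp add: powr_divide) (simp add: divide_inverse)
        also have "\<dots> \<le> ((C + 1) * \<delta> powr \<beta>) * inverse (norm (x - x') powr \<beta>)"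
          by (intro mult_right_mono) auto
        finally show ?thesis
          unfolding eq riesz_def inverse_ennreal[OF pos] using C(1) pos
          by (subst ennreal_mult[symmetric]) (auto intro: ennreal_leI)
      qed
    qed
    also have "\<dots> = ennreal ((C + 1) * \<delta> powr \<beta>) * (\<integral>\<^sup>+x. \<integral>\<^sup>+x'. riesz \<beta> (x - x') \<partial>M \<partial>M)"
      by (simp add: nn_integral_cmult)
    also have "\<dots> \<le> ennreal ((C + 1) * \<delta> powr \<beta>) * (\<integral>\<^sup>+x. ennreal K \<partial>M)"
      by (intro mult_left_mono nn_integral_mono K(2)) auto
    also have "\<dots> = ennreal ((C + 1) * K * \<delta> powr \<beta>)"
      using C(1) K(1) by (simp add: M.emeasure_space_1 ennreal_mult[symmetric] mult_ac)
    finally show "(\<integral>\<^sup>+y. \<integral>\<^sup>+x. slab M y \<delta> x \<partial>M \<partial>N) \<le> ennreal ((C + 1) * K * \<delta> powr \<beta>)" .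
  qed
qed

section \<open>The power spectrum\<close>

text \<open>The squared modulus of \<open>fourier_measure M\<close> at \<xi> divided by
  \<open>- 2 * pi\<close>; without the factor in the phase the Gaussian formulas apply
  directly.\<close>

definition power_spectrum :: "'a::euclidean_space measure \<Rightarrow> 'a \<Rightarrow> real" where
  "power_spectrum M \<xi> = (norm (\<integral>x. cis (\<xi> \<bullet> x) \<partial>M))\<^sup>2"

lemma power_spectrum_nonneg [simp]: "0 \<le> power_spectrum M \<xi>"
  by (simp add: power_spectrum_def)

lemma borel_measurable_power_spectrum:
  assumes "finite_measure M" and [measurable_cong]: "sets M = sets borel"
  shows "power_spectrum M \<in> borel_measurable borel"
proof -
  interpret finite_measure M by fact
  show ?thesis
    unfolding power_spectrum_def[abs_def] by measurable
qed

lemma finite_measure_pair: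
  assumes "finite_measure M" "finite_measure N"
  shows "finite_measure (M \<Otimes>\<^sub>M N)"
proof -
  interpret M: finite_measure M by fact
  interpret N: finite_measure N by fact
  show ?thesis
    by (intro finite_measureI)
       (simp add: space_pair_measure N.emeasure_pair_measure_Times M.emeasure_eq_measure N.emeasure_eq_measure ennreal_mult_eq_top_iff)
qed

text \<open>The power spectrum is the Fourier transform of the distribution of
  \<open>x - x'\<close>, with \<open>x\<close> and \<open>x'\<close> independent.\<close>

lemma integral_cis_difference:
  assumes M: "finite_measure M" and setsM [measurable_cong]: "sets M = sets borel"
  shows "(\<integral>q. cis (\<xi> \<bullet> (fst q - snd q)) \<partial>(M \<Otimes>\<^sub>M M)) = complex_of_real (power_spectrum M \<xi>)"
proof -
  interpret finite_measure M by fact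
  interpret P: pair_sigma_finite M M ..
  interpret Q: finite_measure "M \<Otimes>\<^sub>M M" by (intro finite_measure_pair M)
  have int: "integrable (M \<Otimes>\<^sub>M M) (\<lambda>q. cis (\<xi> \<bullet> (fst q - snd q)))"
    by (rule Q.integrable_const_bound[where B = 1]) auto
  have intM: "integrable M (\<lambda>x. cis (\<xi> \<bullet> x))"
    by (rule integrable_const_bound[where B = 1]) auto
  have "(\<integral>q. cis (\<xi> \<bullet> (fst q - snd q)) \<partial>(M \<Otimes>\<^sub>M M)) = (\<integral>x. \<integral>x'. cis (\<xi> \<bullet> (x - x')) \<partial>M \<partial>M)"
    using P.integral_fst'[OF int] by simp
  also have "\<dots> = (\<integral>x. \<integral>x'. cis (\<xi> \<bullet> x) * cnj (cis (\<xi> \<bullet> x')) \<partial>M \<partial>M)"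
    by (simp add: inner_diff_right cis_cnj cis_mult)
  also have "\<dots> = (\<integral>x. cis (\<xi> \<bullet> x) \<partial>M) * cnj (\<integral>x. cis (\<xi> \<bullet> x) \<partial>M)"
    using intM by simp
  also have "\<dots> = complex_of_real (power_spectrum M \<xi>)"
    unfolding power_spectrum_def by (rule complex_norm_square[symmetric])
  finally show ?thesis .
qed

lemma gaussian_power_spectrum:
  fixes M :: "'a::euclidean_space measure"
  assumes M: "finite_measure M" and setsM [measurable_cong]: "sets M = sets borel" and "0 < s"
  shows "integrable lborel (\<lambda>\<xi>. exp (- (s * norm (\<xi> - w))\<^sup>2 / 2) * power_spectrum M \<xi>)"
    and "complex_of_real (\<integral>\<xi>. exp (- (s * norm (\<xi> - w))\<^sup>2 / 2) * power_spectrum M \<xi> \<partial>lborel)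
      = (\<integral>q. complex_of_real ((sqrt (2 * pi) / s) ^ DIM('a) * exp (- (norm (fst q - snd q) / s)\<^sup>2 / 2))
          * cis (w \<bullet> (fst q - snd q)) \<partial>(M \<Otimes>\<^sub>M M))"
proof -
  have meas: "(\<lambda>(\<xi>, q). \<xi> \<bullet> (fst q - snd q)) \<in> borel_measurable ((lborel :: 'a measure) \<Otimes>\<^sub>M (M \<Otimes>\<^sub>M M))"
    by measurable
  note fub = fubini_phase[OF lborel.sigma_finite_measure_axioms finite_measure_pair[OF M M]
      integrable_gaussian[OF \<open>0 < s\<close>, of w] meas]
  have 1: "integrable lborel (\<lambda>\<xi>. complex_of_real (exp (- (s * norm (\<xi> - w))\<^sup>2 / 2) * power_spectrum M \<xi>))"
    using fub(1) by (simp only: integral_cis_difference[OF M setsM] of_real_mult)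
  then show "integrable lborel (\<lambda>\<xi>. exp (- (s * norm (\<xi> - w))\<^sup>2 / 2) * power_spectrum M \<xi>)"
    by (simp only: complex_of_real_integrable_eq)
  show "complex_of_real (\<integral>\<xi>. exp (- (s * norm (\<xi> - w))\<^sup>2 / 2) * power_spectrum M \<xi> \<partial>lborel)
      = (\<integral>q. complex_of_real ((sqrt (2 * pi) / s) ^ DIM('a) * exp (- (norm (fst q - snd q) / s)\<^sup>2 / 2))
          * cis (w \<bullet> (fst q - snd q)) \<partial>(M \<Otimes>\<^sub>M M))"
    using fub(3) gaussian_fourier_shift[OF \<open>0 < s\<close>, of w]
    by (simp only: integral_cis_difference[OF M setsM] has_bochner_integral_iff
        of_real_mult[symmetric] integral_complex_of_real)
qed

lemma nn_gaussian_power_spectrum: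
  fixes M :: "'a::euclidean_space measure"
  assumes M: "finite_measure M" and setsM [measurable_cong]: "sets M = sets borel" and "0 < s"
  shows "(\<integral>\<^sup>+\<xi>. ennreal (exp (- (s * norm \<xi>)\<^sup>2 / 2) * power_spectrum M \<xi>) \<partial>lborel)
      = ennreal ((sqrt (2 * pi) / s) ^ DIM('a)) * (\<integral>\<^sup>+x. \<integral>\<^sup>+x'. ennreal (exp (- (norm (x - x') / s)\<^sup>2 / 2)) \<partial>M \<partial>M)"
proof -
  interpret finite_measure M by fact
  interpret P: pair_sigma_finite M M ..
  interpret Q: finite_measure "M \<Otimes>\<^sub>M M" by (intro finite_measure_pair M)
  let ?g = "\<lambda>q. exp (- (norm (fst q - snd q) / s)\<^sup>2 / 2) :: real"
  let ?c = "(sqrt (2 * pi) / s) ^ DIM('a)"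
  have c: "0 \<le> ?c" using \<open>0 < s\<close> by simp
  have int: "integrable (M \<Otimes>\<^sub>M M) ?g"
    by (rule Q.integrable_const_bound[where B = 1]) auto
  have "complex_of_real (\<integral>\<xi>. exp (- (s * norm \<xi>)\<^sup>2 / 2) * power_spectrum M \<xi> \<partial>lborel)
      = (\<integral>q. complex_of_real (?c * ?g q) \<partial>(M \<Otimes>\<^sub>M M))"
    using gaussian_power_spectrum(2)[OF assms, of 0] by (simp only: inner_zero_left cis_zero mult_1_right diff_0_right)
  also have "\<dots> = complex_of_real (?c * (\<integral>q. ?g q \<partial>(M \<Otimes>\<^sub>M M)))"
    by (simp only: integral_complex_of_real integral_mult_right_zero)
  finally have eq: "(\<integral>\<xi>. exp (- (s * norm \<xi>)\<^sup>2 / 2) * power_spectrum M \<xi> \<partial>lborel) = ?c * (\<integral>q. ?g q \<partial>(M \<Otimes>\<^sub>M M))"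
    by (simp only: of_real_eq_iff)
  have "(\<integral>\<^sup>+\<xi>. ennreal (exp (- (s * norm \<xi>)\<^sup>2 / 2) * power_spectrum M \<xi>) \<partial>lborel)
      = ennreal (\<integral>\<xi>. exp (- (s * norm \<xi>)\<^sup>2 / 2) * power_spectrum M \<xi> \<partial>lborel)"
    using gaussian_power_spectrum(1)[OF assms, of 0]
    by (intro nn_integral_eq_integral) (simp_all only: diff_0_right, auto)
  also have "\<dots> = ennreal ?c * ennreal (\<integral>q. ?g q \<partial>(M \<Otimes>\<^sub>M M))"
    unfolding eq using c by (rule ennreal_mult') 
  also have "ennreal (\<integral>q. ?g q \<partial>(M \<Otimes>\<^sub>M M)) = (\<integral>\<^sup>+q. ennreal (?g q) \<partial>(M \<Otimes>\<^sub>M M))"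
    by (rule nn_integral_eq_integral[symmetric, OF int]) simp
  also have "\<dots> = (\<integral>\<^sup>+x. \<integral>\<^sup>+x'. ennreal (exp (- (norm (x - x') / s)\<^sup>2 / 2)) \<partial>M \<partial>M)"
    by (subst nn_integral_fst[symmetric]) simp_all
  finally show ?thesis .
qed

text \<open>A Gaussian of width \<open>1 / R\<close> lies below a multiple of
  \<open>R powr (- s)\<close> times the Riesz kernel.\<close>

lemma gaussian_energy_le:
  fixes M :: "'a::euclidean_space measure"
  assumes F: "frostman_measure E s' M" and "s < s'"
  obtains K where "0 \<le> K" "\<And>R. 1 \<le> R \<Longrightarrow>
    (\<integral>\<^sup>+x. \<integral>\<^sup>+x'. ennreal (exp (- (norm (x - x') * R)\<^sup>2 / 2)) \<partial>M \<partial>M) \<le> ennreal (K * R powr (- s))"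
proof -
  interpret prob_space M
    using F unfolding frostman_measure_def by blast
  have setsM [measurable_cong]: "sets M = sets borel"
    using F unfolding frostman_measure_def by blast
  show ?thesis
  proof (cases "0 < s")
    case True
    obtain K where K: "0 \<le> K" "\<And>x. (\<integral>\<^sup>+x'. riesz s (x - x') \<partial>M) \<le> ennreal K"
      using riesz_potential_bounded[OF F True \<open>s < s'\<close>] by blast
    let ?e = "exp (s\<^sup>2 / (4 * (1/2)))"
    show ?thesis
    proof
      show "0 \<le> ?e * K" using K(1) by simp
      fix R :: real assume R: "1 \<le> R"
      have "(\<integral>\<^sup>+x. \<integral>\<^sup>+x'. ennreal (exp (- (norm (x - x') * R)\<^sup>2 / 2)) \<partial>M \<partial>M)
          \<le> (\<integral>\<^sup>+x. \<integral>\<^sup>+x'. ennreal (?e * R powr (- s)) * riesz s (x - x') \<partial>M \<partial>M)"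
      proof (intro nn_integral_mono)
        fix x x'
        show "ennreal (exp (- (norm (x - x') * R)\<^sup>2 / 2)) \<le> ennreal (?e * R powr (- s)) * riesz s (x - x')"
        proof (cases "x - x' = 0")
          case True
          then have "ennreal (?e * R powr (- s)) * riesz s (x - x') = top"
            using R unfolding riesz_def by (subst ennreal_mult_eq_top_iff) auto
          then show ?thesis by (simp only: top_greatest)
        next
          case False
          define u where "u = norm (x - x') * R"
          have u: "0 < u" using False R by (simp add: u_def)
          have pos: "0 < norm (x - x') powr s"
            using False by (intro powr_gt_zero[THEN iffD2]) auto
          have "u powr s * exp (- u\<^sup>2 / 2) \<le> (1 + u) powr s * exp (- (1/2 * u\<^sup>2))"
            using u \<open>0 < s\<close> by (intro mult_mono powr_mono2) auto
          also have "\<dots> \<le> ?e"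
            using u \<open>0 < s\<close> by (intro powr_mult_gaussian_le) auto
          finally have "exp (- u\<^sup>2 / 2) \<le> ?e * u powr (- s)"
            using u unfolding powr_minus by (simp add: field_simps)
          also have "\<dots> = ?e * R powr (- s) * inverse (norm (x - x') powr s)"
            using R by (simp add: u_def powr_mult powr_minus)
          finally show ?thesis
            unfolding riesz_def inverse_ennreal[OF pos] u_def
            by (subst ennreal_mult[symmetric]) (auto intro: ennreal_leI)
        qed
      qed
      also have "\<dots> = ennreal (?e * R powr (- s)) * (\<integral>\<^sup>+x. \<integral>\<^sup>+x'. riesz s (x - x') \<partial>M \<partial>M)"
        by (simp add: nn_integral_cmult)
      also have "\<dots> \<le> ennreal (?e * R powr (- s)) * (\<integral>\<^sup>+x. ennreal K \<partial>M)"
        by (intro mult_left_mono nn_integral_mono K(2)) auto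
      also have "\<dots> = ennreal (?e * K * R powr (- s))"
        using K(1) by (simp add: emeasure_space_1 ennreal_mult[symmetric] mult_ac)
      finally show "(\<integral>\<^sup>+x. \<integral>\<^sup>+x'. ennreal (exp (- (norm (x - x') * R)\<^sup>2 / 2)) \<partial>M \<partial>M) \<le> ennreal (?e * K * R powr (- s))" .
    qed
  next
    \<comment> \<open>Non-positive \<open>s\<close> occurs in
      \<open>spectrum_integral_finite\<close> when \<tau> is large; then 1 is already at most
      \<open>R powr (- s)\<close>.\<close>
    case False
    show ?thesis
    proof
      fix R :: real assume R: "1 \<le> R"
      have "(\<integral>\<^sup>+x. \<integral>\<^sup>+x'. ennreal (exp (- (norm (x - x') * R)\<^sup>2 / 2)) \<partial>M \<partial>M) \<le> (\<integral>\<^sup>+x. \<integral>\<^sup>+x'. ennreal 1 \<partial>M \<partial>M)"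
        by (intro nn_integral_mono ennreal_leI) simp
      also have "\<dots> = ennreal 1" by (simp add: emeasure_space_1)
      also have "\<dots> \<le> ennreal (1 * R powr (- s))"
        using False R by (intro ennreal_leI) (simp add: ge_one_powr_ge_zero)
      finally show "(\<integral>\<^sup>+x. \<integral>\<^sup>+x'. ennreal (exp (- (norm (x - x') * R)\<^sup>2 / 2)) \<partial>M \<partial>M) \<le> ennreal (1 * R powr (- s))" .
    qed simp
  qed
qed

text \<open>By Parseval the power spectrum below height \<open>R\<close> has integral of order
  \<open>R ^ DIM('a)\<close> times a Gaussian energy. Were the exponent larger than the dimension,
  this would tend to 0 although it grows with \<open>R\<close>, so a strictly positive kernel would
  have double integral 0.\<close>

lemma frostman_exponent_le_dim:
  fixes M :: "'a::euclidean_space measure"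
  assumes F: "frostman_measure E s' M"
  shows "s' \<le> DIM('a)"
proof (rule ccontr)
  assume gt: "\<not> s' \<le> DIM('a)"
  interpret prob_space M
    using F unfolding frostman_measure_def by blast
  have setsM [measurable_cong]: "sets M = sets borel"
    using F unfolding frostman_measure_def by blast
  define s where "s = (s' + DIM('a)) / 2"
  have s: "s < s'" "real DIM('a) < s" using gt by (auto simp: s_def)
  obtain K where K: "0 \<le> K" "\<And>R. 1 \<le> R \<Longrightarrow>
    (\<integral>\<^sup>+x. \<integral>\<^sup>+x'. ennreal (exp (- (norm (x - x') * R)\<^sup>2 / 2)) \<partial>M \<partial>M) \<le> ennreal (K * R powr (- s))"
    using gaussian_energy_le[OF F s(1)] by blast
  let ?G = "\<lambda>s. \<integral>\<^sup>+\<xi>. ennreal (exp (- (s * norm \<xi>)\<^sup>2 / 2) * power_spectrum M \<xi>) \<partial>lborel"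
  have le: "?G 1 \<le> ennreal (sqrt (2 * pi) ^ DIM('a) * K * R powr (real DIM('a) - s))" if R: "1 \<le> R" for R
  proof -
    have "?G 1 \<le> ?G (1 / R)"
    proof (intro nn_integral_mono ennreal_leI mult_right_mono)
      fix \<xi> :: 'a
      have "1 / R * norm \<xi> \<le> 1 * norm \<xi>" using R by (intro mult_right_mono) auto
      then have "(1 / R * norm \<xi>)\<^sup>2 \<le> (1 * norm \<xi>)\<^sup>2" using R by (intro power_mono) auto
      then show "exp (- (1 * norm \<xi>)\<^sup>2 / 2) \<le> exp (- (1 / R * norm \<xi>)\<^sup>2 / 2)"
        by simp
    qed simp
    also have "\<dots> = ennreal ((sqrt (2 * pi) / (1 / R)) ^ DIM('a)) *
        (\<integral>\<^sup>+x. \<integral>\<^sup>+x'. ennreal (exp (- (norm (x - x') / (1 / R))\<^sup>2 / 2)) \<partial>M \<partial>M)"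
      using R by (intro nn_gaussian_power_spectrum finite_measure_axioms setsM) auto
    also have "\<dots> \<le> ennreal ((sqrt (2 * pi) * R) ^ DIM('a)) * ennreal (K * R powr (- s))"
      using K(2)[OF R] by (simp add: mult_left_mono)
    also have "\<dots> = ennreal ((sqrt (2 * pi) * R) ^ DIM('a) * (K * R powr (- s)))"
      using K(1) R by (intro ennreal_mult[symmetric]) auto
    also have "(sqrt (2 * pi) * R) ^ DIM('a) * (K * R powr (- s)) = sqrt (2 * pi) ^ DIM('a) * K * R powr (real DIM('a) - s)"
      using R by (simp add: power_mult_distrib powr_diff powr_minus powr_realpow field_simps)
    finally show ?thesis .
  qed
  have lim: "((\<lambda>R. ennreal (sqrt (2 * pi) ^ DIM('a) * K * R powr (real DIM('a) - s))) \<longlongrightarrow> ennreal 0) at_top"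
  proof (rule tendsto_ennrealI)
    have "((\<lambda>R::real. R powr (real DIM('a) - s)) \<longlongrightarrow> 0) at_top"
      using s(2) by (intro tendsto_neg_powr filterlim_ident) auto
    from tendsto_mult_right_zero[OF this]
    show "((\<lambda>R. sqrt (2 * pi) ^ DIM('a) * K * R powr (real DIM('a) - s)) \<longlongrightarrow> 0) at_top" .
  qed
  have "?G 1 \<le> ennreal 0"
  proof (rule tendsto_lowerbound[OF lim])
    show "\<forall>\<^sub>F R in at_top. ?G 1 \<le> ennreal (sqrt (2 * pi) ^ DIM('a) * K * R powr (real DIM('a) - s))"
      using eventually_ge_at_top[of 1] by eventually_elim (rule le)
  qed simp
  then have "ennreal ((sqrt (2 * pi) / 1) ^ DIM('a)) *
      (\<integral>\<^sup>+x. \<integral>\<^sup>+x'. ennreal (exp (- (norm (x - x') / 1)\<^sup>2 / 2)) \<partial>M \<partial>M) = 0"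
    unfolding nn_gaussian_power_spectrum[OF finite_measure_axioms setsM zero_less_one] by simp
  then have "AE x in M. (\<integral>\<^sup>+x'. ennreal (exp (- (norm (x - x'))\<^sup>2 / 2)) \<partial>M) = 0"
    by (simp add: nn_integral_0_iff_AE)
  then have "AE x in M. AE x' in M. False"
    by eventually_elim (simp add: nn_integral_0_iff_AE not_le)
  then show False by simp
qed

text \<open>The left side averages the spectrum over unit bumps centred along the line of
  \<open>y\<close>, up to height about \<open>1 / \<delta>\<close>. Transforming in \<xi> gives the
  unit Gaussian in \<open>x - x'\<close> with a phase linear in \<open>t\<close>; transforming in
  \<open>t\<close> turns that phase into a Gaussian slab of width \<delta>.\<close>

lemma gaussian_slab_spectrum:
  fixes M :: "'a::euclidean_space measure" and y :: 'a
  assumes M: "finite_measure M" and setsM [measurable_cong]: "sets M = sets borel" and "0 < \<delta>"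
  shows "(\<integral>\<^sup>+t. \<integral>\<^sup>+\<xi>. ennreal (exp (- (\<delta> * t)\<^sup>2 / 2)) * ennreal (exp (- (norm (\<xi> - t *\<^sub>R y))\<^sup>2 / 2) * power_spectrum M \<xi>) \<partial>lborel \<partial>lborel)
      = ennreal (sqrt (2 * pi) ^ DIM('a) * (sqrt (2 * pi) / \<delta>)) *
        (\<integral>\<^sup>+x. \<integral>\<^sup>+x'. ennreal (exp (- (norm (x - x'))\<^sup>2 / 2) * exp (- (((x - x') \<bullet> y) / \<delta>)\<^sup>2 / 2)) \<partial>M \<partial>M)"
proof -
  interpret finite_measure M by fact
  interpret P: pair_sigma_finite M M ..
  let ?Q = "M \<Otimes>\<^sub>M M"
  interpret Q: finite_measure ?Q by (intro finite_measure_pair M)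
  let ?c = "sqrt (2 * pi) ^ DIM('a)"
  define g where "g q = ?c * exp (- (norm (fst q - snd q))\<^sup>2 / 2)" for q :: "'a \<times> 'a"
  define h where "h q = sqrt (2 * pi) / \<delta> * exp (- ((y \<bullet> (fst q - snd q)) / \<delta>)\<^sup>2 / 2)" for q :: "'a \<times> 'a"
  define H where "H w = (\<integral>\<xi>. exp (- (1 * norm (\<xi> - w))\<^sup>2 / 2) * power_spectrum M \<xi> \<partial>lborel)" for w
  \<comment> \<open>With the unit Gaussian absorbed as a density the measure stays finite, so the
    integral in \<open>t\<close> is again an instance of \<open>fubini_phase\<close>.\<close>
  define Q' where "Q' = density ?Q (\<lambda>q. ennreal (g q))"
  have [measurable]: "g \<in> borel_measurable ?Q" "h \<in> borel_measurable ?Q"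
    unfolding g_def h_def by measurable
  have g0: "0 \<le> g q" and h0: "0 \<le> h q" for q
    using \<open>0 < \<delta>\<close> by (simp_all add: g_def h_def)
  have Q'f: "finite_measure Q'"
  proof (rule finite_measureI)
    have "emeasure Q' (space Q') = (\<integral>\<^sup>+q. ennreal (g q) \<partial>?Q)"
      by (simp add: Q'_def emeasure_density cong: nn_integral_cong)
    also have "\<dots> \<le> (\<integral>\<^sup>+q. ennreal ?c \<partial>?Q)"
      by (intro nn_integral_mono ennreal_leI) (simp add: g_def mult_le_cancel_left1)
    finally show "emeasure Q' (space Q') \<noteq> \<infinity>"
      by (auto simp: top_unique ennreal_mult_eq_top_iff)
  qed
  have HQ: "complex_of_real (H w) = (\<integral>q. cis (w \<bullet> (fst q - snd q)) \<partial>Q')" for w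
    unfolding H_def gaussian_power_spectrum(2)[OF M setsM zero_less_one] Q'_def
    by (subst integral_density) (auto simp: g0, simp add: g_def scaleR_conv_of_real)
  have meas: "(\<lambda>(t, q). t * (y \<bullet> (fst q - snd q))) \<in> borel_measurable ((lborel :: real measure) \<Otimes>\<^sub>M Q')"
    unfolding Q'_def by measurable
  have w: "integrable lborel (\<lambda>t::real. exp (- (\<delta> * t)\<^sup>2 / 2))"
    using integrable_gaussian[OF \<open>0 < \<delta>\<close>, of "0::real"] by (simp add: power_mult_distrib)
  note fub = fubini_phase[OF lborel.sigma_finite_measure_axioms Q'f w meas]
  have HQ': "(\<integral>q. cis (t * (y \<bullet> (fst q - snd q))) \<partial>Q') = complex_of_real (H (t *\<^sub>R y))" for t
    using HQ[of "t *\<^sub>R y"] by (simp add: inner_diff_right algebra_simps)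
  have hQ: "(\<integral>t. complex_of_real (exp (- (\<delta> * t)\<^sup>2 / 2)) * cis (t * (y \<bullet> (fst q - snd q))) \<partial>lborel) = complex_of_real (h q)" for q
    unfolding h_def using gaussian_fourier_real[OF \<open>0 < \<delta>\<close>] by (simp only: has_bochner_integral_iff)
  have intH: "integrable lborel (\<lambda>t. exp (- (\<delta> * t)\<^sup>2 / 2) * H (t *\<^sub>R y))"
    using fub(1) unfolding HQ' of_real_mult[symmetric] by (simp only: complex_of_real_integrable_eq)
  have inth: "integrable Q' h"
    using fub(2) unfolding hQ by (simp only: complex_of_real_integrable_eq)
  have eq: "(\<integral>t. exp (- (\<delta> * t)\<^sup>2 / 2) * H (t *\<^sub>R y) \<partial>lborel) = (\<integral>q. h q \<partial>Q')"
    using fub(3) unfolding HQ' hQ of_real_mult[symmetric] integral_complex_of_real by (simp only: of_real_eq_iff)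
  have H0: "0 \<le> H w" for w
    unfolding H_def by (intro Bochner_Integration.integral_nonneg) simp
  have nnH: "(\<integral>\<^sup>+\<xi>. ennreal (exp (- (norm (\<xi> - w))\<^sup>2 / 2) * power_spectrum M \<xi>) \<partial>lborel) = ennreal (H w)" for w
    using gaussian_power_spectrum(1)[OF M setsM zero_less_one, of w] unfolding H_def mult_1
    by (intro nn_integral_eq_integral) auto
  have [measurable]: "power_spectrum M \<in> borel_measurable borel"
    by (rule borel_measurable_power_spectrum[OF M setsM])
  have "(\<integral>\<^sup>+t. \<integral>\<^sup>+\<xi>. ennreal (exp (- (\<delta> * t)\<^sup>2 / 2)) * ennreal (exp (- (norm (\<xi> - t *\<^sub>R y))\<^sup>2 / 2) * power_spectrum M \<xi>) \<partial>lborel \<partial>lborel)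
      = (\<integral>\<^sup>+t. ennreal (exp (- (\<delta> * t)\<^sup>2 / 2) * H (t *\<^sub>R y)) \<partial>lborel)"
  proof (rule nn_integral_cong)
    fix t :: real
    have "(\<integral>\<^sup>+\<xi>. ennreal (exp (- (\<delta> * t)\<^sup>2 / 2)) * ennreal (exp (- (norm (\<xi> - t *\<^sub>R y))\<^sup>2 / 2) * power_spectrum M \<xi>) \<partial>lborel)
        = ennreal (exp (- (\<delta> * t)\<^sup>2 / 2)) * (\<integral>\<^sup>+\<xi>. ennreal (exp (- (norm (\<xi> - t *\<^sub>R y))\<^sup>2 / 2) * power_spectrum M \<xi>) \<partial>lborel)"
      by (rule nn_integral_cmult) measurable
    then show "(\<integral>\<^sup>+\<xi>. ennreal (exp (- (\<delta> * t)\<^sup>2 / 2)) * ennreal (exp (- (norm (\<xi> - t *\<^sub>R y))\<^sup>2 / 2) * power_spectrum M \<xi>) \<partial>lborel)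
        = ennreal (exp (- (\<delta> * t)\<^sup>2 / 2) * H (t *\<^sub>R y))"
      by (simp only: nnH ennreal_mult H0 exp_ge_zero)
  qed
  also have "\<dots> = ennreal (\<integral>q. h q \<partial>Q')"
    unfolding eq[symmetric] using H0 by (intro nn_integral_eq_integral intH) auto
  also have "\<dots> = (\<integral>\<^sup>+q. ennreal (h q) \<partial>Q')"
    using h0 by (intro nn_integral_eq_integral[symmetric] inth) auto
  also have "\<dots> = (\<integral>\<^sup>+q. ennreal (g q) * ennreal (h q) \<partial>?Q)"
    unfolding Q'_def by (intro nn_integral_density) auto
  also have "\<dots> = (\<integral>\<^sup>+q. ennreal (?c * (sqrt (2 * pi) / \<delta>)) *
      ennreal (exp (- (norm (fst q - snd q))\<^sup>2 / 2) * exp (- (((fst q - snd q) \<bullet> y) / \<delta>)\<^sup>2 / 2)) \<partial>?Q)"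
    using \<open>0 < \<delta>\<close>
    by (intro nn_integral_cong) (simp add: g_def h_def ennreal_mult[symmetric] inner_commute mult_ac)
  also have "\<dots> = ennreal (?c * (sqrt (2 * pi) / \<delta>)) *
      (\<integral>\<^sup>+q. ennreal (exp (- (norm (fst q - snd q))\<^sup>2 / 2) * exp (- (((fst q - snd q) \<bullet> y) / \<delta>)\<^sup>2 / 2)) \<partial>?Q)"
    by (rule nn_integral_cmult) measurable
  also have "(\<integral>\<^sup>+q. ennreal (exp (- (norm (fst q - snd q))\<^sup>2 / 2) * exp (- (((fst q - snd q) \<bullet> y) / \<delta>)\<^sup>2 / 2)) \<partial>?Q)
      = (\<integral>\<^sup>+x. \<integral>\<^sup>+x'. ennreal (exp (- (norm (x - x'))\<^sup>2 / 2) * exp (- (((x - x') \<bullet> y) / \<delta>)\<^sup>2 / 2)) \<partial>M \<partial>M)"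
    by (subst nn_integral_fst[symmetric]) simp_all
  finally show ?thesis .
qed

text \<open>On the support \<open>norm (x - x')\<close> is at most \<open>2 * D\<close>, so the unit
  Gaussian is at least \<open>exp (- 2 * D\<^sup>2)\<close>; the slab Gaussian is at least
  \<open>exp (- 1/2)\<close> on the slab.\<close>

lemma slab_integral_le_spectrum:
  fixes M :: "'a::euclidean_space measure" and y :: 'a
  assumes M: "finite_measure M" and setsM [measurable_cong]: "sets M = sets borel" and "0 < \<delta>"
    and D: "AE x in M. norm x \<le> D"
  shows "(\<integral>\<^sup>+x. slab M y \<delta> x \<partial>M) \<le> ennreal (exp (1/2 + 2 * D\<^sup>2) * \<delta>) *
    (\<integral>\<^sup>+t. \<integral>\<^sup>+\<xi>. ennreal (exp (- (\<delta> * t)\<^sup>2 / 2)) * ennreal (exp (- (norm (\<xi> - t *\<^sub>R y))\<^sup>2 / 2) * power_spectrum M \<xi>) \<partial>lborel \<partial>lborel)"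
proof -
  interpret finite_measure M by fact
  let ?g = "\<lambda>x x'. ennreal (exp (- (norm (x - x'))\<^sup>2 / 2) * exp (- (((x - x') \<bullet> y) / \<delta>)\<^sup>2 / 2))"
  let ?e = "exp (1/2 + 2 * D\<^sup>2)"
  have pt: "indicator {..\<delta>} \<bar>(x - x') \<bullet> y\<bar> \<le> ennreal ?e * ?g x x'" if "norm x \<le> D" "norm x' \<le> D" for x x'
  proof (cases "\<bar>(x - x') \<bullet> y\<bar> \<le> \<delta>")
    case True
    have "norm (x - x') \<le> 2 * D"
      using norm_triangle_ineq4[of x x'] that by linarith
    then have "(norm (x - x'))\<^sup>2 \<le> (2 * D)\<^sup>2"
      by (intro power_mono) auto
    then have 1: "(norm (x - x'))\<^sup>2 / 2 \<le> 2 * D\<^sup>2"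
      by (simp add: power_mult_distrib)
    have "\<bar>((x - x') \<bullet> y) / \<delta>\<bar> \<le> 1"
      using True \<open>0 < \<delta>\<close> by simp
    then have 2: "(((x - x') \<bullet> y) / \<delta>)\<^sup>2 \<le> 1"
      by (simp only: abs_square_le_1)
    have "1 \<le> exp (1/2 + 2 * D\<^sup>2 + (- (norm (x - x'))\<^sup>2 / 2 + - (((x - x') \<bullet> y) / \<delta>)\<^sup>2 / 2))"
      using 1 2 by (subst one_le_exp_iff) linarith
    also have "\<dots> = ?e * (exp (- (norm (x - x'))\<^sup>2 / 2) * exp (- (((x - x') \<bullet> y) / \<delta>)\<^sup>2 / 2))"
      by (simp only: exp_add)
    finally have "ennreal 1 \<le> ennreal (?e * (exp (- (norm (x - x'))\<^sup>2 / 2) * exp (- (((x - x') \<bullet> y) / \<delta>)\<^sup>2 / 2)))"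
      by (rule ennreal_leI)
    also have "\<dots> = ennreal ?e * ?g x x'"
      by (rule ennreal_mult) auto
    finally show ?thesis
      using True by simp
  qed simp
  let ?J = "\<integral>\<^sup>+x. \<integral>\<^sup>+x'. ?g x x' \<partial>M \<partial>M"
  have "(\<integral>\<^sup>+x. slab M y \<delta> x \<partial>M) \<le> (\<integral>\<^sup>+x. \<integral>\<^sup>+x'. ennreal ?e * ?g x x' \<partial>M \<partial>M)"
    unfolding slab_def
  proof (rule nn_integral_mono_AE)
    show "AE x in M. (\<integral>\<^sup>+x'. indicator {..\<delta>} \<bar>(x - x') \<bullet> y\<bar> \<partial>M) \<le> (\<integral>\<^sup>+x'. ennreal ?e * ?g x x' \<partial>M)"
      using D
    proof eventually_elim
      case (elim x)
      show ?case
        by (rule nn_integral_mono_AE) (use D in eventually_elim, use elim pt in blast)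
    qed
  qed
  also have "\<dots> = ennreal ?e * ?J"
    by (simp add: nn_integral_cmult)
  also have "\<dots> \<le> ennreal ?e * (ennreal \<delta> * (ennreal (sqrt (2 * pi) ^ DIM('a) * (sqrt (2 * pi) / \<delta>)) * ?J))"
  proof (rule mult_left_mono)
    \<comment> \<open>The normalising factors from the Gaussian transforms exceed 1 once \<delta> is
      multiplied back, so they can be inserted for free.\<close>
    have "1 \<le> sqrt (2 * pi)" using pi_gt3 by simp
    then have "1 \<le> sqrt (2 * pi) ^ DIM('a) * sqrt (2 * pi)"
      by (metis power_Suc2 one_le_power)
    also have "\<dots> = \<delta> * (sqrt (2 * pi) ^ DIM('a) * (sqrt (2 * pi) / \<delta>))"
      using \<open>0 < \<delta>\<close> by simp
    finally have "ennreal 1 \<le> ennreal (\<delta> * (sqrt (2 * pi) ^ DIM('a) * (sqrt (2 * pi) / \<delta>)))"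
      by (rule ennreal_leI)
    also have "\<dots> = ennreal \<delta> * ennreal (sqrt (2 * pi) ^ DIM('a) * (sqrt (2 * pi) / \<delta>))"
      using \<open>0 < \<delta>\<close> by (intro ennreal_mult) auto
    finally have "1 * ?J \<le> ennreal \<delta> * ennreal (sqrt (2 * pi) ^ DIM('a) * (sqrt (2 * pi) / \<delta>)) * ?J"
      by (intro mult_right_mono) auto
    then show "?J \<le> ennreal \<delta> * (ennreal (sqrt (2 * pi) ^ DIM('a) * (sqrt (2 * pi) / \<delta>)) * ?J)"
      by (simp only: mult_1 mult.assoc)
  qed simp
  also have "\<dots> = ennreal (?e * \<delta>) * (ennreal (sqrt (2 * pi) ^ DIM('a) * (sqrt (2 * pi) / \<delta>)) * ?J)"
    using \<open>0 < \<delta>\<close> by (simp only: ennreal_mult[of ?e \<delta>] exp_ge_zero less_imp_le mult.assoc)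
  finally show ?thesis
    unfolding gaussian_slab_spectrum[OF M setsM \<open>0 < \<delta>\<close>] .
qed

text \<open>Dyadic Gaussians dominate the weight: those of height \<open>2 ^ k\<close> carry the
  factor \<open>(1/2) ^ k\<close> to the power \<tau>, and their spectral integral is of order
  \<open>2 ^ k\<close> to the power \<open>DIM('a) - s\<close> by the Gaussian energy bound. The
  midpoint \<open>s\<close> keeps \<open>s < s'\<close> and makes the series geometric.\<close>

lemma spectrum_integral_finite:
  fixes M :: "'a::euclidean_space measure"
  assumes F: "frostman_measure E s' M" and \<tau>: "real DIM('a) - s' < \<tau>"
  shows "(\<integral>\<^sup>+\<xi>. ennreal ((1 + norm \<xi>) powr (- \<tau>) * power_spectrum M \<xi>) \<partial>lborel) < \<infinity>"
proof -
  interpret prob_space M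
    using F unfolding frostman_measure_def by blast
  have setsM [measurable_cong]: "sets M = sets borel"
    using F unfolding frostman_measure_def by blast
  have [measurable]: "power_spectrum M \<in> borel_measurable borel"
    by (rule borel_measurable_power_spectrum[OF finite_measure_axioms setsM])
  define s where "s = (s' + (real DIM('a) - \<tau>)) / 2"
  have s: "s < s'" "real DIM('a) - s - \<tau> < 0" using \<tau> by (auto simp: s_def field_simps)
  obtain K where K: "0 \<le> K" "\<And>R. 1 \<le> R \<Longrightarrow>
    (\<integral>\<^sup>+x. \<integral>\<^sup>+x'. ennreal (exp (- (norm (x - x') * R)\<^sup>2 / 2)) \<partial>M \<partial>M) \<le> ennreal (K * R powr (- s))"
    using gaussian_energy_le[OF F s(1)] by blast
  let ?G = "\<lambda>k \<xi>. exp (- ((1/2) ^ k * norm \<xi>)\<^sup>2 / 2) * power_spectrum M \<xi>"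
  let ?b = "\<lambda>k::nat. 2 powr \<bar>\<tau>\<bar> * exp 2 * ((1/2) ^ k) powr \<tau>"
  have pt: "ennreal ((1 + norm \<xi>) powr (- \<tau>) * power_spectrum M \<xi>) \<le> (\<Sum>k. ennreal (?b k) * ennreal (?G k \<xi>))" for \<xi> :: 'a
  proof -
    define r where "r = 1 / (1 + norm \<xi>)"
    have pos: "0 < 1 + norm \<xi>" by (simp add: add_pos_nonneg)
    have r: "0 < r" "r \<le> 1" "r * norm \<xi> \<le> 1"
      using pos by (simp_all add: r_def)
    obtain k where k: "(1/2) ^ Suc k < r" "r \<le> (1/2) ^ k"
      using ex_dyadic_scale[OF r(1,2)] .
    have "(1 + norm \<xi>) powr (- \<tau>) = r powr \<tau>"
      using pos by (simp add: r_def powr_divide powr_minus_divide)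
    \<comment> \<open>\<tau> may have either sign; the factor pays for replacing \<open>r\<close> by
      its dyadic neighbour in the unfavourable case.\<close>
    also have "\<dots> \<le> 2 powr \<bar>\<tau>\<bar> * ((1/2) ^ k) powr \<tau>"
    proof (cases "0 \<le> \<tau>")
      case True
      have "r powr \<tau> \<le> ((1/2) ^ k) powr \<tau>"
        using True k r by (intro powr_mono2) auto
      also have "\<dots> \<le> 2 powr \<bar>\<tau>\<bar> * ((1/2) ^ k) powr \<tau>"
        by (simp add: mult_le_cancel_right1 ge_one_powr_ge_zero)
      finally show ?thesis .
    next
      case False
      have "r powr \<tau> \<le> ((1/2) * (1/2) ^ k) powr \<tau>"
        using False k r by (intro powr_mono2') auto
      also have "\<dots> = (1/2) powr \<tau> * ((1/2) ^ k) powr \<tau>"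
        by (rule powr_mult)
      also have "(1/2) powr \<tau> = 2 powr \<bar>\<tau>\<bar>"
        using False by (simp add: powr_divide powr_minus_divide)
      finally show ?thesis .
    qed
    finally have 1: "(1 + norm \<xi>) powr (- \<tau>) \<le> 2 powr \<bar>\<tau>\<bar> * ((1/2) ^ k) powr \<tau>" .
    have "(1/2) ^ k * norm \<xi> \<le> 2 * r * norm \<xi>"
      using k by (intro mult_right_mono) auto
    then have "(1/2) ^ k * norm \<xi> \<le> 2"
      using r(3) by linarith
    then have "((1/2) ^ k * norm \<xi>)\<^sup>2 \<le> 2\<^sup>2"
      by (intro power_mono) auto
    then have 2: "1 \<le> exp 2 * exp (- ((1/2) ^ k * norm \<xi>)\<^sup>2 / 2)"
      unfolding exp_add[symmetric] by (subst one_le_exp_iff) simp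
    have "(1 + norm \<xi>) powr (- \<tau>) * 1 * power_spectrum M \<xi>
        \<le> (2 powr \<bar>\<tau>\<bar> * ((1/2) ^ k) powr \<tau>) * (exp 2 * exp (- ((1/2) ^ k * norm \<xi>)\<^sup>2 / 2)) * power_spectrum M \<xi>"
      by (intro mult_right_mono mult_mono 1 2) auto
    also have "\<dots> = ?b k * ?G k \<xi>"
      by (simp only: mult_ac)
    finally have "ennreal ((1 + norm \<xi>) powr (- \<tau>) * power_spectrum M \<xi>) \<le> ennreal (?b k) * ennreal (?G k \<xi>)"
      by (subst ennreal_mult[symmetric]) (auto intro: ennreal_leI)
    also have "\<dots> \<le> (\<Sum>k. ennreal (?b k) * ennreal (?G k \<xi>))"
    proof -
      have "(\<Sum>k\<in>{k}. ennreal (?b k) * ennreal (?G k \<xi>)) \<le> (\<Sum>k. ennreal (?b k) * ennreal (?G k \<xi>))"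
        by (rule sum_le_suminf) auto
      then show ?thesis by (simp only: sum.insert sum.empty finite.intros empty_iff not_False_eq_True add_0_right)
    qed
    finally show ?thesis .
  qed
  let ?a = "\<lambda>k::nat. 2 powr \<bar>\<tau>\<bar> * exp 2 * sqrt (2 * pi) ^ DIM('a) * K * (2 powr (real DIM('a) - s - \<tau>)) ^ k"
  have term_le: "ennreal (?b k) * (\<integral>\<^sup>+\<xi>. ennreal (?G k \<xi>) \<partial>lborel) \<le> ennreal (?a k)" for k
  proof -
    have R: "(1::real) \<le> 2 ^ k" by simp
    have div: "u / (1/2) ^ k = u * 2 ^ k" for u :: real
      by (simp add: power_one_over)
    have "(\<integral>\<^sup>+\<xi>. ennreal (?G k \<xi>) \<partial>lborel) = ennreal ((sqrt (2 * pi) / (1/2) ^ k) ^ DIM('a)) *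
        (\<integral>\<^sup>+x. \<integral>\<^sup>+x'. ennreal (exp (- (norm (x - x') / (1/2) ^ k)\<^sup>2 / 2)) \<partial>M \<partial>M)"
      by (intro nn_gaussian_power_spectrum finite_measure_axioms setsM) auto
    also have "\<dots> \<le> ennreal ((sqrt (2 * pi) * 2 ^ k) ^ DIM('a)) * ennreal (K * (2 ^ k) powr (- s))"
      unfolding div by (intro mult_left_mono K(2) R) simp
    also have "\<dots> = ennreal ((sqrt (2 * pi) * 2 ^ k) ^ DIM('a) * (K * (2 ^ k) powr (- s)))"
      using K(1) by (intro ennreal_mult[symmetric]) auto
    finally have "ennreal (?b k) * (\<integral>\<^sup>+\<xi>. ennreal (?G k \<xi>) \<partial>lborel)
        \<le> ennreal (?b k) * ennreal ((sqrt (2 * pi) * 2 ^ k) ^ DIM('a) * (K * (2 ^ k) powr (- s)))"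
      by (rule mult_left_mono) simp
    also have "\<dots> = ennreal (?b k * ((sqrt (2 * pi) * 2 ^ k) ^ DIM('a) * (K * (2 ^ k) powr (- s))))"
      using K(1) by (intro ennreal_mult[symmetric]) auto
    also have "?b k * ((sqrt (2 * pi) * 2 ^ k) ^ DIM('a) * (K * (2 ^ k) powr (- s))) = ?a k"
    proof -
      have "((1/2::real) ^ k) powr \<tau> * ((2 ^ k) ^ DIM('a) * (2 ^ k) powr (- s)) = (2 ^ k) powr (- \<tau> + (real DIM('a) + - s))"
        by (simp only: powr_add) (simp add: power_one_over powr_divide powr_minus_divide powr_realpow)
      also have "\<dots> = (2 powr (real DIM('a) - s - \<tau>)) ^ k"
        by (simp add: powr_realpow[symmetric] powr_powr powr_power algebra_simps)
      finally have e: "((1/2::real) ^ k) powr \<tau> * ((2 ^ k) ^ DIM('a) * (2 ^ k) powr (- s)) = (2 powr (real DIM('a) - s - \<tau>)) ^ k" .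
      show ?thesis
        unfolding e[symmetric] power_mult_distrib[of "sqrt (2 * pi)"] by (simp only: mult_ac)
    qed
    finally show ?thesis .
  qed
  have "(\<integral>\<^sup>+\<xi>. ennreal ((1 + norm \<xi>) powr (- \<tau>) * power_spectrum M \<xi>) \<partial>lborel)
      \<le> (\<integral>\<^sup>+\<xi>. (\<Sum>k. ennreal (?b k) * ennreal (?G k \<xi>)) \<partial>lborel)"
    by (intro nn_integral_mono pt)
  also have "\<dots> = (\<Sum>k. \<integral>\<^sup>+\<xi>. ennreal (?b k) * ennreal (?G k \<xi>) \<partial>lborel)"
    by (intro nn_integral_suminf) measurable
  also have "\<dots> = (\<Sum>k. ennreal (?b k) * (\<integral>\<^sup>+\<xi>. ennreal (?G k \<xi>) \<partial>lborel))"
    by (intro suminf_cong nn_integral_cmult) measurable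
  also have "\<dots> \<le> (\<Sum>k. ennreal (?a k))"
    by (intro suminf_le term_le) auto
  also have "\<dots> < \<infinity>"
  proof -
    have "summable ?a"
      using s by (intro summable_mult summable_geometric) (auto simp: powr_less_one)
    then show ?thesis
      using K(1) by (simp add: suminf_ennreal2 less_top[symmetric])
  qed
  finally show ?thesis .
qed

section \<open>Tubes\<close>

lemma open_tube: "open (tube v \<rho>)"
  unfolding tube_def by blast

text \<open>The right side is the squared distance of \<xi> from the line through \<open>y\<close>.
  That distance and the distance of \<open>y\<close> from the line through \<xi> are the sine of the
  same angle times \<open>norm \<xi>\<close> and \<open>norm y\<close>, and the latter distance is
  at least \<open>r\<close>. A tube extends to one side of the origin only, hence two of
  them.\<close>

lemma dist_line_outside_tubes:
  fixes \<xi> y :: "'a::euclidean_space"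
  assumes "\<xi> \<noteq> 0" "y \<noteq> 0" "0 < A" "norm y \<le> A" "0 \<le> r"
    and out: "y \<notin> tube ((A / norm \<xi>) *\<^sub>R \<xi>) r" "y \<notin> tube (- ((A / norm \<xi>) *\<^sub>R \<xi>)) r"
  shows "(norm \<xi> * r / A)\<^sup>2 \<le> (norm \<xi>)\<^sup>2 - (\<xi> \<bullet> y)\<^sup>2 / (norm y)\<^sup>2"
proof -
  define e where "e = \<xi> /\<^sub>R norm \<xi>"
  have e: "norm e = 1" "\<xi> = norm \<xi> *\<^sub>R e" "(A / norm \<xi>) *\<^sub>R \<xi> = A *\<^sub>R e"
    using \<open>\<xi> \<noteq> 0\<close> by (simp_all add: e_def divide_inverse)
  have ee: "e \<bullet> e = 1" using e(1) by (simp add: norm_eq_1)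
  define c where "c = e \<bullet> y"
  have c: "\<bar>c\<bar> \<le> A"
    using Cauchy_Schwarz_ineq2[of e y] e(1) \<open>norm y \<le> A\<close> by (simp add: c_def)
  \<comment> \<open>The foot of the perpendicular from \<open>y\<close> lies on one of the two axes,
    because \<open>norm y \<le> A\<close>.\<close>
  have "c *\<^sub>R e \<in> closed_segment 0 (A *\<^sub>R e) \<or> c *\<^sub>R e \<in> closed_segment 0 (- (A *\<^sub>R e))"
  proof (cases "0 \<le> c")
    case True
    then have "c *\<^sub>R e = (1 - c / A) *\<^sub>R 0 + (c / A) *\<^sub>R (A *\<^sub>R e)" "0 \<le> c / A" "c / A \<le> 1"
      using c \<open>0 < A\<close> by auto
    then show ?thesis unfolding closed_segment_def by blast
  next
    case False
    have "0 \<le> - c / A"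
      using False \<open>0 < A\<close> by (intro divide_nonneg_pos) auto
    moreover have "- c / A \<le> 1"
      using c \<open>0 < A\<close> unfolding pos_divide_le_eq[OF \<open>0 < A\<close>] by linarith
    moreover have "c *\<^sub>R e = (1 - (- c / A)) *\<^sub>R 0 + (- c / A) *\<^sub>R (- (A *\<^sub>R e))"
      using \<open>0 < A\<close> by simp
    ultimately show ?thesis unfolding closed_segment_def by blast
  qed
  then have "y \<notin> ball (c *\<^sub>R e) r"
    using out unfolding tube_def e(3) by blast
  then have "r \<le> norm (y - c *\<^sub>R e)"
    by (simp add: dist_norm norm_minus_commute)
  then have "r\<^sup>2 \<le> (norm (y - c *\<^sub>R e))\<^sup>2"
    using \<open>0 \<le> r\<close> by (intro power_mono) auto
  also have "\<dots> = (norm y)\<^sup>2 - c\<^sup>2"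
    unfolding power2_norm_eq_inner
    by (simp add: inner_diff_left inner_diff_right ee c_def inner_commute power2_eq_square)
  finally have r: "r\<^sup>2 \<le> (norm y)\<^sup>2 - c\<^sup>2" .
  have "(norm \<xi> * r / A)\<^sup>2 = (norm \<xi>)\<^sup>2 * (r\<^sup>2 / A\<^sup>2)"
    by (simp add: power_mult_distrib power_divide)
  also have "\<dots> \<le> (norm \<xi>)\<^sup>2 * (((norm y)\<^sup>2 - c\<^sup>2) / (norm y)\<^sup>2)"
  proof (intro mult_left_mono frac_le r)
    show "(norm y)\<^sup>2 \<le> A\<^sup>2" using \<open>norm y \<le> A\<close> by (intro power_mono) auto
    show "0 \<le> (norm y)\<^sup>2 - c\<^sup>2" using r zero_le_power2[of r] by linarith
  qed (use \<open>y \<noteq> 0\<close> in auto)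
  also have "\<dots> = (norm \<xi>)\<^sup>2 - (norm \<xi> * c)\<^sup>2 / (norm y)\<^sup>2"
    using \<open>y \<noteq> 0\<close> by (simp add: field_simps power_mult_distrib)
  also have "norm \<xi> * c = \<xi> \<bullet> y"
    by (subst (2) e(2)) (simp add: c_def)
  finally show ?thesis .
qed

text \<open>Pythagoras at the foot \<open>t0 *\<^sub>R y\<close> splits off the distance of \<xi>
  from the line; the rest is a translated Gaussian in \<open>t\<close>, widened by
  \<open>a \<le> norm y\<close>.\<close>

lemma gaussian_line_integral_le:
  fixes \<xi> y :: "'a::euclidean_space"
  assumes "0 < a" "a \<le> norm y"
  shows "(\<integral>\<^sup>+t. ennreal (exp (- (norm (\<xi> - t *\<^sub>R y))\<^sup>2 / 4)) \<partial>lborel)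
    \<le> ennreal (exp (- ((norm \<xi>)\<^sup>2 - (\<xi> \<bullet> y)\<^sup>2 / (norm y)\<^sup>2) / 4)) * (\<integral>\<^sup>+t. ennreal (exp (- (a * t)\<^sup>2 / 4)) \<partial>lborel)"
proof -
  define t0 where "t0 = (\<xi> \<bullet> y) / (norm y)\<^sup>2"
  let ?\<rho> = "(norm \<xi>)\<^sup>2 - (\<xi> \<bullet> y)\<^sup>2 / (norm y)\<^sup>2"
  have y: "norm y \<noteq> 0" using assms by auto
  have gen: "- (p + b) / 4 \<le> - p / 4 + - c / 4" if "c \<le> b" for p b c :: real
    using that by (simp add: field_simps)
  have "(\<integral>\<^sup>+t. ennreal (exp (- (norm (\<xi> - t *\<^sub>R y))\<^sup>2 / 4)) \<partial>lborel)
      \<le> (\<integral>\<^sup>+t. ennreal (exp (- ?\<rho> / 4)) * ennreal (exp (- (a * (- t0 + 1 * t))\<^sup>2 / 4)) \<partial>lborel)"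
  proof (rule nn_integral_mono)
    fix t :: real
    have "(norm (\<xi> - t *\<^sub>R y))\<^sup>2 = (norm \<xi>)\<^sup>2 - 2 * t * (\<xi> \<bullet> y) + t\<^sup>2 * (norm y)\<^sup>2"
      unfolding power2_norm_eq_inner
      by (simp add: inner_diff_left inner_diff_right inner_commute power2_eq_square)
    also have "\<dots> = ?\<rho> + (norm y * (t - t0))\<^sup>2"
    proof -
      define n where "n = norm y"
      have "n \<noteq> 0" using y by (simp add: n_def)
      then show ?thesis
        unfolding t0_def n_def[symmetric] by (simp add: field_simps power2_eq_square)
    qed
    finally have eq: "(norm (\<xi> - t *\<^sub>R y))\<^sup>2 = ?\<rho> + (norm y * (t - t0))\<^sup>2" .
    have "\<bar>a * (t - t0)\<bar> \<le> \<bar>norm y * (t - t0)\<bar>"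
      using assms unfolding abs_mult by (intro mult_right_mono) auto
    then have "(a * (t - t0))\<^sup>2 \<le> (norm y * (t - t0))\<^sup>2"
      by (simp only: abs_le_square_iff)
    moreover have "- t0 + 1 * t = t - t0" by simp
    ultimately have "exp (- (norm (\<xi> - t *\<^sub>R y))\<^sup>2 / 4) \<le> exp (- ?\<rho> / 4 + - (a * (- t0 + 1 * t))\<^sup>2 / 4)"
      unfolding eq exp_le_cancel_iff by (simp only: gen)
    then show "ennreal (exp (- (norm (\<xi> - t *\<^sub>R y))\<^sup>2 / 4)) \<le> ennreal (exp (- ?\<rho> / 4)) * ennreal (exp (- (a * (- t0 + 1 * t))\<^sup>2 / 4))"
      unfolding exp_add by (subst ennreal_mult[symmetric]) (auto intro: ennreal_leI)
  qed
  also have "\<dots> = ennreal (exp (- ?\<rho> / 4)) * (\<integral>\<^sup>+t. ennreal (exp (- (a * (- t0 + 1 * t))\<^sup>2 / 4)) \<partial>lborel)"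
    by (rule nn_integral_cmult) measurable
  also have "(\<integral>\<^sup>+t. ennreal (exp (- (a * (- t0 + 1 * t))\<^sup>2 / 4)) \<partial>lborel) = (\<integral>\<^sup>+t. ennreal (exp (- (a * t)\<^sup>2 / 4)) \<partial>lborel)"
    using nn_integral_real_affine[of "\<lambda>t. ennreal (exp (- (a * t)\<^sup>2 / 4))" 1 "- t0"] by simp
  finally show ?thesis .
qed

lemma gaussian_integral_finite:
  assumes "0 < (a::real)"
  obtains C where "0 \<le> C" "(\<integral>\<^sup>+t. ennreal (exp (- (a * t)\<^sup>2 / 4)) \<partial>lborel) = ennreal C"
proof -
  have "0 < a / sqrt 2" using assms by simp
  then have "integrable lborel (\<lambda>t::real. exp (- (a / sqrt 2 * norm (t - 0))\<^sup>2 / 2))"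
    by (rule integrable_gaussian)
  then have "integrable lborel (\<lambda>t::real. exp (- (a * t)\<^sup>2 / 4))"
    by (simp add: power_mult_distrib power_divide)
  from nn_integral_eq_integral[OF this] show ?thesis
    by (intro that[of "\<integral>t. exp (- (a * t)\<^sup>2 / 4) \<partial>lborel"] Bochner_Integration.integral_nonneg) auto
qed

lemma powr_one_add_compare:
  fixes u \<sigma> :: real
  assumes "1 \<le> u"
  shows "u powr (- \<sigma>) \<le> 2 powr \<bar>\<sigma>\<bar> * (1 + u) powr (- \<sigma>)"
proof (cases "0 \<le> \<sigma>")
  case True
  have "u powr (- \<sigma>) \<le> ((1 + u) / 2) powr (- \<sigma>)"
    using assms True by (intro powr_mono2') auto
  also have "\<dots> = 2 powr \<bar>\<sigma>\<bar> * (1 + u) powr (- \<sigma>)"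
    using True by (simp add: powr_divide powr_minus field_simps)
  finally show ?thesis .
next
  case False
  have "u powr (- \<sigma>) \<le> (1 + u) powr (- \<sigma>)"
    using assms False by (intro powr_mono2) auto
  also have "\<dots> \<le> 2 powr \<bar>\<sigma>\<bar> * (1 + u) powr (- \<sigma>)"
    by (simp add: mult_le_cancel_right1 ge_one_powr_ge_zero)
  finally show ?thesis .
qed

lemma one_le_powr_compare:
  fixes u R \<sigma> :: real
  assumes "0 \<le> u" "u \<le> R"
  shows "1 \<le> (1 + R) powr \<bar>\<sigma>\<bar> * (1 + u) powr (- \<sigma>)"
proof -
  have "1 \<le> (1 + R) powr \<bar>\<sigma>\<bar> * (1 + u) powr (- \<bar>\<sigma>\<bar>)"
  proof -
    have "1 = (1 + u) powr \<bar>\<sigma>\<bar> * (1 + u) powr (- \<bar>\<sigma>\<bar>)"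
      using assms by (simp add: powr_add[symmetric])
    also have "\<dots> \<le> (1 + R) powr \<bar>\<sigma>\<bar> * (1 + u) powr (- \<bar>\<sigma>\<bar>)"
      using assms by (intro mult_right_mono powr_mono2) auto
    finally show ?thesis .
  qed
  also have "\<dots> \<le> (1 + R) powr \<bar>\<sigma>\<bar> * (1 + u) powr (- \<sigma>)"
    using assms by (intro mult_left_mono powr_mono) auto
  finally show ?thesis .
qed

text \<open>A tube of radius \<open>R powr (\<theta> - 1)\<close> has mass of order \<open>R\<close>
  to the power - (1 - \<theta>) * (\<open>s\<close> - \<epsilon>). Both \<epsilon> and \<theta> must
  be small enough that this decay still beats \<sigma>; \<open>s\<close> may be negative, hence the
  absolute value in the choice of \<theta>.\<close>

lemma exists_tube_scale:
  fixes s \<sigma> :: real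
  assumes "\<sigma> < s"
  obtains \<epsilon> \<theta> where "0 < \<epsilon>" "0 < \<theta>" "\<theta> < 1" "\<sigma> \<le> (1 - \<theta>) * (s - \<epsilon>)"
proof -
  define \<epsilon> where "\<epsilon> = (s - \<sigma>) / 2"
  define m where "m = s - \<epsilon>"
  have m: "\<sigma> < m" "0 < \<epsilon>" using assms by (auto simp: m_def \<epsilon>_def field_simps)
  define \<theta> where "\<theta> = min (1/2) ((m - \<sigma>) / (\<bar>m\<bar> + 1))"
  have \<theta>: "0 < \<theta>" "\<theta> < 1" using m by (auto simp: \<theta>_def)
  have "\<theta> * m \<le> \<theta> * \<bar>m\<bar>" using \<theta> by (intro mult_left_mono) auto
  also have "\<dots> \<le> (m - \<sigma>) / (\<bar>m\<bar> + 1) * \<bar>m\<bar>"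
    by (intro mult_right_mono) (auto simp: \<theta>_def)
  also have "\<dots> \<le> m - \<sigma>"
    using m by (simp add: field_simps)
  finally have "\<sigma> \<le> (1 - \<theta>) * m" by (simp add: algebra_simps)
  then show ?thesis
    using m \<theta> by (intro that[of \<epsilon> \<theta>]) (auto simp: m_def)
qed

text \<open>
  Only those \<open>y\<close> in the tube about \<open>\<xi>\<close> of radius \<open>r = \<bar>\<xi>\<bar> powr (\<theta> - 1)\<close> have a line \<open>\<real> y\<close> passing within
  \<open>\<approx> \<bar>\<xi>\<bar> r = \<bar>\<xi>\<bar> powr \<theta>\<close> of \<open>\<xi>\<close>; on all other lines the Gaussian decays faster than any power.
\<close>

lemma line_mass_le:
  fixes N :: "'a::euclidean_space measure"
  assumes N: "finite_measure N" and setsN [measurable_cong]: "sets N = sets borel"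
    and N1: "emeasure N (space N) \<le> 1"
    and ann: "AE y in N. a \<le> norm y \<and> norm y \<le> A" and "0 < a" "0 < A"
    and tubes: "\<forall>\<epsilon>>0. \<exists>C>0. \<forall>\<^sub>F \<delta> in at_right 0. \<forall>v. norm v = A \<longrightarrow>
      measure N (tube v \<delta>) \<le> C * (1 / \<delta>) powr \<epsilon> * \<delta> powr s"
    and "\<sigma> < s"
  obtains C where "0 \<le> C" "\<And>\<xi>. (\<integral>\<^sup>+y. \<integral>\<^sup>+t. ennreal (exp (- (norm (\<xi> - t *\<^sub>R y))\<^sup>2 / 4)) \<partial>lborel \<partial>N)
    \<le> ennreal (C * (1 + norm \<xi>) powr (- \<sigma>))"
proof -
  interpret finite_measure N by fact
  obtain \<epsilon> \<theta> where \<epsilon>: "0 < \<epsilon>" and \<theta>: "0 < \<theta>" "\<theta> < 1" and \<sigma>: "\<sigma> \<le> (1 - \<theta>) * (s - \<epsilon>)"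
    using exists_tube_scale[OF \<open>\<sigma> < s\<close>] by blast
  obtain C0 where "C0 > 0" and "\<forall>\<^sub>F \<delta> in at_right 0. \<forall>v. norm v = A \<longrightarrow>
      measure N (tube v \<delta>) \<le> C0 * (1 / \<delta>) powr \<epsilon> * \<delta> powr s"
    using tubes \<epsilon> by blast
  then obtain r0 where "r0 > 0" and r0: "\<And>\<delta> v. 0 < \<delta> \<Longrightarrow> \<delta> < r0 \<Longrightarrow> norm v = A \<Longrightarrow>
      measure N (tube v \<delta>) \<le> C0 * (1 / \<delta>) powr \<epsilon> * \<delta> powr s"
    unfolding eventually_at_right_field by auto
  have "((\<lambda>R::real. R powr (\<theta> - 1)) \<longlongrightarrow> 0) at_top"
    using \<theta> by (intro tendsto_neg_powr filterlim_ident) auto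
  then have "\<forall>\<^sub>F R in at_top. R powr (\<theta> - 1) < r0"
    using \<open>r0 > 0\<close> by (rule order_tendstoD)
  then obtain R1 where R1: "\<And>R. R1 \<le> R \<Longrightarrow> R powr (\<theta> - 1) < r0"
    unfolding eventually_at_top_linorder by blast
  define R0 where "R0 = max 1 R1"
  obtain Ca where Ca: "0 \<le> Ca" "(\<integral>\<^sup>+t. ennreal (exp (- (a * t)\<^sup>2 / 4)) \<partial>lborel) = ennreal Ca"
    using gaussian_integral_finite[OF \<open>0 < a\<close>] .
  \<comment> \<open>Off the tubes the Gaussian is evaluated at distance of order
    \<open>R powr \<theta>\<close>; its decay of order \<open>q\<close> there becomes
    \<open>R powr (- max \<sigma> 0)\<close>.\<close>
  define q where "q = max \<sigma> 0 / \<theta>"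
  have q: "0 \<le> q" "\<theta> * q = max \<sigma> 0" using \<theta> by (auto simp: q_def)
  define c where "c = 1 / (4 * A\<^sup>2)"
  have c: "0 < c" using \<open>0 < A\<close> by (simp add: c_def)
  define K where "K = exp (q\<^sup>2 / (4 * c))"
  have K: "0 \<le> K" by (simp add: K_def)
  define D where "D = Ca * (2 * C0 + K) * 2 powr \<bar>\<sigma>\<bar>"
  have D: "0 \<le> D" using Ca(1) \<open>C0 > 0\<close> K by (simp add: D_def)
  let ?\<rho> = "\<lambda>\<xi> y. (norm \<xi>)\<^sup>2 - (\<xi> \<bullet> y)\<^sup>2 / (norm y)\<^sup>2"
  have \<rho>_nonneg: "0 \<le> ?\<rho> \<xi> y" for \<xi> y :: 'a
  proof (cases "y = 0")
    case False
    have "(\<xi> \<bullet> y)\<^sup>2 \<le> (norm \<xi>)\<^sup>2 * (norm y)\<^sup>2"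
      using Cauchy_Schwarz_ineq[of \<xi> y] by (simp add: power2_norm_eq_inner)
    then show ?thesis
      using False by (simp add: pos_divide_le_eq)
  qed simp
  let ?V = "\<lambda>\<xi>. \<integral>\<^sup>+y. \<integral>\<^sup>+t. ennreal (exp (- (norm (\<xi> - t *\<^sub>R y))\<^sup>2 / 4)) \<partial>lborel \<partial>N"
  show ?thesis
  proof
    show "0 \<le> D + Ca * (1 + R0) powr \<bar>\<sigma>\<bar>" using D Ca(1) by simp
    fix \<xi> :: 'a
    show "?V \<xi> \<le> ennreal ((D + Ca * (1 + R0) powr \<bar>\<sigma>\<bar>) * (1 + norm \<xi>) powr (- \<sigma>))"
    \<comment> \<open>Below \<open>R0\<close> the tube hypothesis says nothing, but the mass is at
      most \<open>Ca\<close> and the weight is bounded below.\<close>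
    proof (cases "norm \<xi> \<le> R0")
      case True
      have "?V \<xi> \<le> (\<integral>\<^sup>+y. ennreal Ca \<partial>N)"
      proof (rule nn_integral_mono_AE)
        show "AE y in N. (\<integral>\<^sup>+t. ennreal (exp (- (norm (\<xi> - t *\<^sub>R y))\<^sup>2 / 4)) \<partial>lborel) \<le> ennreal Ca"
          using ann
        proof eventually_elim
          case (elim y)
          have "ennreal (exp (- ?\<rho> \<xi> y / 4)) \<le> ennreal 1"
            using \<rho>_nonneg[of \<xi> y] by (intro ennreal_leI) simp
          then have "ennreal (exp (- ?\<rho> \<xi> y / 4)) * ennreal Ca \<le> ennreal 1 * ennreal Ca"
            by (rule mult_right_mono) simp
          then show ?case
            using gaussian_line_integral_le[OF \<open>0 < a\<close>, of y \<xi>] elim Ca(2) by auto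
        qed
      qed
      also have "\<dots> = ennreal Ca * emeasure N (space N)"
        by simp
      also have "\<dots> \<le> ennreal Ca * 1"
        by (intro mult_left_mono N1) simp
      also have "\<dots> \<le> ennreal ((D + Ca * (1 + R0) powr \<bar>\<sigma>\<bar>) * (1 + norm \<xi>) powr (- \<sigma>))"
      proof -
        have "Ca * 1 \<le> Ca * ((1 + R0) powr \<bar>\<sigma>\<bar> * (1 + norm \<xi>) powr (- \<sigma>))"
          using True by (intro mult_left_mono one_le_powr_compare Ca(1)) auto
        moreover have "0 \<le> D * (1 + norm \<xi>) powr (- \<sigma>)" using D by simp
        ultimately show ?thesis
          by (simp only: mult_1_right) (intro ennreal_leI, simp add: distrib_right mult.assoc)
      qed
      finally show ?thesis .
    next
      case False
      define R where "R = norm \<xi>"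
      have R: "1 \<le> R" "R1 \<le> R" "0 < R" "\<xi> \<noteq> 0"
        using False by (auto simp: R_def R0_def)
      define r where "r = R powr (\<theta> - 1)"
      have r: "0 < r" "r < r0" using R1[OF R(2)] R by (auto simp: r_def)
      have Rr: "R * r = R powr \<theta>"
        using R powr_add[of R 1 "\<theta> - 1"] by (simp add: r_def)
      define v where "v = (A / norm \<xi>) *\<^sub>R \<xi>"
      have v: "norm v = A" "norm (- v) = A" using R(4) \<open>0 < A\<close> by (auto simp: v_def)
      define T where "T = tube v r \<union> tube (- v) r"
      have [measurable]: "T \<in> sets borel" by (simp add: T_def open_tube)
      then have T: "T \<in> sets N" by (simp add: setsN)
      have tube_le: "measure N (tube u r) \<le> C0 * R powr (- \<sigma>)" if "norm u = A" for u
      proof -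
        have "measure N (tube u r) \<le> C0 * (1 / r) powr \<epsilon> * r powr s"
          by (rule r0[OF r that])
        also have "\<dots> = C0 * r powr (s - \<epsilon>)"
          using r by (simp add: powr_divide powr_diff)
        also have "r powr (s - \<epsilon>) = R powr (- ((1 - \<theta>) * (s - \<epsilon>)))"
          by (simp add: r_def powr_powr algebra_simps)
        also have "C0 * R powr (- ((1 - \<theta>) * (s - \<epsilon>))) \<le> C0 * R powr (- \<sigma>)"
          using \<sigma> R \<open>C0 > 0\<close> by (intro mult_left_mono powr_mono) auto
        finally show ?thesis .
      qed
      have NT: "measure N T \<le> 2 * C0 * R powr (- \<sigma>)"
      proof -
        have "measure N T \<le> measure N (tube v r) + measure N (tube (- v) r)"
          unfolding T_def by (intro measure_Un_le) (auto simp: setsN open_tube)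
        then show ?thesis using tube_le[OF v(1)] tube_le[OF v(2)] by linarith
      qed
      have ex: "exp (- (R * r / A)\<^sup>2 / 4) \<le> K * R powr (- \<sigma>)"
      proof -
        define u where "u = R powr \<theta>"
        have u: "0 < u" using R by (simp add: u_def)
        have "u powr q * exp (- (c * u\<^sup>2)) \<le> (1 + u) powr q * exp (- (c * u\<^sup>2))"
          using u q by (intro mult_right_mono powr_mono2) auto
        also have "\<dots> \<le> K"
          unfolding K_def using u q c by (intro powr_mult_gaussian_le) auto
        finally have "exp (- (c * u\<^sup>2)) \<le> K * u powr (- q)"
          using u unfolding powr_minus by (simp add: field_simps)
        also have "u powr (- q) = R powr (- max \<sigma> 0)"
          using q(2) by (simp add: u_def powr_powr)
        also have "K * R powr (- max \<sigma> 0) \<le> K * R powr (- \<sigma>)"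
          using R K by (intro mult_left_mono powr_mono) auto
        also have "- (c * u\<^sup>2) = - (R * r / A)\<^sup>2 / 4"
          by (simp add: Rr u_def c_def power_divide)
        finally show ?thesis .
      qed
      \<comment> \<open>Inside the tubes the line may pass through \<xi> and only the small mass of
        \<open>T\<close> helps; outside, the smallness of the Gaussian does.\<close>
      have "?V \<xi> \<le> (\<integral>\<^sup>+y. ennreal Ca * (indicator T y + ennreal (K * R powr (- \<sigma>))) \<partial>N)"
      proof (rule nn_integral_mono_AE)
        show "AE y in N. (\<integral>\<^sup>+t. ennreal (exp (- (norm (\<xi> - t *\<^sub>R y))\<^sup>2 / 4)) \<partial>lborel)
            \<le> ennreal Ca * (indicator T y + ennreal (K * R powr (- \<sigma>)))"
          using ann
        proof eventually_elim
          case (elim y)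
          have y: "y \<noteq> 0" using elim \<open>0 < a\<close> by auto
          have "ennreal (exp (- ?\<rho> \<xi> y / 4)) \<le> indicator T y + ennreal (K * R powr (- \<sigma>))"
          proof (cases "y \<in> T")
            case True
            have "ennreal (exp (- ?\<rho> \<xi> y / 4)) \<le> ennreal 1"
              using \<rho>_nonneg[of \<xi> y] by (intro ennreal_leI) simp
            then show ?thesis using True by (simp add: add_increasing2)
          next
            case False
            have "(norm \<xi> * r / A)\<^sup>2 \<le> ?\<rho> \<xi> y"
              by (rule dist_line_outside_tubes[OF R(4) y \<open>0 < A\<close>])
                 (use elim r False in \<open>auto simp: T_def v_def\<close>)
            then have "exp (- ?\<rho> \<xi> y / 4) \<le> exp (- (R * r / A)\<^sup>2 / 4)"
              by (simp add: R_def)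
            also note ex
            finally have "ennreal (exp (- ?\<rho> \<xi> y / 4)) \<le> ennreal (K * R powr (- \<sigma>))"
              by (rule ennreal_leI)
            then show ?thesis by (simp add: add_increasing)
          qed
          then have "ennreal (exp (- ?\<rho> \<xi> y / 4)) * ennreal Ca \<le> (indicator T y + ennreal (K * R powr (- \<sigma>))) * ennreal Ca"
            by (rule mult_right_mono) simp
          then show ?case
            using gaussian_line_integral_le[OF \<open>0 < a\<close>, of y \<xi>] elim unfolding Ca(2) mult.commute[of "ennreal Ca"]
            by (meson order_trans)
        qed
      qed
      also have "\<dots> = ennreal Ca * (\<integral>\<^sup>+y. indicator T y + ennreal (K * R powr (- \<sigma>)) \<partial>N)"
        by (intro nn_integral_cmult) measurable
      also have "(\<integral>\<^sup>+y. indicator T y + ennreal (K * R powr (- \<sigma>)) \<partial>N) = emeasure N T + ennreal (K * R powr (- \<sigma>)) * emeasure N (space N)"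
        using T by (subst nn_integral_add) auto
      also have "ennreal Ca * \<dots> \<le> ennreal Ca * (ennreal (2 * C0 * R powr (- \<sigma>)) + ennreal (K * R powr (- \<sigma>)) * 1)"
        using NT by (intro mult_left_mono add_mono N1) (auto simp: emeasure_eq_measure intro: ennreal_leI)
      also have "\<dots> = ennreal (Ca * (2 * C0 + K) * R powr (- \<sigma>))"
        using Ca(1) K \<open>C0 > 0\<close>
        by (simp add: ennreal_mult[symmetric] ennreal_plus[symmetric] distrib_right distrib_left mult.assoc del: ennreal_plus)
      also have "\<dots> \<le> ennreal ((D + Ca * (1 + R0) powr \<bar>\<sigma>\<bar>) * (1 + norm \<xi>) powr (- \<sigma>))"
      proof (rule ennreal_leI)
        have "Ca * (2 * C0 + K) * R powr (- \<sigma>) \<le> Ca * (2 * C0 + K) * (2 powr \<bar>\<sigma>\<bar> * (1 + R) powr (- \<sigma>))"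
          using Ca(1) K \<open>C0 > 0\<close> by (intro mult_left_mono powr_one_add_compare R(1)) auto
        also have "\<dots> = D * (1 + norm \<xi>) powr (- \<sigma>)"
          by (simp add: D_def R_def mult.assoc)
        also have "\<dots> \<le> (D + Ca * (1 + R0) powr \<bar>\<sigma>\<bar>) * (1 + norm \<xi>) powr (- \<sigma>)"
          using Ca(1) by (intro mult_right_mono) auto
        finally show "Ca * (2 * C0 + K) * R powr (- \<sigma>) \<le> (D + Ca * (1 + R0) powr \<bar>\<sigma>\<bar>) * (1 + norm \<xi>) powr (- \<sigma>)" .
      qed
      finally show ?thesis .
    qed
  qed
qed

text \<open>Since \<open>norm \<xi>\<close> is at most
  \<open>norm (\<xi> - t *\<^sub>R y) + \<bar>t\<bar> * A\<close>, a \<xi> far above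
  \<open>1 / \<delta>\<close> makes one of the two Gaussians small. Half of the exponent of the line
  Gaussian is spent on this cutoff, which is free of \<open>t\<close> and \<open>y\<close>; the
  other half remains, hence the 4.\<close>

lemma gaussian_cutoff_le:
  fixes \<xi> y :: "'a::euclidean_space"
  assumes "0 < \<delta>" "\<delta> \<le> 1" "1 \<le> A" "norm y \<le> A"
  shows "exp (- (\<delta> * t)\<^sup>2 / 2) * exp (- (norm (\<xi> - t *\<^sub>R y))\<^sup>2 / 2)
    \<le> exp (- (1 / (8 * A\<^sup>2) * (\<delta> * norm \<xi>)\<^sup>2)) * exp (- (norm (\<xi> - t *\<^sub>R y))\<^sup>2 / 4)"
proof -
  define n where "n = norm (\<xi> - t *\<^sub>R y)"
  have A: "0 < A" "1 \<le> A\<^sup>2" using assms by (auto simp: one_le_power)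
  have "norm \<xi> \<le> n + norm (t *\<^sub>R y)"
    unfolding n_def using norm_triangle_ineq[of "\<xi> - t *\<^sub>R y" "t *\<^sub>R y"] by simp
  also have "norm (t *\<^sub>R y) \<le> \<bar>t\<bar> * A"
    using assms by (simp add: mult_left_mono)
  finally have "\<delta> * norm \<xi> \<le> \<delta> * (n + \<bar>t\<bar> * A)"
    using assms by (intro mult_left_mono) auto
  also have "\<dots> = \<delta> * n + \<delta> * \<bar>t\<bar> * A" by (simp add: algebra_simps)
  also have "\<delta> * n \<le> n * A"
  proof -
    have "\<delta> * n \<le> 1 * n" using assms by (intro mult_right_mono) (auto simp: n_def)
    also have "1 * n \<le> A * n" using assms by (intro mult_right_mono) (auto simp: n_def)
    finally show ?thesis by (simp add: mult.commute)
  qed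
  finally have "\<delta> * norm \<xi> \<le> (n + \<delta> * \<bar>t\<bar>) * A"
    by (simp add: algebra_simps)
  then have "(\<delta> * norm \<xi>)\<^sup>2 \<le> ((n + \<delta> * \<bar>t\<bar>) * A)\<^sup>2"
    using assms by (intro power_mono) auto
  also have "\<dots> = (n + \<delta> * \<bar>t\<bar>)\<^sup>2 * A\<^sup>2"
    by (rule power_mult_distrib)
  also have "\<dots> \<le> (2 * n\<^sup>2 + 2 * (\<delta> * t)\<^sup>2) * A\<^sup>2"
  proof (rule mult_right_mono)
    have "0 \<le> (n - \<delta> * \<bar>t\<bar>)\<^sup>2" by simp
    also have "\<dots> = 2 * n\<^sup>2 + 2 * (\<delta> * t)\<^sup>2 - (n + \<delta> * \<bar>t\<bar>)\<^sup>2"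
      by (simp add: power2_eq_square algebra_simps abs_mult_self_eq)
    finally show "(n + \<delta> * \<bar>t\<bar>)\<^sup>2 \<le> 2 * n\<^sup>2 + 2 * (\<delta> * t)\<^sup>2" by simp
  qed simp
  finally have "1 / (8 * A\<^sup>2) * (\<delta> * norm \<xi>)\<^sup>2 \<le> (n\<^sup>2 + (\<delta> * t)\<^sup>2) / 4"
    using A by (simp add: field_simps)
  moreover have "0 \<le> (\<delta> * t)\<^sup>2" by simp
  ultimately have "- (\<delta> * t)\<^sup>2 / 2 + - n\<^sup>2 / 2 \<le> - (1 / (8 * A\<^sup>2) * (\<delta> * norm \<xi>)\<^sup>2) + - n\<^sup>2 / 4"
    by argo
  then show ?thesis
    unfolding n_def[symmetric] exp_add[symmetric] exp_le_cancel_iff .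
qed

text \<open>With \<xi> outermost, integrating \<open>t\<close> and \<open>y\<close> gives the line
  mass. The cutoff yields \<open>\<delta> powr (- (1 - \<alpha>))\<close> and extra decay 1 -
  \<alpha>, and the prefactor \<delta> restores \<open>\<delta> powr \<alpha>\<close>.\<close>

lemma slab_integral_le_of_tubes:
  fixes M N :: "'a::euclidean_space measure"
  assumes F: "frostman_measure E s' M" and MD: "AE x in M. norm x \<le> D"
    and N: "finite_measure N" and setsN [measurable_cong]: "sets N = sets borel"
    and N1: "emeasure N (space N) \<le> 1"
    and ann: "AE y in N. a \<le> norm y \<and> norm y \<le> A" and "0 < a" "1 \<le> A"
    and tubes: "\<forall>\<epsilon>>0. \<exists>C>0. \<forall>\<^sub>F \<delta> in at_right 0. \<forall>v. norm v = A \<longrightarrow>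
      measure N (tube v \<delta>) \<le> C * (1 / \<delta>) powr \<epsilon> * \<delta> powr s"
    and \<alpha>: "\<alpha> \<le> 1" "real DIM('a) < s' + s + 1 - \<alpha>"
  obtains C where "\<And>\<delta>. 0 < \<delta> \<Longrightarrow> \<delta> \<le> 1 \<Longrightarrow>
    (\<integral>\<^sup>+y. \<integral>\<^sup>+x. slab M y \<delta> x \<partial>M \<partial>N) \<le> ennreal (C * \<delta> powr \<alpha>)"
proof -
  interpret N: finite_measure N by fact
  interpret M: prob_space M
    using F unfolding frostman_measure_def by blast
  have setsM [measurable_cong]: "sets M = sets borel"
    using F unfolding frostman_measure_def by blast
  note Mf = M.finite_measure_axioms
  have [measurable]: "power_spectrum M \<in> borel_measurable borel"
    by (rule borel_measurable_power_spectrum[OF Mf setsM])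
  interpret NL: pair_sigma_finite lborel N ..
  \<comment> \<open>The midpoint of the admissible interval: below \<open>s\<close> for the line
    mass, and large enough for the spectrum to be integrable against the exponent \<sigma> + 1 -
    \<alpha>. The interval is non-empty by the dimension inequality.\<close>
  define \<sigma> where "\<sigma> = (s + (real DIM('a) - s' - 1 + \<alpha>)) / 2"
  have \<sigma>: "\<sigma> < s" "real DIM('a) - s' < \<sigma> + (1 - \<alpha>)"
    using \<alpha> by (auto simp: \<sigma>_def field_simps)
  obtain CV where CV: "0 \<le> CV" "\<And>\<xi>. (\<integral>\<^sup>+y. \<integral>\<^sup>+t. ennreal (exp (- (norm (\<xi> - t *\<^sub>R y))\<^sup>2 / 4)) \<partial>lborel \<partial>N)
      \<le> ennreal (CV * (1 + norm \<xi>) powr (- \<sigma>))"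
    by (rule line_mass_le[OF N setsN N1 ann \<open>0 < a\<close> _ tubes \<sigma>(1)]) (use \<open>1 \<le> A\<close> in auto)
  have "(\<integral>\<^sup>+\<xi>. ennreal ((1 + norm \<xi>) powr (- (\<sigma> + (1 - \<alpha>))) * power_spectrum M \<xi>) \<partial>lborel) < \<infinity>"
    by (rule spectrum_integral_finite[OF F \<sigma>(2)])
  then obtain I where I: "0 \<le> I"
    "(\<integral>\<^sup>+\<xi>. ennreal ((1 + norm \<xi>) powr (- (\<sigma> + (1 - \<alpha>))) * power_spectrum M \<xi>) \<partial>lborel) = ennreal I"
    by (auto simp: less_top_ennreal)
  define c where "c = 1 / (8 * A\<^sup>2)"
  have c: "0 < c" using \<open>1 \<le> A\<close> by (simp add: c_def)
  define K where "K = exp ((1 - \<alpha>)\<^sup>2 / (4 * c))"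
  define B where "B = exp (1/2 + 2 * D\<^sup>2)"
  have K: "0 \<le> K" and B: "0 \<le> B" by (simp_all add: K_def B_def)
  show ?thesis
  proof
    fix \<delta> :: real assume \<delta>: "0 < \<delta>" "\<delta> \<le> 1"
    let ?f = "\<lambda>y t \<xi>. ennreal (exp (- (\<delta> * t)\<^sup>2 / 2)) * ennreal (exp (- (norm (\<xi> - t *\<^sub>R y))\<^sup>2 / 2) * power_spectrum M \<xi>)"
    let ?h = "\<lambda>y t \<xi>. ennreal (exp (- (norm (\<xi> - t *\<^sub>R y))\<^sup>2 / 4))"
    let ?w = "\<lambda>\<xi>. ennreal (exp (- (c * (\<delta> * norm \<xi>)\<^sup>2)) * power_spectrum M \<xi>)"
    have "(\<integral>\<^sup>+y. \<integral>\<^sup>+x. slab M y \<delta> x \<partial>M \<partial>N) \<le> (\<integral>\<^sup>+y. ennreal (B * \<delta>) * (\<integral>\<^sup>+t. \<integral>\<^sup>+\<xi>. ?f y t \<xi> \<partial>lborel \<partial>lborel) \<partial>N)"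
      unfolding B_def by (intro nn_integral_mono slab_integral_le_spectrum[OF Mf setsM \<delta>(1) MD])
    also have "\<dots> = ennreal (B * \<delta>) * (\<integral>\<^sup>+y. \<integral>\<^sup>+t. \<integral>\<^sup>+\<xi>. ?f y t \<xi> \<partial>lborel \<partial>lborel \<partial>N)"
      by (rule nn_integral_cmult) measurable
    also have "\<dots> \<le> ennreal (B * \<delta>) * (\<integral>\<^sup>+y. \<integral>\<^sup>+t. \<integral>\<^sup>+\<xi>. ?w \<xi> * ?h y t \<xi> \<partial>lborel \<partial>lborel \<partial>N)"
    proof (intro mult_left_mono nn_integral_mono_AE)
      show "AE y in N. (\<integral>\<^sup>+t. \<integral>\<^sup>+\<xi>. ?f y t \<xi> \<partial>lborel \<partial>lborel) \<le> (\<integral>\<^sup>+t. \<integral>\<^sup>+\<xi>. ?w \<xi> * ?h y t \<xi> \<partial>lborel \<partial>lborel)"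
        using ann
      proof eventually_elim
        case (elim y)
        show ?case
        proof (intro nn_integral_mono)
          fix t \<xi>
          have "exp (- (\<delta> * t)\<^sup>2 / 2) * exp (- (norm (\<xi> - t *\<^sub>R y))\<^sup>2 / 2) * power_spectrum M \<xi>
              \<le> exp (- (c * (\<delta> * norm \<xi>)\<^sup>2)) * exp (- (norm (\<xi> - t *\<^sub>R y))\<^sup>2 / 4) * power_spectrum M \<xi>"
            unfolding c_def using elim \<open>1 \<le> A\<close> \<delta> by (intro mult_right_mono gaussian_cutoff_le) auto
          from ennreal_leI[OF this] show "?f y t \<xi> \<le> ?w \<xi> * ?h y t \<xi>"
            by (simp add: ennreal_mult[symmetric] mult_ac)
        qed
      qed
    qed simp
    also have "(\<integral>\<^sup>+y. \<integral>\<^sup>+t. \<integral>\<^sup>+\<xi>. ?w \<xi> * ?h y t \<xi> \<partial>lborel \<partial>lborel \<partial>N)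
        = (\<integral>\<^sup>+y. \<integral>\<^sup>+\<xi>. \<integral>\<^sup>+t. ?w \<xi> * ?h y t \<xi> \<partial>lborel \<partial>lborel \<partial>N)"
      by (intro nn_integral_cong lborel_pair.Fubini') measurable
    also have "\<dots> = (\<integral>\<^sup>+\<xi>. \<integral>\<^sup>+y. \<integral>\<^sup>+t. ?w \<xi> * ?h y t \<xi> \<partial>lborel \<partial>N \<partial>lborel)"
      by (intro NL.Fubini') measurable
    also have "\<dots> = (\<integral>\<^sup>+\<xi>. ?w \<xi> * (\<integral>\<^sup>+y. \<integral>\<^sup>+t. ?h y t \<xi> \<partial>lborel \<partial>N) \<partial>lborel)"
    proof (rule nn_integral_cong)
      fix \<xi> :: 'a
      have "(\<integral>\<^sup>+y. \<integral>\<^sup>+t. ?w \<xi> * ?h y t \<xi> \<partial>lborel \<partial>N) = (\<integral>\<^sup>+y. ?w \<xi> * (\<integral>\<^sup>+t. ?h y t \<xi> \<partial>lborel) \<partial>N)"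
        by (intro nn_integral_cong nn_integral_cmult) measurable
      also have "\<dots> = ?w \<xi> * (\<integral>\<^sup>+y. \<integral>\<^sup>+t. ?h y t \<xi> \<partial>lborel \<partial>N)"
        by (rule nn_integral_cmult) measurable
      finally show "(\<integral>\<^sup>+y. \<integral>\<^sup>+t. ?w \<xi> * ?h y t \<xi> \<partial>lborel \<partial>N) = ?w \<xi> * (\<integral>\<^sup>+y. \<integral>\<^sup>+t. ?h y t \<xi> \<partial>lborel \<partial>N)" .
    qed
    also have "\<dots> \<le> (\<integral>\<^sup>+\<xi>. ennreal (K * CV * \<delta> powr (- (1 - \<alpha>))) *
        ennreal ((1 + norm \<xi>) powr (- (\<sigma> + (1 - \<alpha>))) * power_spectrum M \<xi>) \<partial>lborel)"
    proof (rule nn_integral_mono)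
      fix \<xi> :: 'a
      have "exp (- (c * (\<delta> * norm \<xi>)\<^sup>2)) \<le> K * \<delta> powr (- (1 - \<alpha>)) * (1 + norm \<xi>) powr (- (1 - \<alpha>))"
        unfolding K_def using \<alpha>(1) c \<delta> by (intro gaussian_le_scaled_powr) auto
      then have "exp (- (c * (\<delta> * norm \<xi>)\<^sup>2)) * power_spectrum M \<xi> * (CV * (1 + norm \<xi>) powr (- \<sigma>))
          \<le> K * \<delta> powr (- (1 - \<alpha>)) * (1 + norm \<xi>) powr (- (1 - \<alpha>)) * power_spectrum M \<xi> * (CV * (1 + norm \<xi>) powr (- \<sigma>))"
        using CV(1) by (intro mult_right_mono) auto
      also have "\<dots> = K * CV * \<delta> powr (- (1 - \<alpha>)) * ((1 + norm \<xi>) powr (- \<sigma>) * (1 + norm \<xi>) powr (- (1 - \<alpha>)) * power_spectrum M \<xi>)"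
        by (simp only: mult_ac)
      also have "(1 + norm \<xi>) powr (- \<sigma>) * (1 + norm \<xi>) powr (- (1 - \<alpha>)) = (1 + norm \<xi>) powr (- (\<sigma> + (1 - \<alpha>)))"
        by (simp add: powr_add[symmetric])
      finally have le: "exp (- (c * (\<delta> * norm \<xi>)\<^sup>2)) * power_spectrum M \<xi> * (CV * (1 + norm \<xi>) powr (- \<sigma>))
          \<le> K * CV * \<delta> powr (- (1 - \<alpha>)) * ((1 + norm \<xi>) powr (- (\<sigma> + (1 - \<alpha>))) * power_spectrum M \<xi>)" .
      have "?w \<xi> * (\<integral>\<^sup>+y. \<integral>\<^sup>+t. ?h y t \<xi> \<partial>lborel \<partial>N) \<le> ?w \<xi> * ennreal (CV * (1 + norm \<xi>) powr (- \<sigma>))"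
        by (intro mult_left_mono CV(2)) simp
      also have "\<dots> = ennreal (exp (- (c * (\<delta> * norm \<xi>)\<^sup>2)) * power_spectrum M \<xi> * (CV * (1 + norm \<xi>) powr (- \<sigma>)))"
        using CV(1) by (intro ennreal_mult[symmetric]) auto
      also have "\<dots> \<le> ennreal (K * CV * \<delta> powr (- (1 - \<alpha>)) * ((1 + norm \<xi>) powr (- (\<sigma> + (1 - \<alpha>))) * power_spectrum M \<xi>))"
        by (rule ennreal_leI[OF le])
      also have "\<dots> = ennreal (K * CV * \<delta> powr (- (1 - \<alpha>))) * ennreal ((1 + norm \<xi>) powr (- (\<sigma> + (1 - \<alpha>))) * power_spectrum M \<xi>)"
        using CV(1) K by (intro ennreal_mult) auto
      finally show "?w \<xi> * (\<integral>\<^sup>+y. \<integral>\<^sup>+t. ?h y t \<xi> \<partial>lborel \<partial>N)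
          \<le> ennreal (K * CV * \<delta> powr (- (1 - \<alpha>))) * ennreal ((1 + norm \<xi>) powr (- (\<sigma> + (1 - \<alpha>))) * power_spectrum M \<xi>)" .
    qed
    also have "\<dots> = ennreal (K * CV * \<delta> powr (- (1 - \<alpha>))) * ennreal I"
      unfolding I(2)[symmetric] by (rule nn_integral_cmult) measurable
    finally have "(\<integral>\<^sup>+y. \<integral>\<^sup>+x. slab M y \<delta> x \<partial>M \<partial>N) \<le> ennreal (B * \<delta>) * (ennreal (K * CV * \<delta> powr (- (1 - \<alpha>))) * ennreal I)"
      by (simp add: mult_left_mono)
    also have "\<dots> = ennreal (B * \<delta> * (K * CV * \<delta> powr (- (1 - \<alpha>)) * I))"
      using B K CV(1) I(1) \<delta> by (simp only: ennreal_mult[symmetric] mult_nonneg_nonneg powr_ge_zero less_imp_le)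
    also have "B * \<delta> * (K * CV * \<delta> powr (- (1 - \<alpha>)) * I) = B * K * CV * I * (\<delta> powr 1 * \<delta> powr (- (1 - \<alpha>)))"
      using \<delta> by simp
    also have "\<delta> powr 1 * \<delta> powr (- (1 - \<alpha>)) = \<delta> powr \<alpha>"
      by (simp only: powr_add[symmetric]) simp
    finally show "(\<integral>\<^sup>+y. \<integral>\<^sup>+x. slab M y \<delta> x \<partial>M \<partial>N) \<le> ennreal (B * K * CV * I * \<delta> powr \<alpha>)" .
  qed
qed

section \<open>Compact support, annuli and the conclusion\<close>

lemma AE_in_measure_support:
  fixes M :: "'a::euclidean_space measure"
  assumes setsM: "sets M = sets borel"
  shows "AE x in M. x \<in> measure_support M"
proof -
  define \<U> where "\<U> = {U. open U \<and> emeasure M U = 0}"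
  obtain \<V> where \<V>: "\<V> \<subseteq> \<U>" "countable \<V>" "\<Union>\<V> = \<Union>\<U>"
    using Lindelof[of \<U>] by (auto simp: \<U>_def)
  have "AE x in M. \<forall>U\<in>\<V>. x \<notin> U"
    unfolding AE_ball_countable[OF \<V>(2)]
    using \<V>(1) by (auto simp: \<U>_def setsM intro!: AE_not_in null_setsI)
  then show ?thesis
  proof eventually_elim
    case (elim x)
    then have "x \<notin> \<Union>\<U>" using \<V>(3) by blast
    then show ?case
      by (auto simp: measure_support_def \<U>_def zero_less_iff_neq_zero)
  qed
qed

lemma frostman_bounded:
  fixes M :: "'a::euclidean_space measure"
  assumes F: "frostman_measure E s M"
  obtains D where "AE x in M. norm x \<le> D"
proof -
  have "compact (measure_support M)" and setsM: "sets M = sets borel"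
    using F unfolding frostman_measure_def by blast+
  then obtain D where D: "\<And>x. x \<in> measure_support M \<Longrightarrow> norm x \<le> D"
    using compact_imp_bounded bounded_iff by metis
  show ?thesis
    using AE_in_measure_support[OF setsM] by (intro that[of D]) (auto elim!: eventually_mono intro: D)
qed

lemma emeasure_density_indicator_le:
  assumes "S \<in> sets M" "X \<in> sets M"
  shows "emeasure (density M (indicator S)) X \<le> emeasure M X"
proof -
  have "emeasure (density M (indicator S)) X = (\<integral>\<^sup>+y. indicator S y * indicator X y \<partial>M)"
    using assms by (intro emeasure_density) auto
  also have "\<dots> \<le> (\<integral>\<^sup>+y. indicator X y \<partial>M)"
    by (intro nn_integral_mono) (auto simp: indicator_def)
  finally show ?thesis using assms by simp
qed

text \<open>The tube estimates have constants depending on \<open>a\<close>, but countably many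
  \<open>a\<close> exhaust the complement of the origin.\<close>

lemma AE_of_AE_annuli:
  fixes M :: "'a::euclidean_space measure"
  assumes setsM [measurable_cong]: "sets M = sets borel" and "finite_measure M" and zero: "measure M {0} = 0"
    and AE: "\<And>a. 0 < a \<Longrightarrow> AE y in density M (indicator {y. a \<le> norm y}). P y"
  shows "AE y in M. P y"
proof -
  interpret finite_measure M by fact
  have "AE y in M. \<forall>n. 1 / real (Suc n) \<le> norm y \<longrightarrow> P y"
    unfolding AE_all_countable
  proof
    fix n
    have "AE y in M. 0 < (indicator {y. 1 / real (Suc n) \<le> norm y} y :: ennreal) \<longrightarrow> P y"
      using AE[of "1 / real (Suc n)"]
        AE_density[of "indicator {y. 1 / real (Suc n) \<le> norm y}" M P] by auto
    then show "AE y in M. 1 / real (Suc n) \<le> norm y \<longrightarrow> P y"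
      by eventually_elim (auto simp: indicator_def)
  qed
  moreover have "AE y in M. y \<notin> {0}"
    using zero by (intro AE_not_in null_setsI) (auto simp: emeasure_eq_measure setsM)
  ultimately show ?thesis
  proof eventually_elim
    case (elim y)
    then obtain n where "1 / real (Suc n) < norm y"
      using reals_Archimedean[of "norm y"] by (auto simp: inverse_eq_divide)
    then show ?case using elim by (auto dest: less_imp_le)
  qed
qed

lemma slab_integral_le_on_annulus:
  fixes M N :: "'a::euclidean_space measure"
  assumes FM: "frostman_measure E s' M" and FN: "frostman_measure F s'' N"
    and tubes: "\<forall>K\<ge>1. \<forall>\<epsilon>>0. \<exists>C>0. \<forall>\<^sub>F \<delta> in at_right 0. \<forall>v \<rho>.
           1 / K \<le> norm v \<and> norm v \<le> K \<and> \<delta> / K \<le> \<rho> \<and> \<rho> \<le> K * \<delta> \<longrightarrow>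
           measure N (tube v \<rho>) \<le> C * (1 / \<delta>) powr \<epsilon> * \<delta> powr s"
    and \<alpha>: "\<alpha> \<le> 1" "real DIM('a) < s' + s + 1 - \<alpha>" and "0 < a"
  obtains C where "\<And>\<delta>. 0 < \<delta> \<Longrightarrow> \<delta> \<le> 1 \<Longrightarrow>
    (\<integral>\<^sup>+y. \<integral>\<^sup>+x. slab M y \<delta> x \<partial>M \<partial>(density N (indicator {y. a \<le> norm y}))) \<le> ennreal (C * \<delta> powr \<alpha>)"
proof -
  interpret N: prob_space N
    using FN unfolding frostman_measure_def by blast
  have setsN [measurable_cong]: "sets N = sets borel"
    using FN unfolding frostman_measure_def by blast
  obtain D where D: "AE x in M. norm x \<le> D"
    using frostman_bounded[OF FM] .
  obtain A' where A': "AE y in N. norm y \<le> A'"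
    using frostman_bounded[OF FN] .
  define A where "A = max 1 A'"
  have A: "1 \<le> A" "AE y in N. norm y \<le> A"
    using A' by (auto simp: A_def elim!: eventually_mono)
  let ?N = "density N (indicator {y. a \<le> norm y})"
  have le: "emeasure ?N X \<le> emeasure N X" if "X \<in> sets N" for X
    using that by (intro emeasure_density_indicator_le) (simp_all add: setsN)
  have N1: "emeasure ?N (space ?N) \<le> 1"
    using le[of "space N"] by (simp add: N.emeasure_space_1)
  have finN: "finite_measure ?N"
    using N1 by (intro finite_measureI) (auto simp: top_unique)
  interpret N': finite_measure ?N by (rule finN)
  have ann: "AE y in ?N. a \<le> norm y \<and> norm y \<le> A"
    using A(2) by (subst AE_density) (auto elim!: eventually_mono simp: indicator_def)
  have tubes': "\<forall>\<epsilon>>0. \<exists>C>0. \<forall>\<^sub>F \<delta> in at_right 0. \<forall>v. norm v = A \<longrightarrow>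
      measure ?N (tube v \<delta>) \<le> C * (1 / \<delta>) powr \<epsilon> * \<delta> powr s"
  proof (intro allI impI)
    fix \<epsilon> :: real assume "\<epsilon> > 0"
    \<comment> \<open>\<open>K = A\<close> admits length exactly \<open>A\<close> and radius exactly
      \<delta>, because \<open>1 \<le> A\<close>.\<close>
    then obtain C where "C > 0" and C: "\<forall>\<^sub>F \<delta> in at_right 0. \<forall>v \<rho>.
           1 / A \<le> norm v \<and> norm v \<le> A \<and> \<delta> / A \<le> \<rho> \<and> \<rho> \<le> A * \<delta> \<longrightarrow>
           measure N (tube v \<rho>) \<le> C * (1 / \<delta>) powr \<epsilon> * \<delta> powr s"
      using tubes A(1) by blast
    have pos: "\<forall>\<^sub>F \<delta> in at_right (0::real). 0 < \<delta>"
      by (rule eventually_at_right_less)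
    have "\<forall>\<^sub>F \<delta> in at_right 0. \<forall>v. norm v = A \<longrightarrow>
        measure ?N (tube v \<delta>) \<le> C * (1 / \<delta>) powr \<epsilon> * \<delta> powr s"
      using C pos
    proof eventually_elim
      case (elim \<delta>)
      show ?case
      proof (intro allI impI)
        fix v :: 'a assume v: "norm v = A"
        have "1 / A \<le> A" using A(1) order_trans[of "1 / A" 1 A] by simp
        moreover have "\<delta> / A \<le> \<delta>" "\<delta> \<le> A * \<delta>"
          using A(1) elim(2) by (simp_all add: pos_divide_le_eq mult_le_cancel_left1 mult_le_cancel_right1)
        ultimately have N_le: "measure N (tube v \<delta>) \<le> C * (1 / \<delta>) powr \<epsilon> * \<delta> powr s"
          using elim(1) v by blast
        have "ennreal (measure ?N (tube v \<delta>)) \<le> ennreal (measure N (tube v \<delta>))"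
          using le[of "tube v \<delta>"] open_tube[of v \<delta>]
          by (simp add: N'.emeasure_eq_measure N.emeasure_eq_measure setsN)
        then show "measure ?N (tube v \<delta>) \<le> C * (1 / \<delta>) powr \<epsilon> * \<delta> powr s"
          using N_le by simp
      qed
    qed
    then show "\<exists>C>0. \<forall>\<^sub>F \<delta> in at_right 0. \<forall>v. norm v = A \<longrightarrow>
        measure ?N (tube v \<delta>) \<le> C * (1 / \<delta>) powr \<epsilon> * \<delta> powr s"
      using \<open>C > 0\<close> by blast
  qed
  show ?thesis
    by (rule slab_integral_le_of_tubes[OF FM D finN _ N1 ann \<open>0 < a\<close> A(1) tubes' \<alpha>])
       (auto simp: setsN intro: that)
qed

(* The premise of the first conjunct excludes only measures with an atom at the origin when
   sF = 0; for these the claim fails (muF the point mass at 0, projection onto y = 0). If 0 < sF,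
   muF has no atoms. *)
theorem theorem1p0p3:
  fixes E F :: "(real ^ 'd) set"
    and muE muF :: "(real ^ 'd) measure"
    and sE sF gammaF lF :: real
  assumes "CARD('d) \<ge> 2"
    and "hausdorff_dim E = ereal sE"
    and "hausdorff_dim F = ereal sF"
    and "frostman_measure E sE muE"
    and "frostman_measure F sF muF"
    and "gammaF \<ge> 0" and "lF \<ge> 0"
    and "\<forall>\<epsilon>>0. \<exists>C>0. \<forall>\<^sub>F \<xi> in at_infinity.
           norm (fourier_measure muF \<xi>) \<le> C * norm \<xi> powr \<epsilon> * norm \<xi> powr (- gammaF)"
    and "\<forall>K\<ge>1. \<forall>\<epsilon>>0. \<exists>C>0. \<forall>\<^sub>F \<delta> in at_right 0. \<forall>v \<rho>.
           1 / K \<le> norm v \<and> norm v \<le> K \<and> \<delta> / K \<le> \<rho> \<and> \<rho> \<le> K * \<delta> \<longrightarrow>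
           measure muF (tube v \<rho>) \<le> C * (1 / \<delta>) powr \<epsilon> * \<delta> powr (sF - lF)"
  shows "(0 < sF \<or> measure muF {0} = 0 \<longrightarrow>
           (\<forall>\<alpha>. 0 < \<alpha> \<and> \<alpha> \<le> 1 \<and>
              max (min gammaF sE / \<alpha>) ((sE + sF - lF + 1 - \<alpha>) / real CARD('d)) > 1 \<longrightarrow>
              (AE y in muF. y \<in> F \<longrightarrow> hausdorff_dim (projection_set y E) \<ge> ereal \<alpha>))) \<and>
         (max (min gammaF sE) ((sE + sF - lF) / real CARD('d)) > 1 \<longrightarrow>
              (AE y in muF. y \<in> F \<longrightarrow> outer_measure_of lborel (projection_set y E) > 0))"
proof -
  note muE = assms(4) and muF = assms(5) and decay = assms(8) and tubes = assms(9)
  have ME: "prob_space muE" "sets muE = sets borel" "AE x in muE. x \<in> E"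
    using muE unfolding frostman_measure_def by blast+
  have MF: "prob_space muF" "sets muF = sets borel"
    using muF unfolding frostman_measure_def by blast+
  interpret F: prob_space muF by (rule MF(1))
  let ?N = "\<lambda>a. density muF (indicator {y. a \<le> norm y})"
  have N: "finite_measure (?N a)" "sets (?N a) = sets borel" for a
  proof -
    have "emeasure (?N a) (space muF) \<le> emeasure muF (space muF)"
      by (rule emeasure_density_indicator_le[OF _ sets.top]) (simp add: MF(2))
    then show "finite_measure (?N a)"
      by (intro finite_measureI) (auto simp: F.emeasure_space_1 top_unique)
  qed (simp add: MF(2))
  have decay_bound: "\<exists>C. \<forall>\<delta>. 0 < \<delta> \<longrightarrow> (\<integral>\<^sup>+y. \<integral>\<^sup>+x. slab muE y \<delta> x \<partial>muE \<partial>muF) \<le> ennreal (C * \<delta> powr \<alpha>)"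
    if "0 < \<alpha>" "\<alpha> \<le> 1" "\<alpha> < gammaF" "\<alpha> < sE" for \<alpha>
    using slab_integral_le_of_fourier_decay[OF muE MF decay that] by blast
  have tube_bound: "\<exists>C. \<forall>\<delta>. 0 < \<delta> \<longrightarrow> \<delta> \<le> 1 \<longrightarrow>
      (\<integral>\<^sup>+y. \<integral>\<^sup>+x. slab muE y \<delta> x \<partial>muE \<partial>(?N a)) \<le> ennreal (C * \<delta> powr \<alpha>)"
    if "\<alpha> \<le> 1" "(sE + sF - lF + 1 - \<alpha>) / real CARD('d) > 1" "0 < a" for \<alpha> a
  proof -
    have "real DIM(real ^ 'd) < sE + (sF - lF) + 1 - \<alpha>"
      using that(2) by (simp add: field_simps)
    from slab_integral_le_on_annulus[OF muE muF tubes that(1) this that(3)] show ?thesis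
      by blast
  qed
  show ?thesis
  proof (intro conjI impI allI)
    fix \<alpha> assume origin: "0 < sF \<or> measure muF {0} = 0"
      and \<alpha>: "0 < \<alpha> \<and> \<alpha> \<le> 1 \<and> max (min gammaF sE / \<alpha>) ((sE + sF - lF + 1 - \<alpha>) / real CARD('d)) > 1"
    have "AE y in muF. ereal \<alpha> \<le> hausdorff_dim (projection_set y E)"
    proof (cases "min gammaF sE / \<alpha> > 1")
      case True
      then have "\<alpha> < gammaF" "\<alpha> < sE" using \<alpha> by (auto simp: field_simps)
      then obtain C where "\<And>\<delta>. 0 < \<delta> \<Longrightarrow>
          (\<integral>\<^sup>+y. \<integral>\<^sup>+x. slab muE y \<delta> x \<partial>muE \<partial>muF) \<le> ennreal (C * \<delta> powr \<alpha>)"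
        using decay_bound \<alpha> by blast
      then show ?thesis
        using \<alpha> by (intro AE_hausdorff_dim_projection_ge[OF ME(1,2) F.finite_measure_axioms MF(2) ME(3)]) auto
    next
      case False
      then have gt: "(sE + sF - lF + 1 - \<alpha>) / real CARD('d) > 1"
        using \<alpha> unfolding less_max_iff_disj by blast
      show ?thesis
      proof (rule AE_of_AE_annuli[OF MF(2) F.finite_measure_axioms])
        show "measure muF {0} = 0"
          using origin frostman_singleton_null[OF muF] by blast
        fix a :: real assume "0 < a"
        then obtain C where "\<And>\<delta>. 0 < \<delta> \<Longrightarrow> \<delta> \<le> 1 \<Longrightarrow>
            (\<integral>\<^sup>+y. \<integral>\<^sup>+x. slab muE y \<delta> x \<partial>muE \<partial>(?N a)) \<le> ennreal (C * \<delta> powr \<alpha>)"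
          using tube_bound[OF _ gt] \<alpha> by blast
        then show "AE y in ?N a. ereal \<alpha> \<le> hausdorff_dim (projection_set y E)"
          using \<alpha> by (intro AE_hausdorff_dim_projection_ge[OF ME(1,2) N ME(3)]) auto
      qed
    qed
    then show "AE y in muF. y \<in> F \<longrightarrow> hausdorff_dim (projection_set y E) \<ge> ereal \<alpha>"
      by eventually_elim simp
  next
    assume gt: "max (min gammaF sE) ((sE + sF - lF) / real CARD('d)) > 1"
    have "AE y in muF. 0 < outer_measure_of lborel (projection_set y E)"
    proof (cases "min gammaF sE > 1")
      case True
      then obtain C where "\<And>\<delta>. 0 < \<delta> \<Longrightarrow>
          (\<integral>\<^sup>+y. \<integral>\<^sup>+x. slab muE y \<delta> x \<partial>muE \<partial>muF) \<le> ennreal (C * \<delta> powr 1)"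
        using decay_bound[of 1] by auto
      then show ?thesis
        by (intro AE_outer_measure_projection_pos[OF ME(1,2) F.finite_measure_axioms MF(2) ME(3), of C]) simp
    next
      case False
      then have "(sE + sF - lF) / real CARD('d) > 1"
        using gt unfolding less_max_iff_disj by blast
      then have gt': "(sE + sF - lF + 1 - 1) / real CARD('d) > 1"
        by simp
      \<comment> \<open>The inequality gives \<open>real CARD('d) < sE + sF - lF\<close>, so this
        bound and \<open>0 \<le> lF\<close> force \<open>0 < sF\<close>, and the origin is a null
        set.\<close>
      have "sE \<le> real CARD('d)"
        using frostman_exponent_le_dim[OF muE] by simp
      then have "0 < sF"
        using gt' \<open>lF \<ge> 0\<close> by (simp add: field_simps)
      show ?thesis
      proof (rule AE_of_AE_annuli[OF MF(2) F.finite_measure_axioms])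
        show "measure muF {0} = 0"
          using \<open>0 < sF\<close> frostman_singleton_null[OF muF] by blast
        fix a :: real assume "0 < a"
        then obtain C where C: "\<And>\<delta>. 0 < \<delta> \<Longrightarrow> \<delta> \<le> 1 \<Longrightarrow>
            (\<integral>\<^sup>+y. \<integral>\<^sup>+x. slab muE y \<delta> x \<partial>muE \<partial>(?N a)) \<le> ennreal (C * \<delta> powr 1)"
          using tube_bound[OF order_refl gt'] by blast
        then show "AE y in ?N a. 0 < outer_measure_of lborel (projection_set y E)"
          by (intro AE_outer_measure_projection_pos[OF ME(1,2) N ME(3), of a C]) simp
      qed
    qed
    then show "AE y in muF. y \<in> F \<longrightarrow> outer_measure_of lborel (projection_set y E) > 0"
      by eventually_elim simp
  qed
qed

end
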